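(* Let $D$ be a braid diagram with a $\chi$-coloring, and let $\mathfrak f,\mathfrak f'$ be two log-colorings of it that agree on all boundary segments and boundary regions and have the same meridian parameters $\mu_i$. Let $\lambda_i,\lambda_i'$ be the log-longitudes of component $i$ for $\mathfrak f,\mathfrak f'$. Then \[ J(D,\chi,\mathfrak f')=\exp\Big(-\frac{2\pi i}{N}\sum_i(\lambda_i'-\lambda_i)\mu_i\Big)\,J(D,\chi,\mathfrak f). \] In particular $J(D,\chi,\mathfrak f)$ is independent of the internal region log-parameters and depends on the internal segment log-parameters only through the log-longitudes.
   Context: $N\ge2$, $\omega^x=e^{2\pi ix/N}$, and $V(\alpha,\beta,\mu)=\mathbb C^N$ with basis $\hat v_n$ ($n\in\mathbb Z/N$). A braid diagram is a word in the braid generators $\sigma_i^{\pm1}$, drawn with strands moving downward; crossings cut strands into segments and the plane into regions; components are the strands. At each crossing, label the two incoming segments $1,2$ and outgoing $1',2'$ (1 continues as $1'$, 2 as $2'$) and the four adjacent regions $\mathsf N,\mathsf W,\mathsf S,\mathsf E$ so that, in the left-to-right order of tensor factors, the incoming side reads ($\mathsf N$,1,$\mathsf W$,2,$\mathsf S$) and the outgoing side ($\mathsf N$,$2'$,$\mathsf E$,$1'$,$\mathsf S$); the sign $\epsilon$ is $+1$ for $\sigma_i$ and $-1$ for $\sigma_i^{-1}$. A log-coloring assigns $\beta$ to each segment, $\gamma$ to each region and $\mu$ to each component such that every crossing is a log-colored crossing of sign $\epsilon$, meaning: with $\alpha_1=\gamma_{\mathsf W}-\gamma_{\mathsf N}$,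 $\alpha_2=\gamma_{\mathsf S}-\gamma_{\mathsf W}$, $\alpha_{2'}=\gamma_{\mathsf E}-\gamma_{\mathsf N}$, $\alpha_{1'}=\gamma_{\mathsf S}-\gamma_{\mathsf E}$, $a=e^{2\pi i\alpha}$, $b=e^{2\pi i\beta}$, $m=e^{2\pi i\mu}$ (nonzero, finite) one has, for $\epsilon=+1$, $a_{1'}=a_1/A$, $a_{2'}=a_2A$, $A=1-\frac{m_1b_1}{b_2}(1-\frac{a_1}{m_1})(1-\frac1{m_2a_2})$, $b_{1'}=\frac{m_2b_2}{m_1}(1-m_2a_2(1-\frac{b_2}{m_1b_1}))^{-1}$, $b_{2'}=b_1(1-\frac{m_1}{a_1}(1-\frac{b_2}{m_1b_1}))$, and for $\epsilon=-1$, $a_{1'}=a_1/\tilde A$, $a_{2'}=a_2\tilde A$, $\tilde A=1-\frac{b_2}{m_1b_1}(1-m_1a_1)(1-\frac{m_2}{a_2})$, $b_{1'}=\frac{m_2b_2}{m_1}(1-\frac{a_2}{m_2}(1-\frac{m_1b_1}{b_2}))$, $b_{2'}=b_1(1-\frac1{m_1a_1}(1-\frac{m_1b_1}{b_2}))^{-1}$. The underlying $\chi$-coloring is the resulting assignment of $(a,b,\omega^\mu)$ to segments. Each segment $s$ carries $V(\alpha_s,\beta_s,\mu_s)$ with $\alpha_s$ the difference of the $\gamma$'s of the regions to its right and left (in tensor order). At each crossing define $\zeta^0,\zeta^1$ and the quantum dilogarithm as follows: $\zeta^0_{\mathsf N}=\epsilon(\beta_{2'}-\beta_1)$, $\zeta^0_{\mathsf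 W}=\epsilon(\beta_2-\beta_1-\mu_1)$, $\zeta^0_{\mathsf S}=\epsilon(\beta_2-\beta_{1'}+\mu_2-\mu_1)$, $\zeta^0_{\mathsf E}=\epsilon(\beta_{2'}-\beta_{1'}+\mu_2)$; $e^{2\pi i\kappa}=e^{2\pi i\gamma_{\mathsf N}}/(1-(b_{2'}/b_1)^\epsilon)$; $\zeta^1_{\mathsf N}=\kappa-\gamma_{\mathsf N}$, $\zeta^1_{\mathsf W}=\kappa-\gamma_{\mathsf W}+\epsilon\mu_1$, $\zeta^1_{\mathsf S}=\kappa-\gamma_{\mathsf S}+\epsilon(\mu_1-\mu_2)$, $\zeta^1_{\mathsf E}=\kappa-\gamma_{\mathsf E}-\epsilon\mu_2$; $\Lambda(\zeta)=\Phi_{\sqrt N}(i\zeta/\sqrt N-\frac i2(\sqrt N+1/\sqrt N)+i/\sqrt N)$ with Faddeev's $\Phi_{\mathsf b}(z)=\exp\int_{\mathbb R+i0}\frac{e^{-2izw}}{4\sinh(w\mathsf b)\sinh(w/\mathsf b)}\frac{dw}w$; $\Lambda(\zeta^0,\zeta^1\mid n)=\omega^{-\zeta^0\zeta^1/2-n\zeta^1}\Lambda(\zeta^0+n)$. The positive $R$-matrix is $\hat R_{n_1n_2}^{n_1'n_2'}=\frac{\omega^{-(N-1)(\zeta^0_{\mathsf W}+\zeta^1_{\mathsf W})}}N\omega^{n_2-n_1}\frac{\Lambda(\zeta_{\mathsf N}\mid n_2'-n_1)\Lambda(\zeta_{\mathsf S}\mid n_2-n_1')}{\Lambda(\zeta_{\mathsf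 W}\mid n_2-n_1-1)\Lambda(\zeta_{\mathsf E}\mid n_2'-n_1')}$ and the negative one $\bar R_{n_1n_2}^{n_1'n_2'}=\frac{\omega^{(N-1)(\zeta^0_{\mathsf E}+\zeta^1_{\mathsf E}-\zeta^0_{\mathsf S}-\zeta^1_{\mathsf S}-\zeta^0_{\mathsf N}-\zeta^1_{\mathsf N})}}N\omega^{n_1-n_2}\frac{\Lambda(\zeta_{\mathsf W}\mid n_1-n_2)\Lambda(\zeta_{\mathsf E}\mid n_1'-n_2'-1)}{\Lambda(\zeta_{\mathsf N}\mid n_1-n_2'-1)\Lambda(\zeta_{\mathsf S}\mid n_1'-n_2-1)}$ (writing $\Lambda(\zeta_j\mid n)$ for $\Lambda(\zeta^0_j,\zeta^1_j\mid n)$); at pinched crossings (some $\zeta^0_j\in\mathbb Z$) the $R$-matrix is defined as the limit of these formulas. The braiding at a positive crossing is $\hat v_{n_1}\otimes\hat v_{n_2}\mapsto\sum\hat R_{n_1n_2}^{n_1'n_2'}\hat v_{n_2'}\otimes\hat v_{n_1'}$, and at a negative crossing it is $\bar R\tau$ ($\tau$ the flip). $J(D,\chi,\mathfrak f)$ is the composite of the braidings of the crossings (tensored with identities on the other strands), a linear map from the tensor product of the modules on the top segments to that on the bottom segments. Log-longitude: each segment consists of one half-segment per crossing it is incident to. At a positive crossing the half-segments contribute $-\beta_1,+\beta_{1'},+\beta_2,-\beta_{2'}$; at a negative crossing $+\beta_1,-\beta_{1'},-\beta_2,+\beta_{2'}$. The log-longitude $\lambda_i$ of component $i$ is half the sum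 of contributions of all half-segments in component $i$. *)

theory Defs
  imports "HOL-Analysis.Analysis"
begin

definition omega :: "nat \<Rightarrow> complex \<Rightarrow> complex" where
  "omega N x = exp (2 * of_real pi * \<i> * x / of_nat N)"

definition ee :: "complex \<Rightarrow> complex" where
  "ee x = exp (2 * of_real pi * \<i> * x)"

text \<open>The integral over R + i0 (the real line passing above the origin) is taken over the
  horizontal line Im w = delta with delta = pi min(b,1/b)/2; the integrand is holomorphic in
  the strip 0 < Im w < pi min(b,1/b), so this is the same contour integral.  It converges
  for |Im z| < (b+1/b)/2.\<close>
definition faddeev_integral :: "real \<Rightarrow> complex \<Rightarrow> complex" where
  "faddeev_integral b z =
     integral UNIV (\<lambda>t::real.
        let w = complex_of_real t + \<i> * complex_of_real (pi * min b (1 / b) / 2)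
        in exp (- 2 * \<i> * z * w) /
           (4 * sinh (w * complex_of_real b) * sinh (w / complex_of_real b) * w))"

definition faddeev_poles :: "real \<Rightarrow> complex set" where
  "faddeev_poles b =
     {\<i> * complex_of_real ((b + 1 / b) / 2 + real m * b + real n / b) | m n :: nat. True}"

text \<open>Phi_b: the meromorphic continuation to C of exp(integral) from the strip
  |Im z| < (b+1/b)/2; holomorphic off its pole set, where we put the junk value 0.\<close>
definition faddeev_Phi :: "real \<Rightarrow> complex \<Rightarrow> complex" where
  "faddeev_Phi b =
     (THE f. f holomorphic_on (- faddeev_poles b)
          \<and> (\<forall>z. \<bar>Im z\<bar> < (b + 1 / b) / 2 \<longrightarrow> f z = exp (faddeev_integral b z))
          \<and> (\<forall>z\<in>faddeev_poles b. f z = 0))"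

definition Lam :: "nat \<Rightarrow> complex \<Rightarrow> complex" where
  "Lam N \<zeta> = (let s = complex_of_real (sqrt (real N)) in
      faddeev_Phi (sqrt (real N)) (\<i> * \<zeta> / s - \<i> / 2 * (s + 1 / s) + \<i> / s))"

definition LamI :: "nat \<Rightarrow> complex \<times> complex \<Rightarrow> int \<Rightarrow> complex" where
  "LamI N z n = omega N (- (fst z * snd z / 2) - of_int n * snd z) * Lam N (fst z + of_int n)"

text \<open>Crossing data: ((beta_1, beta_2, beta_1', beta_2'), (gamma_N, gamma_W, gamma_S, gamma_E),
  (mu_1, mu_2)).  The Boolean is the sign: True = positive (sigma_i), False = negative.\<close>
type_synonym cdata =
  "(complex \<times> complex \<times> complex \<times> complex) \<times> (complex \<times> complex \<times> complex \<times> complex) \<times> (complex \<times> complex)"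

definition logcross :: "bool \<Rightarrow> cdata \<Rightarrow> bool" where
  "logcross pos c = (case c of ((\<beta>1, \<beta>2, \<beta>1', \<beta>2'), (gN, gW, gS, gE), (\<mu>1, \<mu>2)) \<Rightarrow>
     (let a1 = ee (gW - gN); a2 = ee (gS - gW); a2' = ee (gE - gN); a1' = ee (gS - gE);
          b1 = ee \<beta>1; b2 = ee \<beta>2; b1' = ee \<beta>1'; b2' = ee \<beta>2'; m1 = ee \<mu>1; m2 = ee \<mu>2 in
      if pos then
        (let A = 1 - m1 * b1 / b2 * (1 - a1 / m1) * (1 - 1 / (m2 * a2)) in
          a1' = a1 / A \<and> a2' = a2 * A
          \<and> b1' = m2 * b2 / m1 * inverse (1 - m2 * a2 * (1 - b2 / (m1 * b1)))
          \<and> b2' = b1 * (1 - m1 / a1 * (1 - b2 / (m1 * b1))))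
      else
        (let A = 1 - b2 / (m1 * b1) * (1 - m1 * a1) * (1 - m2 / a2) in
          a1' = a1 / A \<and> a2' = a2 * A
          \<and> b1' = m2 * b2 / m1 * (1 - a2 / m2 * (1 - m1 * b1 / b2))
          \<and> b2' = b1 * inverse (1 - 1 / (m1 * a1) * (1 - m1 * b1 / b2)))))"

text \<open>zeta^0 and zeta^1 at the regions N, W, S, E (in this order); each entry is the pair
  (zeta^0_j, zeta^1_j).  kappa is chosen with exp(2 pi i kappa) = exp(2 pi i gamma_N)/(1-(b_2'/b_1)^eps)
  via the principal logarithm (the R-matrix does not depend on this choice).\<close>
definition zetas :: "bool \<Rightarrow> cdata \<Rightarrow>
    (complex \<times> complex) \<times> (complex \<times> complex) \<times> (complex \<times> complex) \<times> (complex \<times> complex)" where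
  "zetas pos c = (case c of ((\<beta>1, \<beta>2, \<beta>1', \<beta>2'), (gN, gW, gS, gE), (\<mu>1, \<mu>2)) \<Rightarrow>
     (let \<epsilon> = (if pos then 1 else -1 :: complex);
          r = (if pos then ee \<beta>2' / ee \<beta>1 else ee \<beta>1 / ee \<beta>2');
          \<kappa> = gN - Ln (1 - r) / (2 * of_real pi * \<i>) in
      ((\<epsilon> * (\<beta>2' - \<beta>1), \<kappa> - gN),
       (\<epsilon> * (\<beta>2 - \<beta>1 - \<mu>1), \<kappa> - gW + \<epsilon> * \<mu>1),
       (\<epsilon> * (\<beta>2 - \<beta>1' + \<mu>2 - \<mu>1), \<kappa> - gS + \<epsilon> * (\<mu>1 - \<mu>2)),
       (\<epsilon> * (\<beta>2' - \<beta>1' + \<mu>2), \<kappa> - gE - \<epsilon> * \<mu>2))))"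

definition pinched :: "bool \<Rightarrow> cdata \<Rightarrow> bool" where
  "pinched pos c = (case zetas pos c of (zN, zW, zS, zE) \<Rightarrow>
     fst zN \<in> \<int> \<or> fst zW \<in> \<int> \<or> fst zS \<in> \<int> \<or> fst zE \<in> \<int>)"

definition Rformula :: "nat \<Rightarrow> bool \<Rightarrow> cdata \<Rightarrow> int \<Rightarrow> int \<Rightarrow> int \<Rightarrow> int \<Rightarrow> complex" where
  "Rformula N pos c n1 n2 n1' n2' = (case zetas pos c of (zN, zW, zS, zE) \<Rightarrow>
     if pos then
       omega N (- (of_nat N - 1) * (fst zW + snd zW)) / of_nat N * omega N (of_int (n2 - n1))
       * (LamI N zN (n2' - n1) * LamI N zS (n2 - n1'))
       / (LamI N zW (n2 - n1 - 1) * LamI N zE (n2' - n1'))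
     else
       omega N ((of_nat N - 1) * (fst zE + snd zE - fst zS - snd zS - fst zN - snd zN))
         / of_nat N * omega N (of_int (n1 - n2))
       * (LamI N zW (n1 - n2) * LamI N zE (n1' - n2' - 1))
       / (LamI N zN (n1 - n2' - 1) * LamI N zS (n1' - n2 - 1)))"

definition Rmat :: "nat \<Rightarrow> bool \<Rightarrow> cdata \<Rightarrow> int \<Rightarrow> int \<Rightarrow> int \<Rightarrow> int \<Rightarrow> complex" where
  "Rmat N pos c n1 n2 n1' n2' =
     (if \<not> pinched pos c then Rformula N pos c n1 n2 n1' n2'
      else Lim (at c within {c'. logcross pos c' \<and> \<not> pinched pos c'})
               (\<lambda>c'. Rformula N pos c' n1 n2 n1' n2'))"

text \<open>A braid diagram on n strands is a word w; the letter (i, s) is sigma_{i+1}^{+1} (s = True)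
  or sigma_{i+1}^{-1} (s = False), crossing the strands in positions i and i+1 (0-based).
  Levels t = 0..length w lie between consecutive crossings (crossing t is between levels t
  and t+1).  A segment is described by its position p < n at a level; a region by its position
  r <= n at a level (region r lies between strands r-1 and r).\<close>
definition is_braid :: "nat \<Rightarrow> (nat \<times> bool) list \<Rightarrow> bool" where
  "is_braid n w = (\<forall>x\<in>set w. Suc (fst x) < n)"

text \<open>Component (strand) through position p at level t, named by its top position.\<close>
fun strand :: "(nat \<times> bool) list \<Rightarrow> nat \<Rightarrow> nat \<Rightarrow> nat" where
  "strand w 0 p = p"
| "strand w (Suc t) p = (let i = fst (w ! t) in
     if p = i then strand w t (Suc i) else if p = Suc i then strand w t i else strand w t p)"

record logcol =
  lbeta :: "nat \<Rightarrow> nat \<Rightarrow> complex"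
  lgamma :: "nat \<Rightarrow> nat \<Rightarrow> complex"
  lmu :: "nat \<Rightarrow> complex"

definition cross_data :: "(nat \<times> bool) list \<Rightarrow> logcol \<Rightarrow> nat \<Rightarrow> cdata" where
  "cross_data w f t = (let i = fst (w ! t); \<beta> = lbeta f; \<gamma> = lgamma f; \<mu> = lmu f in
     ((\<beta> t i, \<beta> t (Suc i), \<beta> (Suc t) (Suc i), \<beta> (Suc t) i),
      (\<gamma> t i, \<gamma> t (Suc i), \<gamma> t (Suc (Suc i)), \<gamma> (Suc t) (Suc i)),
      (\<mu> (strand w t i), \<mu> (strand w t (Suc i)))))"

definition is_log_coloring :: "nat \<Rightarrow> (nat \<times> bool) list \<Rightarrow> logcol \<Rightarrow> bool" where
  "is_log_coloring n w f = (\<forall>t < length w. let i = fst (w ! t) in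
       (\<forall>p < n. p \<noteq> i \<and> p \<noteq> Suc i \<longrightarrow> lbeta f (Suc t) p = lbeta f t p)
     \<and> (\<forall>r \<le> n. r \<noteq> Suc i \<longrightarrow> lgamma f (Suc t) r = lgamma f t r)
     \<and> logcross (snd (w ! t)) (cross_data w f t))"

text \<open>Underlying chi-coloring (a, b, omega^mu) of the segment at level t, position p;
  alpha of a segment = gamma(right region) - gamma(left region).\<close>
definition chi_of :: "nat \<Rightarrow> (nat \<times> bool) list \<Rightarrow> logcol \<Rightarrow> nat \<Rightarrow> nat \<Rightarrow> complex \<times> complex \<times> complex" where
  "chi_of N w f t p = (ee (lgamma f t (Suc p) - lgamma f t p), ee (lbeta f t p),
                       omega N (lmu f (strand w t p)))"

definition states :: "nat \<Rightarrow> nat \<Rightarrow> nat list set" where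
  "states N n = {xs. length xs = n \<and> (\<forall>x\<in>set xs. x < N)}"

text \<open>Matrix entry (coefficient of the basis vector ys in the image of xs) of the braiding
  at crossing t: hat v_{n1} (x) hat v_{n2} maps to sum R_{n1 n2}^{n1' n2'} hat v_{n2'} (x) hat v_{n1'}.\<close>
definition crossM :: "nat \<Rightarrow> (nat \<times> bool) list \<Rightarrow> logcol \<Rightarrow> nat \<Rightarrow> nat list \<Rightarrow> nat list \<Rightarrow> complex" where
  "crossM N w f t xs ys = (let i = fst (w ! t) in
     if (\<forall>q < length xs. q \<noteq> i \<and> q \<noteq> Suc i \<longrightarrow> xs ! q = ys ! q)
     then Rmat N (snd (w ! t)) (cross_data w f t)
            (int (xs ! i)) (int (xs ! Suc i)) (int (ys ! Suc i)) (int (ys ! i))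
     else 0)"

fun Jpart :: "nat \<Rightarrow> nat \<Rightarrow> (nat \<times> bool) list \<Rightarrow> logcol \<Rightarrow> nat \<Rightarrow> nat list \<Rightarrow> nat list \<Rightarrow> complex" where
  "Jpart N n w f 0 xs ys = (if xs = ys then 1 else 0)"
| "Jpart N n w f (Suc t) xs ys = (\<Sum>zs\<in>states N n. Jpart N n w f t xs zs * crossM N w f t zs ys)"

text \<open>J(D, chi, f) as a matrix: entry (xs, ys) = coefficient of the bottom basis vector ys in
  the image of the top basis vector xs.\<close>
definition Jop :: "nat \<Rightarrow> nat \<Rightarrow> (nat \<times> bool) list \<Rightarrow> logcol \<Rightarrow> nat list \<Rightarrow> nat list \<Rightarrow> complex" where
  "Jop N n w f = Jpart N n w f (length w)"

definition loglong :: "(nat \<times> bool) list \<Rightarrow> logcol \<Rightarrow> nat \<Rightarrow> complex" where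
  "loglong w f j = (1 / 2) * (\<Sum>t < length w.
     (let i = fst (w ! t); \<epsilon> = (if snd (w ! t) then 1 else -1 :: complex); \<beta> = lbeta f in
      \<epsilon> * ((if strand w t i = j then \<beta> (Suc t) (Suc i) - \<beta> t i else 0)
          + (if strand w t (Suc i) = j then \<beta> t (Suc i) - \<beta> (Suc t) i else 0))))"

end

theory Submission
  imports Defs "HOL-Complex_Analysis.Complex_Analysis"
begin

text \<open>Since \<open>e\<^sup>2\<^sup>\<pi>\<^sup>i\<^sup>\<beta>\<close> and \<open>e\<^sup>2\<^sup>\<pi>\<^sup>i\<^sup>\<alpha>\<close> are fixed by the \<open>\<chi>\<close>-coloring, the two log-colorings differ by integers
  on internal segments and regions. The equation \<open>\<Lambda>(\<zeta>) = (1 - e\<^sup>2\<^sup>\<pi>\<^sup>i\<^sup>\<zeta>) \<Lambda>(\<zeta> + N)\<close> together with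
  \<open>e\<^sup>2\<^sup>\<pi>\<^sup>i\<^sup>\<zeta>\<^sup>1 (1 - e\<^sup>2\<^sup>\<pi>\<^sup>i\<^sup>\<zeta>\<^sup>0) = 1\<close> makes \<open>\<Lambda>(\<zeta>\<^sup>0, \<zeta>\<^sup>1 | n)\<close> periodic in \<open>n\<close> modulo \<open>N\<close>, so shifting a \<open>\<beta>\<close> by an
  integer amounts to a cyclic shift of the basis at that segment, and shifting a \<open>\<gamma>\<close> to a diagonal change of
  basis, both up to a phase. The basis changes and most of the phase telescope along the braid and are trivial
  at its two ends; what survives is the change of the log-longitudes paired with the meridians.\<close>

section \<open>Integrals of exponentially decaying functions along a horizontal line\<close>

text \<open>Since \<open>faddeev_Phi\<close> is a definite description, it means something only once
  the integral is known to have exactly one continuation off the pole set. The continuation and the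
  functional equation have the same source. The change of the Faddeev integral under the shift of
  its argument by \<open>\<i> * s\<close>, \<open>s = sqrt N\<close>, has as derivative a line
  integral of an exponential over sinh, which one residue evaluates; integrating back gives the
  logarithm of \<open>1 + exp (2 * pi * s * z)\<close>. The obstacle is the pinched crossings. There
  the flatness equation cannot hold, \<kappa> diverges, and \<open>Rmat\<close> is a
  \<open>Lim\<close>, which says nothing until the limit exists and non-pinched crossings accumulate
  at the pinched one. The transformation law is proved off the pinched locus and extended by
  continuity, as an integer shift is a translation of the parameter space that preserves this locus.
  Only longitudes survive because the sign of a crossing enters the exponent solely through \<mu>
  times changes of \<beta>. All other terms are, for either sign, a sum over outgoing segments minus
  the same sum over incoming ones.\<close>

lemma integrable_exp_minus_abs:
  fixes a :: real
  assumes "a > 0"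
  shows "(\<lambda>t::real. exp (- a * \<bar>t\<bar>)) integrable_on UNIV"
proof -
  let ?f = "\<lambda>t::real. indicator {0..} t *\<^sub>R exp (- a * t)"
  have "set_integrable lebesgue {0..} (\<lambda>t::real. exp (- a * t))"
    by (intro nonnegative_absolutely_integrable_1 integrable_on_exp_minus_to_infinity assms) auto
  moreover have "?f \<in> borel_measurable lborel" by measurable
  ultimately have "integrable lborel ?f"
    unfolding set_integrable_def using integrable_completion by blast
  moreover from this have "integrable lborel (\<lambda>t. ?f (0 + (-1) * t))"
    by (rule lborel_integrable_real_affine) simp
  ultimately have "integrable lborel (\<lambda>t. ?f t + ?f (0 + (-1) * t))"
    by (intro Bochner_Integration.integrable_add)
  hence "integrable lborel (\<lambda>t. norm (?f t + ?f (0 + (-1) * t)))"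
    by (rule integrable_norm)
  \<comment> \<open>Both half-line pieces equal 1 at \<open>t = 0\<close>, so their sum dominates
    the integrand instead of agreeing with it everywhere.\<close>
  hence "integrable lborel (\<lambda>t. exp (- a * \<bar>t\<bar>))"
    by (rule Bochner_Integration.integrable_bound) (auto simp: indicator_def)
  thus ?thesis by (rule integrable_on_lborel)
qed

lemma absolutely_integrable_exp_decay:
  fixes g :: "real \<Rightarrow> complex"
  assumes "continuous_on UNIV g" "a > 0" "\<And>t. norm (g t) \<le> C * exp (- a * \<bar>t\<bar>)"
  shows "g absolutely_integrable_on UNIV"
proof (rule measurable_bounded_by_integrable_imp_absolutely_integrable)
  show "g \<in> borel_measurable (lebesgue_on UNIV)"
    by (rule continuous_imp_measurable_on_sets_lebesgue) (use assms in auto)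
  show "(\<lambda>t. C * exp (- a * \<bar>t\<bar>)) integrable_on UNIV"
    by (intro integrable_on_mult_right integrable_exp_minus_abs assms)
qed (use assms in auto)

lemma norm_exp_line_le:
  "norm (exp (- 2 * \<i> * z * Complex t d)) \<le> exp (2 * \<bar>Im z\<bar> * \<bar>t\<bar> + 2 * \<bar>Re z\<bar> * \<bar>d\<bar>)"
proof -
  have "Re z * d \<le> \<bar>Re z\<bar> * \<bar>d\<bar>" "Im z * t \<le> \<bar>Im z\<bar> * \<bar>t\<bar>"
    by (metis abs_ge_self abs_mult)+
  thus ?thesis by (simp add: algebra_simps)
qed

lemma norm_exp_line_times_le:
  assumes "\<And>t. norm (g t) \<le> C * exp (- a * \<bar>t\<bar>)"
  shows "norm (exp (- 2 * \<i> * z * Complex t d) * g t)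
     \<le> C * exp (2 * \<bar>Re z\<bar> * \<bar>d\<bar>) * exp (- (a - 2 * \<bar>Im z\<bar>) * \<bar>t\<bar>)"
proof -
  have "norm (exp (- 2 * \<i> * z * Complex t d) * g t)
      \<le> exp (2 * \<bar>Im z\<bar> * \<bar>t\<bar> + 2 * \<bar>Re z\<bar> * \<bar>d\<bar>) * (C * exp (- a * \<bar>t\<bar>))"
    unfolding norm_mult by (intro mult_mono norm_exp_line_le assms) auto
  also have "\<dots> = C * exp (2 * \<bar>Re z\<bar> * \<bar>d\<bar>) * exp (- (a - 2 * \<bar>Im z\<bar>) * \<bar>t\<bar>)"
    by (simp add: exp_add[symmetric] algebra_simps)
  finally show ?thesis .
qed

lemma continuous_on_exp_line:
  assumes "continuous_on UNIV g"
  shows "continuous_on UNIV (\<lambda>t::real. exp (- 2 * \<i> * z * Complex t d) * (g t :: complex))"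
proof -
  have "(\<lambda>t::real. Complex t d) = (\<lambda>t. of_real t + \<i> * of_real d)"
    by (auto simp: complex_eq_iff)
  thus ?thesis using assms by (auto intro!: continuous_intros)
qed

text \<open>Along a horizontal line the exponential grows at rate at most
  \<open>2 * \<bar>Im z\<bar>\<close>; a kernel decaying at rate \<open>a\<close> absorbs this as
  long as \<open>\<bar>Im z\<bar> < a / 2\<close>.\<close>

lemma exp_line_integrable:
  assumes "continuous_on UNIV g" "\<And>t. norm (g t) \<le> C * exp (- a * \<bar>t\<bar>)" "\<bar>Im z\<bar> < a / 2"
  shows "(\<lambda>t. exp (- 2 * \<i> * z * Complex t d) * g t) absolutely_integrable_on UNIV"
  by (rule absolutely_integrable_exp_decay[OF continuous_on_exp_line _ norm_exp_line_times_le])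
     (use assms in auto)

text \<open>Polynomial factors produced by differentiation are paid for with an arbitrarily small
  share \<open>k\<close> of the exponential decay.\<close>

lemma le_exp_mult:
  fixes y k :: real
  assumes "y \<ge> 0" "k > 0"
  shows "y \<le> (1 / k) * exp (k * y)" "y\<^sup>2 \<le> (2 / k\<^sup>2) * exp (k * y)"
proof -
  have 1: "1 + k * y \<le> exp (k * y)" by (rule exp_ge_add_one_self)
  hence "k * y \<le> exp (k * y)" by linarith
  thus "y \<le> (1 / k) * exp (k * y)" using assms by (simp add: field_simps)
  have "1 + k * y + (k * y)\<^sup>2 / 2 \<le> exp (k * y)"
    by (rule exp_lower_Taylor_quadratic) (use assms in auto)
  moreover have "k * y \<ge> 0" using assms by simp
  ultimately have "(k * y)\<^sup>2 \<le> 2 * exp (k * y)" by linarith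
  thus "y\<^sup>2 \<le> (2 / k\<^sup>2) * exp (k * y)"
    using assms by (simp add: field_simps power_mult_distrib)
qed

lemma norm_Complex_le: "norm (Complex t d) \<le> \<bar>t\<bar> + \<bar>d\<bar>"
  using cmod_le[of "Complex t d"] by simp

text \<open>Differentiation under the integral sign by a direct estimate: the second-order Taylor
  remainder of the exponential is at most \<open>(norm h)\<^sup>2\<close> times an integrable
  function of \<open>t\<close> that does not depend on \<open>h\<close>.\<close>

lemma exp_line_has_field_derivative:
  assumes cont: "continuous_on UNIV g"
    and bnd: "\<And>t. norm (g t) \<le> C * exp (- a * \<bar>t\<bar>)" and z: "\<bar>Im z\<bar> < a / 2"
  shows "((\<lambda>z. integral UNIV (\<lambda>t. exp (- 2 * \<i> * z * Complex t d) * g t)) has_field_derivative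
           integral UNIV (\<lambda>t. exp (- 2 * \<i> * z * Complex t d) * (- 2 * \<i> * Complex t d * g t))) (at z)"
    (is "(?F has_field_derivative ?D) _")
proof -
  \<comment> \<open>\<open>e\<close> is the decay left after the growth of the exponential. A
    quarter of it absorbs the linear factor \<open>Complex t d\<close> of the derivative; half of it
    absorbs the Taylor remainder.\<close>
  define e where "e = a - 2 * \<bar>Im z\<bar>"
  have e: "e > 0" using z by (simp add: e_def)
  have C: "C \<ge> 0" using order_trans[OF norm_ge_zero bnd[of 0]] by simp
  have contC: "continuous_on UNIV (\<lambda>t::real. Complex t d)"
    by (simp add: Complex_eq) (intro continuous_intros)
  define a' where "a' = a - e / 4"
  define C' where "C' = 2 * (1 / (e / 4)) * exp (e / 4 * \<bar>d\<bar>) * C"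
  have bnd': "norm (- 2 * \<i> * Complex t d * g t) \<le> C' * exp (- a' * \<bar>t\<bar>)" for t
  proof -
    have "norm (Complex t d) \<le> \<bar>t\<bar> + \<bar>d\<bar>" by (rule norm_Complex_le)
    also have "\<dots> \<le> (1 / (e / 4)) * exp (e / 4 * (\<bar>t\<bar> + \<bar>d\<bar>))"
      by (rule le_exp_mult) (use e in auto)
    finally have "norm (Complex t d) * norm (g t)
       \<le> (1 / (e / 4)) * exp (e / 4 * (\<bar>t\<bar> + \<bar>d\<bar>)) * (C * exp (- a * \<bar>t\<bar>))"
      by (intro mult_mono bnd) (use e C in auto)
    also have "\<dots> = (1 / (e / 4)) * C * exp (e / 4 * (\<bar>t\<bar> + \<bar>d\<bar>) + - a * \<bar>t\<bar>)"
      unfolding exp_add by simp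
    also have "e / 4 * (\<bar>t\<bar> + \<bar>d\<bar>) + - a * \<bar>t\<bar> = e / 4 * \<bar>d\<bar> + - a' * \<bar>t\<bar>"
      by (simp add: a'_def algebra_simps)
    finally show ?thesis
      unfolding exp_add C'_def using e by (simp add: norm_mult field_simps)
  qed
  have int1: "(\<lambda>t. exp (- 2 * \<i> * z' * Complex t d) * g t) integrable_on UNIV" if "\<bar>Im z'\<bar> < a / 2" for z'
    using exp_line_integrable[OF cont bnd that] absolutely_integrable_on_def by blast
  have int2: "(\<lambda>t. exp (- 2 * \<i> * z * Complex t d) * (- 2 * \<i> * Complex t d * g t)) integrable_on UNIV"
  proof -
    have "continuous_on UNIV (\<lambda>t. - 2 * \<i> * Complex t d * g t)"
      by (intro continuous_intros cont contC)
    moreover have "\<bar>Im z\<bar> < a' / 2" using e by (simp add: a'_def e_def field_simps)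
    ultimately show ?thesis
      using exp_line_integrable[OF _ bnd'] absolutely_integrable_on_def by blast
  qed
  define K where "K = 4 * (2 / (e/4)\<^sup>2) * exp (e / 2 * \<bar>d\<bar>) * (C * exp (2 * \<bar>Re z\<bar> * \<bar>d\<bar>))"
  define I where "I = integral UNIV (\<lambda>t::real. exp (- (e/2) * \<bar>t\<bar>))"
  \<comment> \<open>The radius \<open>e / 8\<close> gives \<open>norm u \<le> e / 4 * y\<close>, so
    the exponential in the Taylor bound costs a quarter of the decay and the quadratic factor
    another quarter.\<close>
  have main: "norm (?F (z + h) - ?F z - h * ?D) \<le> (norm h)\<^sup>2 * (K * I)" if h: "norm h < e / 8" for h
  proof -
    have "\<bar>Im (z + h)\<bar> \<le> \<bar>Im z\<bar> + norm h" using abs_Im_le_cmod[of h] by auto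
    also have "\<dots> < a / 2" using h e by (simp add: e_def field_simps)
    finally have zh: "\<bar>Im (z + h)\<bar> < a / 2" .
    let ?r = "\<lambda>t. (exp (- 2 * \<i> * (z + h) * Complex t d) * g t) - (exp (- 2 * \<i> * z * Complex t d) * g t)
               - h * (exp (- 2 * \<i> * z * Complex t d) * (- 2 * \<i> * Complex t d * g t))"
    have eq: "?F (z + h) - ?F z - h * ?D = integral UNIV ?r"
      by (rule integral_unique[symmetric])
         (intro has_integral_diff has_integral_mult_right integrable_integral int1[OF zh] int1[OF z] int2)
    have "norm (integral UNIV ?r) \<le> integral UNIV (\<lambda>t::real. (norm h)\<^sup>2 * K * exp (- (e/2) * \<bar>t\<bar>))"
    proof (rule integral_norm_bound_integral)
      show "?r integrable_on UNIV"
        using int1[OF zh] int1[OF z] int2 by (intro integrable_diff integrable_on_mult_right)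
      show "(\<lambda>t::real. (norm h)\<^sup>2 * K * exp (- (e/2) * \<bar>t\<bar>)) integrable_on UNIV"
        using e by (intro integrable_on_mult_right integrable_exp_minus_abs) auto
      fix t :: real
      define u where "u = - 2 * \<i> * h * Complex t d"
      define y where "y = \<bar>t\<bar> + \<bar>d\<bar>"
      have y: "norm (Complex t d) \<le> y" "y \<ge> 0" using norm_Complex_le by (auto simp: y_def)
      have "exp u - (\<Sum>k\<le>1. u ^ k / fact k) = exp u - 1 - u" by simp
      hence T: "norm (exp u - 1 - u) \<le> exp \<bar>Re u\<bar> * (norm u)\<^sup>2"
        using Taylor_exp[of u 1] by (simp add: power2_eq_square diff_diff_eq)
      have nu: "norm u \<le> 2 * norm h * y"
        unfolding u_def using y by (auto simp: norm_mult intro!: mult_left_mono)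
      also have "\<dots> \<le> e / 4 * y" using h y by (intro mult_right_mono) auto
      finally have "\<bar>Re u\<bar> \<le> e / 4 * y" using abs_Re_le_cmod[of u] by linarith
      hence "norm (exp u - 1 - u) \<le> exp (e / 4 * y) * (2 * norm h * y)\<^sup>2"
        by (intro order_trans[OF T] mult_mono power_mono nu) auto
      also have "\<dots> = exp (e / 4 * y) * (4 * (norm h)\<^sup>2) * y\<^sup>2" by (simp add: power2_eq_square)
      also have "\<dots> \<le> exp (e / 4 * y) * (4 * (norm h)\<^sup>2) * ((2 / (e/4)\<^sup>2) * exp (e / 4 * y))"
        by (intro mult_left_mono le_exp_mult) (use y e in auto)
      also have "\<dots> = (norm h)\<^sup>2 * (4 * (2 / (e/4)\<^sup>2) * exp (e / 4 * y + e / 4 * y))"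
        unfolding exp_add by simp
      also have "e / 4 * y + e / 4 * y = e / 2 * \<bar>d\<bar> + e / 2 * \<bar>t\<bar>" by (simp add: y_def field_simps)
      finally have A: "norm (exp u - 1 - u)
         \<le> (norm h)\<^sup>2 * (4 * (2 / (e/4)\<^sup>2) * (exp (e / 2 * \<bar>d\<bar>) * exp (e / 2 * \<bar>t\<bar>)))"
        unfolding exp_add .
      have "exp (- 2 * \<i> * (z + h) * Complex t d) = exp (- 2 * \<i> * z * Complex t d) * exp u"
        by (simp add: u_def exp_add[symmetric] algebra_simps)
      hence "?r t = (exp u - 1 - u) * (exp (- 2 * \<i> * z * Complex t d) * g t)"
        by (simp add: u_def algebra_simps)
      hence r: "norm (?r t) = norm (exp u - 1 - u) * norm (exp (- 2 * \<i> * z * Complex t d) * g t)"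
        by (simp only: norm_mult)
      have B: "norm (exp u - 1 - u) * norm (exp (- 2 * \<i> * z * Complex t d) * g t)
          \<le> ((norm h)\<^sup>2 * (4 * (2 / (e/4)\<^sup>2) * (exp (e / 2 * \<bar>d\<bar>) * exp (e / 2 * \<bar>t\<bar>))))
          * (C * exp (2 * \<bar>Re z\<bar> * \<bar>d\<bar>) * exp (- (a - 2 * \<bar>Im z\<bar>) * \<bar>t\<bar>))"
        by (intro mult_mono A norm_exp_line_times_le bnd) auto
      have E: "exp (e / 2 * \<bar>t\<bar>) * exp (- (a - 2 * \<bar>Im z\<bar>) * \<bar>t\<bar>) = exp (- (e/2) * \<bar>t\<bar>)"
        by (simp add: exp_add[symmetric] e_def algebra_simps)
      show "norm (?r t) \<le> (norm h)\<^sup>2 * K * exp (- (e/2) * \<bar>t\<bar>)"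
        unfolding r E[symmetric] K_def using B by (simp only: mult_ac)
    qed
    thus ?thesis unfolding eq by (simp add: I_def)
  qed
  have lim0: "((\<lambda>h. norm h * (K * I)) \<longlongrightarrow> 0) (at (0::complex))"
    by (rule tendsto_eq_intros refl | simp)+
  show ?thesis
    unfolding has_field_derivative_def has_derivative_at
  proof (intro conjI bounded_linear_mult_right)
    show "((\<lambda>h. norm (?F (z + h) - ?F z - ?D * h) / norm h) \<longlongrightarrow> 0) (at 0)"
    proof (rule tendsto_sandwich[OF _ _ tendsto_const lim0])
      have "eventually (\<lambda>h. norm h < e / 8) (at (0::complex))"
        using e by (intro order_tendstoD(2)[of _ "norm (0::complex)"] tendsto_intros) auto
      thus "eventually (\<lambda>h. norm (?F (z + h) - ?F z - ?D * h) / norm h \<le> norm h * (K * I)) (at 0)"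
        using eventually_neq_at_within[of 0 0 UNIV]
      proof eventually_elim
        case (elim h)
        thus ?case using main[of h] by (simp add: field_simps power2_eq_square)
      qed
    qed auto
  qed
qed

section \<open>A residue computation\<close>

text \<open>Multiplication by \<i> turns the horizontal segment into a vertical one, for which the
  parametrisation by the imaginary part is available.\<close>

lemma contour_integral_linepath_same_Im:
  assumes "a < b"
  shows "contour_integral (linepath (Complex a c) (Complex b c)) f = integral {a..b} (\<lambda>x. f (Complex x c))"
proof -
  let ?z = "Complex a c" and ?z' = "Complex b c"
  have lp: "linepath (\<i> * ?z) (\<i> * ?z') x = \<i> * linepath ?z ?z' x" for x
    by (simp add: linepath_def scaleR_conv_of_real algebra_simps)
  have "contour_integral (linepath (\<i> * ?z) (\<i> * ?z')) (\<lambda>w. f (- \<i> * w))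
      = \<i> * integral {a..b} (\<lambda>x. f (- \<i> * Complex (- c) x))"
    by (rule contour_integral_linepath_same_Re) (use assms in auto)
  moreover have "- \<i> * Complex (- c) x = Complex x c" for x
    by (simp add: complex_eq_iff)
  moreover have "contour_integral (linepath (\<i> * ?z) (\<i> * ?z')) (\<lambda>w. f (- \<i> * w))
      = \<i> * contour_integral (linepath ?z ?z') f"
  proof -
    have "contour_integral (linepath (\<i> * ?z) (\<i> * ?z')) (\<lambda>w. f (- \<i> * w))
      = integral {0..1} (\<lambda>x. \<i> * (f (linepath ?z ?z' x) * (?z' - ?z)))"
      by (simp only: contour_integral_integral vector_derivative_linepath_at lp) (simp add: algebra_simps)
    also have "\<dots> = \<i> * integral {0..1} (\<lambda>x. f (linepath ?z ?z' x) * (?z' - ?z))"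
      by (rule integral_mult_right)
    finally show ?thesis by (simp only: contour_integral_integral vector_derivative_linepath_at)
  qed
  ultimately show ?thesis by simp
qed

lemma integral_symmetric_tendsto:
  fixes f :: "real \<Rightarrow> complex"
  assumes "f absolutely_integrable_on UNIV"
  shows "(\<lambda>n. integral {- real n..real n} f) \<longlonglongrightarrow> integral UNIV f"
proof -
  let ?f = "\<lambda>n x. if x \<in> {- real n..real n} then f x else 0"
  have "(\<lambda>n. integral UNIV (?f n)) \<longlonglongrightarrow> integral UNIV f"
  proof (rule dominated_convergence(2))
    show "?f n integrable_on UNIV" for n
      unfolding integrable_restrict_UNIV
      by (rule set_lebesgue_integral_eq_integral(1), rule set_integrable_subset[OF assms]) auto
    show "(\<lambda>x. norm (f x)) integrable_on UNIV"
      using assms by (simp add: absolutely_integrable_on_def)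
    show "(\<lambda>n. ?f n x) \<longlonglongrightarrow> f x" for x
    proof (rule tendsto_eventually)
      obtain m where "\<bar>x\<bar> \<le> real m" using real_arch_simple by blast
      thus "\<forall>\<^sub>F n in sequentially. ?f n x = f x"
        unfolding eventually_sequentially by (intro exI[of _ m]) auto
    qed
  qed auto
  thus ?thesis by (simp only: integral_restrict_UNIV)
qed

text \<open>The imaginary part of \<open>sinh w\<close> already suffices: it is the product of
  \<open>sin (Im w)\<close> and \<open>cosh (Re w)\<close>.\<close>

lemma norm_sinh_ge:
  fixes w :: complex
  shows "\<bar>sin (Im w)\<bar> * exp \<bar>Re w\<bar> / 2 \<le> norm (sinh w)"
proof -
  have "exp \<bar>Re w\<bar> \<le> exp (Re w) + exp (- Re w)" by (cases "Re w \<ge> 0") auto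
  hence "\<bar>sin (Im w)\<bar> * exp \<bar>Re w\<bar> / 2 \<le> \<bar>sin (Im w)\<bar> * (exp (Re w) + exp (- Re w)) / 2"
    by (intro divide_right_mono mult_left_mono) auto
  also have "\<dots> = \<bar>sin (Im w) * (exp (Re w) + exp (- Re w)) / 2\<bar>" by (simp add: abs_mult)
  also have "sin (Im w) * (exp (Re w) + exp (- Re w)) / 2 = Im (sinh w)"
    by (simp add: sinh_field_def Im_exp algebra_simps)
  also have "\<bar>Im (sinh w)\<bar> \<le> norm (sinh w)" by (rule abs_Im_le_cmod)
  finally show ?thesis .
qed

text \<open>Meant for the vertical sides of a rectangle, where \<open>Im w\<close> passes through pi
  and the bound by the sine is empty. It rests on \<open>norm (sinh w)\<close> being at least
  \<open>\<bar>sinh (Re w)\<bar>\<close>.\<close>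

lemma norm_sinh_ge_of_Re:
  fixes w :: complex
  assumes "\<bar>Re w\<bar> \<ge> 1"
  shows "exp \<bar>Re w\<bar> / 4 \<le> norm (sinh w)"
proof -
  have *: "exp x - exp (- x) \<ge> exp x / 2" if "x \<ge> 1" for x :: real
  proof -
    have "2 \<le> exp x" using order_trans[OF _ exp_ge_add_one_self[of x], of 2] that by linarith
    hence "exp x * exp x \<ge> 2 * 1" by (rule mult_mono) (use that in auto)
    hence "exp x - inverse (exp x) \<ge> exp x / 2" by (simp add: field_simps)
    thus ?thesis by (simp add: exp_minus)
  qed
  have "norm (exp w) = exp (Re w)" "norm (exp (- w)) = exp (- Re w)" by auto
  hence "norm (exp w - exp (- w)) \<ge> \<bar>exp (Re w) - exp (- Re w)\<bar>"
    by (metis norm_triangle_ineq3)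
  moreover have "\<bar>exp (Re w) - exp (- Re w)\<bar> \<ge> exp \<bar>Re w\<bar> / 2"
    using *[of "Re w"] *[of "- Re w"] assms by (cases "Re w \<ge> 0") auto
  ultimately show ?thesis by (simp add: sinh_field_def norm_divide)
qed

lemma sinh_eq_0_in_strip:
  fixes w :: complex
  assumes "sinh w = 0" "0 < Im w" "Im w < 2 * pi"
  shows "w = \<i> * pi"
proof -
  from assms(1) have "exp w = 1 \<or> exp w = - 1" by (simp add: sinh_zero_iff)
  thus ?thesis
  proof
    assume "exp w = 1"
    then obtain n :: int where n: "Im w = of_int (2 * n) * pi" by (auto simp: exp_eq_1)
    have "0 < real_of_int (2 * n) * pi" "real_of_int (2 * n) * pi < 2 * pi" using assms n by auto
    hence "0 < 2 * n" "2 * n < 2" using pi_gt_zero by (auto simp: zero_less_mult_iff)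
    thus ?thesis by auto
  next
    assume "exp w = - 1"
    hence "exp (w - \<i> * pi) = 1" by (simp add: exp_diff)
    then obtain n :: int where n: "Re w = 0" "Im w - pi = of_int (2 * n) * pi" by (auto simp: exp_eq_1)
    have "- 1 * pi < real_of_int (2 * n) * pi" "real_of_int (2 * n) * pi < 1 * pi"
      using assms(2,3) unfolding n(2)[symmetric] by auto
    hence "- 1 < real_of_int (2 * n)" "real_of_int (2 * n) < 1"
      using mult_less_cancel_right_pos[OF pi_gt_zero] by blast+
    hence "n = 0" by linarith
    thus ?thesis using n by (simp add: complex_eq_iff)
  qed
qed

text \<open>The zeros of \<open>sinh (u / s)\<close> are the integer multiples of
  \<open>\<i> * pi * s\<close>. As \<open>0 < d < pi * s\<close>, a rectangle of height
  \<open>pi * s\<close> starting at height \<open>d\<close> encloses only the first one, where the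
  derivative of \<open>sinh (u / s)\<close> is \<open>- 1 / s\<close>.\<close>

lemma rect_contour_integral:
  fixes s d R :: real and z :: complex
  assumes "s > 0" "0 < d" "d < pi * s" "R > 0"
  shows "contour_integral (rectpath (Complex (- R) d) (Complex R (d + pi * s)))
           (\<lambda>u. exp (- 2 * \<i> * z * u) / sinh (u / s)) = - 2 * pi * \<i> * s * exp (2 * pi * s * z)"
proof -
  define f where "f = (\<lambda>u. exp (- 2 * \<i> * z * u) / sinh (u / s))"
  define S where "S = {u. 0 < Im u \<and> Im u < 2 * pi * s}"
  define p where "p = \<i> * pi * s"
  define a1 where "a1 = Complex (- R) d"
  define a3 where "a3 = Complex R (d + pi * s)"
  have S: "open S" "connected S" "p \<in> S"
  proof -
    have "S = {u. 0 < Im u} \<inter> {u. Im u < 2 * pi * s}" by (auto simp: S_def)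
    moreover have "open \<dots>" by (intro open_Int open_halfspace_Im_lt open_halfspace_Im_gt)
    moreover have "convex ({u. 0 < Im u} \<inter> {u. Im u < 2 * pi * s})"
      by (intro convex_Int convex_halfspace_Im_lt convex_halfspace_Im_gt)
    ultimately show "open S" "connected S" by (auto intro: convex_connected)
    show "p \<in> S" using assms by (auto simp: S_def p_def)
  qed
  have nz: "sinh (u / s) \<noteq> 0" if "u \<in> S - {p}" for u
  proof
    assume "sinh (u / s) = 0"
    moreover have "0 < Im (u / s)" "Im (u / s) < 2 * pi"
      using that assms by (auto simp: S_def field_simps)
    ultimately have "u / s = \<i> * pi" by (rule sinh_eq_0_in_strip)
    hence "u = p" using assms by (auto simp: p_def field_simps)
    thus False using that by simp
  qed
  have hol1: "(\<lambda>u. exp (- 2 * \<i> * z * u)) holomorphic_on S" by (intro holomorphic_intros)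
  have hol2: "(\<lambda>u. sinh (u / s)) holomorphic_on S"
    unfolding sinh_field_def using assms by (intro holomorphic_intros) auto
  have "f holomorphic_on S - {p}"
    unfolding f_def using nz
    by (intro holomorphic_on_divide holomorphic_on_subset[OF hol1] holomorphic_on_subset[OF hol2]) auto
  moreover have psub: "path_image (rectpath a1 a3) \<subseteq> S - {p}"
  proof -
    have "path_image (rectpath a1 a3) \<subseteq> cbox a1 a3"
      by (rule path_image_rectpath_subset_cbox) (use assms in \<open>auto simp: a1_def a3_def\<close>)
    moreover have "cbox a1 a3 \<subseteq> S"
      using assms by (auto simp: a1_def a3_def in_cbox_complex_iff S_def)
    moreover have "p \<in> box a1 a3" using assms by (auto simp: a1_def a3_def in_box_complex_iff p_def)
    moreover have "path_image (rectpath a1 a3) \<inter> box a1 a3 = {}"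
      by (rule path_image_rectpath_inter_box) (use assms in \<open>auto simp: a1_def a3_def\<close>)
    ultimately show ?thesis by blast
  qed
  moreover have "winding_number (rectpath a1 a3) u = 0" if "u \<notin> S" for u
    by (rule winding_number_rectpath_outside)
       (use assms that in \<open>auto simp: a1_def a3_def in_cbox_complex_iff S_def\<close>)
  ultimately have "contour_integral (rectpath a1 a3) f
     = 2 * pi * \<i> * (\<Sum>q\<in>{p}. winding_number (rectpath a1 a3) q * residue f q)"
    using S by (intro Residue_theorem) auto
  also have "winding_number (rectpath a1 a3) p = 1"
    by (rule winding_number_rectpath)
       (use assms in \<open>auto simp: a1_def a3_def in_box_complex_iff p_def\<close>)
  hence "(\<Sum>q\<in>{p}. winding_number (rectpath a1 a3) q * residue f q) = residue f p" by simp
  also have "residue f p = exp (- 2 * \<i> * z * p) / (- 1 / s)"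
    unfolding f_def
  proof (rule residue_simple_pole_deriv[OF hol1 hol2 S])
    have "((\<lambda>u. sinh (u / s)) has_field_derivative (cosh (p / s) / s)) (at p)"
      using assms by (auto intro!: derivative_eq_intros)
    also have "p / s = \<i> * pi" using assms by (simp add: p_def)
    also have "cosh (\<i> * complex_of_real pi) = - 1" by (simp add: cosh_field_def exp_minus)
    finally show "((\<lambda>u. sinh (u / s)) has_field_derivative (- 1 / s)) (at p)" by simp
    show "sinh (p / s) = 0" using assms by (simp add: p_def sinh_zero_iff)
  qed (use assms in auto)
  also have "- 2 * \<i> * z * p = 2 * pi * s * z" by (simp add: p_def algebra_simps)
  finally show ?thesis using assms by (simp add: f_def a1_def a3_def field_simps)
qed

text \<open>Raising \<open>u\<close> by \<open>\<i> * pi * s\<close> multiplies the integrand by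
  \<open>- exp (2 * pi * s * z)\<close>, so both horizontal sides give the same integral up to this
  factor, and the vertical sides vanish in the limit. The factor
  \<open>1 + exp (2 * pi * s * z)\<close> stays on the left because its nonvanishing is later read
  off from this very identity.\<close>

lemma integral_exp_over_sinh:
  fixes s d :: real and z :: complex
  assumes s: "s > 0" and d: "0 < d" "d < pi * s" and z: "\<bar>Im z\<bar> < 1 / (2 * s)"
  shows "integral UNIV (\<lambda>t. exp (- 2 * \<i> * z * Complex t d) / sinh (Complex t d / s)) * (1 + exp (2 * pi * s * z))
       = - 2 * pi * \<i> * s * exp (2 * pi * s * z)"
proof -
  define f where "f = (\<lambda>u. exp (- 2 * \<i> * z * u) / sinh (u / s))"
  define g where "g = (\<lambda>t. inverse (sinh (Complex t d / s)))"
  define q where "q = sin (d / s)"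
  have q: "q > 0" unfolding q_def using assms by (intro sin_gt_zero) (auto simp: field_simps)
  have nzs: "sinh (u / s) \<noteq> 0" if "u \<in> cbox (Complex a d) (Complex b (d + pi * s)) - {\<i> * pi * s}" for u a b
  proof
    assume "sinh (u / s) = 0"
    moreover have "0 < Im (u / s)" "Im (u / s) < 2 * pi"
      using that assms by (auto simp: field_simps in_cbox_complex_iff)
    ultimately have "u / s = \<i> * pi" by (rule sinh_eq_0_in_strip)
    thus False using that assms by (auto simp: field_simps)
  qed
  have gle: "norm (g t) \<le> (2 / q) * exp (- (1 / s) * \<bar>t\<bar>)" for t
  proof -
    have "q * exp (\<bar>t\<bar> / s) / 2 \<le> norm (sinh (Complex t d / s))"
      using norm_sinh_ge[of "Complex t d / s"] q s by (simp add: q_def)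
    hence "norm (g t) \<le> inverse (q * exp (\<bar>t\<bar> / s) / 2)"
      unfolding g_def norm_inverse using q by (intro le_imp_inverse_le) auto
    also have "\<dots> = (2 / q) * exp (- (1 / s) * \<bar>t\<bar>)" by (simp add: exp_minus field_simps)
    finally show ?thesis .
  qed
  have contg: "continuous_on UNIV g"
  proof -
    have "sinh (Complex t d / s) \<noteq> 0" for t
      by (rule nzs[of _ t t]) (use s d in \<open>auto simp: in_cbox_complex_iff complex_eq_iff\<close>)
    thus ?thesis unfolding g_def sinh_field_def Complex_eq using s
      by (intro continuous_intros) (auto simp: sinh_field_def)
  qed
  have ai: "(\<lambda>t. exp (- 2 * \<i> * z * Complex t d) * g t) absolutely_integrable_on UNIV"
    by (rule exp_line_integrable[OF contg gle]) (use z in simp)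
  define J where "J = (\<lambda>R. integral {- R..R} (\<lambda>t. f (Complex t d)))"
  define side where "side = (\<lambda>R. contour_integral (linepath (Complex R d) (Complex R (d + pi * s))) f)"
  have contf: "continuous_on (cbox (Complex a d) (Complex b (d + pi * s)) - {\<i> * pi * s}) f" for a b
    unfolding f_def using nzs s
    by (intro continuous_intros) (auto simp: sinh_field_def intro!: continuous_intros)
  have ci: "f contour_integrable_on linepath u v"
    if "closed_segment u v \<subseteq> cbox (Complex a d) (Complex b (d + pi * s)) - {\<i> * pi * s}" for u v a b
    by (rule contour_integrable_continuous_linepath[OF continuous_on_subset[OF contf that]])
  have segv: "closed_segment (Complex r d) (Complex r (d + pi * s)) \<subseteq> cbox (Complex r d) (Complex r (d + pi * s)) - {\<i> * pi * s}"
    if "r \<noteq> 0" for r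
    using that s by (auto simp: closed_segment_same_Re closed_segment_eq_real_ivl in_cbox_complex_iff)
  have main: "J R * (1 + exp (2 * pi * s * z)) + side R - side (- R) = - 2 * pi * \<i> * s * exp (2 * pi * s * z)"
    if R: "R > 0" for R
  proof -
    let ?b = "Complex (- R) d" and ?c = "Complex R d" and ?e = "Complex R (d + pi * s)" and ?h = "Complex (- R) (d + pi * s)"
    have i1: "f contour_integrable_on linepath ?b ?c" "f contour_integrable_on linepath ?h ?e"
      by (rule ci[of _ _ "-R" R], use R s d in \<open>auto simp: closed_segment_same_Im closed_segment_eq_real_ivl in_cbox_complex_iff\<close>)+
    have i2: "f contour_integrable_on linepath ?c ?e" "f contour_integrable_on linepath ?b ?h"
      using R by (auto intro!: ci[OF segv])
    have i3: "f contour_integrable_on linepath ?e ?h" "f contour_integrable_on linepath ?h ?b"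
      using i1(2) i2(2) contour_integrable_reversepath[of _ f]
      by (metis reversepath_linepath valid_path_linepath)+
    have "contour_integral (rectpath ?b ?e) f = contour_integral (linepath ?b ?c) f
        + contour_integral (linepath ?c ?e) f + contour_integral (linepath ?e ?h) f + contour_integral (linepath ?h ?b) f"
      unfolding rectpath_def Let_def using i1 i2 i3
      by (simp add: contour_integrable_joinI)
    also have "contour_integral (linepath ?e ?h) f = - contour_integral (linepath ?h ?e) f"
      using contour_integral_reversepath[of "linepath ?h ?e" f] by simp
    also have "contour_integral (linepath ?h ?b) f = - side (- R)"
      unfolding side_def using contour_integral_reversepath[of "linepath ?b ?h" f] by simp
    also have "contour_integral (linepath ?b ?c) f = J R"
      unfolding J_def using R by (intro contour_integral_linepath_same_Im) auto
    also have "contour_integral (linepath ?h ?e) f = integral {-R..R} (\<lambda>t. f (Complex t (d + pi * s)))"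
      using R by (intro contour_integral_linepath_same_Im) auto
    also have "(\<lambda>t. f (Complex t (d + pi * s))) = (\<lambda>t. - exp (2 * pi * s * z) * f (Complex t d))"
    proof
      fix t
      have "Complex t (d + pi * s) = Complex t d + \<i> * pi * s" by (simp add: complex_eq_iff)
      moreover have "- 2 * \<i> * z * (Complex t d + \<i> * pi * s) = 2 * pi * s * z + - 2 * \<i> * z * Complex t d"
        by (simp add: algebra_simps)
      moreover have "(Complex t d + \<i> * pi * s) / s = Complex t d / s + \<i> * pi" using s by (simp add: field_simps)
      moreover have "sinh (Complex t d / s + \<i> * pi) = - sinh (Complex t d / s)"
        by (simp add: sinh_add) (simp add: sinh_field_def cosh_field_def exp_minus)
      ultimately show "f (Complex t (d + pi * s)) = - exp (2 * pi * s * z) * f (Complex t d)"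
        unfolding f_def by (simp only: exp_add) simp
    qed
    also have "integral {-R..R} \<dots> = - exp (2 * pi * s * z) * J R"
      unfolding J_def by (rule integral_mult_right)
    finally show ?thesis
      using rect_contour_integral[OF s d R, of z] unfolding f_def side_def by (simp add: algebra_simps)
  qed
  \<comment> \<open>For \<open>\<bar>r\<bar> \<ge> s\<close> the real part of \<open>u / s\<close>
    has modulus at least 1, as \<open>norm_sinh_ge_of_Re\<close> demands. The rate in the bound is
    positive because \<open>\<bar>Im z\<bar> < 1 / (2 * s)\<close>.\<close>
  have sidele: "norm (side r) \<le> 4 * exp (2 * \<bar>Re z\<bar> * (d + pi * s)) * (pi * s) * exp (- (1 / s - 2 * \<bar>Im z\<bar>) * \<bar>r\<bar>)"
    if r: "\<bar>r\<bar> \<ge> s" for r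
  proof -
    have r0: "r \<noteq> 0" using r s by auto
    have "norm (side r) \<le> (4 * exp (2 * \<bar>Re z\<bar> * (d + pi * s)) * exp (- (1 / s - 2 * \<bar>Im z\<bar>) * \<bar>r\<bar>)) * norm (Complex r (d + pi * s) - Complex r d)"
      unfolding side_def
    proof (rule contour_integral_bound_linepath)
      show "f contour_integrable_on linepath (Complex r d) (Complex r (d + pi * s))"
        by (rule ci[OF segv[OF r0]])
      fix u assume "u \<in> closed_segment (Complex r d) (Complex r (d + pi * s))"
      then obtain y where u: "u = Complex r y" and y: "d \<le> y" "y \<le> d + pi * s"
        using s by (cases u) (auto simp: closed_segment_same_Re closed_segment_eq_real_ivl)
      have "exp (\<bar>r\<bar> / s) / 4 \<le> norm (sinh (u / s))"
        using norm_sinh_ge_of_Re[of "u / s"] r s by (simp add: u)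
      moreover have "norm (exp (- 2 * \<i> * z * u)) \<le> exp (2 * \<bar>Im z\<bar> * \<bar>r\<bar> + 2 * \<bar>Re z\<bar> * \<bar>y\<bar>)"
        unfolding u by (rule norm_exp_line_le)
      moreover have "\<dots> \<le> exp (2 * \<bar>Im z\<bar> * \<bar>r\<bar> + 2 * \<bar>Re z\<bar> * (d + pi * s))"
        using y d by (simp add: mult_left_mono)
      ultimately have "norm (f u) \<le> exp (2 * \<bar>Im z\<bar> * \<bar>r\<bar> + 2 * \<bar>Re z\<bar> * (d + pi * s)) / (exp (\<bar>r\<bar> / s) / 4)"
        unfolding f_def norm_divide by (intro frac_le) auto
      also have "\<dots> = 4 * exp (2 * \<bar>Re z\<bar> * (d + pi * s)) * exp (2 * \<bar>Im z\<bar> * \<bar>r\<bar> - \<bar>r\<bar> / s)"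
        by (simp add: exp_add exp_diff)
      also have "2 * \<bar>Im z\<bar> * \<bar>r\<bar> - \<bar>r\<bar> / s = - (1 / s - 2 * \<bar>Im z\<bar>) * \<bar>r\<bar>" by (simp add: algebra_simps)
      finally show "norm (f u) \<le> 4 * exp (2 * \<bar>Re z\<bar> * (d + pi * s)) * exp (- (1 / s - 2 * \<bar>Im z\<bar>) * \<bar>r\<bar>)" .
    qed auto
    also have "Complex r (d + pi * s) - Complex r d = \<i> * (pi * s)" by (simp add: complex_eq_iff)
    also have "norm \<dots> = pi * s" using s by (simp add: norm_mult)
    finally show ?thesis by (simp add: mult_ac)
  qed
  have e: "1 / s - 2 * \<bar>Im z\<bar> > 0" using z s by (simp add: field_simps)
  have lim0: "(\<lambda>n. 4 * exp (2 * \<bar>Re z\<bar> * (d + pi * s)) * (pi * s) * exp (- (1 / s - 2 * \<bar>Im z\<bar>) * real n)) \<longlonglongrightarrow> 0"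
  proof -
    have "filterlim (\<lambda>n. - (1 / s - 2 * \<bar>Im z\<bar>) * real n) at_bot sequentially"
      by (rule filterlim_tendsto_neg_mult_at_bot[OF tendsto_const _ filterlim_real_sequentially]) (use e in auto)
    hence "(\<lambda>n. exp (- (1 / s - 2 * \<bar>Im z\<bar>) * real n)) \<longlonglongrightarrow> 0"
      by (rule filterlim_compose[OF exp_at_bot])
    from tendsto_mult_right_zero[OF this] show ?thesis by blast
  qed
  have sl: "(\<lambda>n. side (\<sigma> * real n)) \<longlonglongrightarrow> 0" if "\<bar>\<sigma>\<bar> = 1" for \<sigma>
  proof (rule Lim_null_comparison[OF _ lim0])
    obtain m where "s \<le> real m" using real_arch_simple by blast
    thus "\<forall>\<^sub>F n in sequentially. norm (side (\<sigma> * real n)) \<le> 4 * exp (2 * \<bar>Re z\<bar> * (d + pi * s)) * (pi * s) * exp (- (1 / s - 2 * \<bar>Im z\<bar>) * real n)"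
      unfolding eventually_sequentially using that
      by (intro exI[of _ m]) (auto intro!: order_trans[OF sidele] simp: abs_mult)
  qed
  have JL: "(\<lambda>n. J (real n)) \<longlonglongrightarrow> integral UNIV (\<lambda>t. exp (- 2 * \<i> * z * Complex t d) * g t)"
    using integral_symmetric_tendsto[OF ai] unfolding J_def f_def g_def by (simp add: divide_inverse)
  have "(\<lambda>n. J (real n) * (1 + exp (2 * pi * s * z)) + side (1 * real n) - side (-1 * real n))
      \<longlonglongrightarrow> integral UNIV (\<lambda>t. exp (- 2 * \<i> * z * Complex t d) * g t) * (1 + exp (2 * pi * s * z)) + 0 - 0"
    by (intro tendsto_intros JL sl) auto
  moreover have "\<forall>\<^sub>F n in sequentially. J (real n) * (1 + exp (2 * pi * s * z)) + side (1 * real n) - side (-1 * real n) = - 2 * pi * \<i> * s * exp (2 * pi * s * z)"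
    using eventually_gt_at_top[of 0] by eventually_elim (use main in auto)
  hence "(\<lambda>n. J (real n) * (1 + exp (2 * pi * s * z)) + side (1 * real n) - side (-1 * real n)) \<longlonglongrightarrow> - 2 * pi * \<i> * s * exp (2 * pi * s * z)"
    by (rule tendsto_eventually)
  ultimately show ?thesis
    using LIMSEQ_unique unfolding g_def by (fastforce simp: divide_inverse)
qed

section \<open>The functional equation of the Faddeev integral\<close>

text \<open>The contour of \<open>faddeev_integral\<close> for \<open>s \<ge> 1\<close>, where
  \<open>min s (1 / s)\<close> is \<open>1 / s\<close>.\<close>

definition faddeev_line :: "real \<Rightarrow> real \<Rightarrow> complex" where
  "faddeev_line s t = Complex t (pi / (2 * s))"

text \<open>On this line \<open>w * s\<close> has imaginary part \<open>pi / 2\<close>, whose sine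
  is 1, and \<open>w / s\<close> has imaginary part \<open>pi / (2 * s\<^sup>2)\<close>, strictly
  between 0 and pi. These two sines are the constants in the bounds.\<close>

lemma faddeev_line_facts:
  assumes "s \<ge> 1"
  shows "continuous_on UNIV (faddeev_line s)"
    and "1 / norm (faddeev_line s t) \<le> 2 * s / pi" "faddeev_line s t \<noteq> 0"
    and "inverse (norm (sinh (faddeev_line s t / s))) \<le> (2 / sin (pi / (2 * s\<^sup>2))) * exp (- (1 / s) * \<bar>t\<bar>)"
    and "sinh (faddeev_line s t / s) \<noteq> 0"
    and "inverse (norm (sinh (faddeev_line s t * s))) \<le> 2 * exp (- s * \<bar>t\<bar>)"
    and "sinh (faddeev_line s t * s) \<noteq> 0"
proof -
  have *: "faddeev_line s t = of_real t + \<i> * of_real (pi / (2 * s))" for t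
    by (simp add: faddeev_line_def complex_eq_iff)
  show "continuous_on UNIV (faddeev_line s)"
    by (subst continuous_on_cong[OF refl *]) (intro continuous_intros)
  have "0 < pi / (2 * s)" using assms by simp
  moreover have "pi / (2 * s) \<le> norm (faddeev_line s t)"
    using abs_Im_le_cmod[of "faddeev_line s t"] assms by (simp add: faddeev_line_def)
  ultimately show "faddeev_line s t \<noteq> 0" "1 / norm (faddeev_line s t) \<le> 2 * s / pi"
    using frac_le[of 1 1 "pi / (2 * s)" "norm (faddeev_line s t)"] by auto
  define q where "q = sin (pi / (2 * s\<^sup>2))"
  have "s\<^sup>2 \<ge> 1" using assms by (simp add: one_le_power)
  hence "pi / (2 * s\<^sup>2) \<le> pi / (2 * 1)" by (intro divide_left_mono mult_left_mono) auto
  hence "pi / (2 * s\<^sup>2) < pi" using pi_gt_zero by linarith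
  moreover have "pi / (2 * s\<^sup>2) > 0" using assms by (intro divide_pos_pos) auto
  ultimately have q: "q > 0" unfolding q_def by (intro sin_gt_zero)
  have "\<bar>q\<bar> * exp \<bar>t / s\<bar> / 2 \<le> norm (sinh (faddeev_line s t / s))"
    using norm_sinh_ge[of "faddeev_line s t / s"] assms
    by (simp add: faddeev_line_def q_def power2_eq_square mult.assoc)
  hence 1: "q * exp (\<bar>t\<bar> / s) / 2 \<le> norm (sinh (faddeev_line s t / s))" using q assms by simp
  moreover have "0 < q * exp (\<bar>t\<bar> / s) / 2" using q by simp
  ultimately show "sinh (faddeev_line s t / s) \<noteq> 0"
    by (metis norm_zero not_le)
  have "inverse (norm (sinh (faddeev_line s t / s))) \<le> inverse (q * exp (\<bar>t\<bar> / s) / 2)"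
    using 1 q by (intro le_imp_inverse_le) auto
  also have "\<dots> = (2 / q) * exp (- (1 / s) * \<bar>t\<bar>)" by (simp add: exp_minus field_simps)
  finally show "inverse (norm (sinh (faddeev_line s t / s))) \<le> (2 / sin (pi / (2 * s\<^sup>2))) * exp (- (1 / s) * \<bar>t\<bar>)"
    by (simp add: q_def)
  have "exp \<bar>t * s\<bar> / 2 \<le> norm (sinh (faddeev_line s t * s))"
    using norm_sinh_ge[of "faddeev_line s t * s"] assms
    by (simp add: faddeev_line_def)
  hence 2: "exp (s * \<bar>t\<bar>) / 2 \<le> norm (sinh (faddeev_line s t * s))" using assms by (simp add: abs_mult mult.commute)
  moreover have "0 < exp (s * \<bar>t\<bar>) / 2" by simp
  ultimately show "sinh (faddeev_line s t * s) \<noteq> 0"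
    by (metis norm_zero not_le)
  have "inverse (norm (sinh (faddeev_line s t * s))) \<le> inverse (exp (s * \<bar>t\<bar>) / 2)"
    using 2 by (intro le_imp_inverse_le) auto
  also have "\<dots> = 2 * exp (- s * \<bar>t\<bar>)" by (simp add: exp_minus field_simps)
  finally show "inverse (norm (sinh (faddeev_line s t * s))) \<le> 2 * exp (- s * \<bar>t\<bar>)" .
qed

lemma continuous_sinh_faddeev_line:
  assumes "s \<ge> 1"
  shows "continuous_on UNIV (\<lambda>t. sinh (faddeev_line s t / s))"
        "continuous_on UNIV (\<lambda>t. sinh (faddeev_line s t * s))"
  unfolding sinh_field_def using assms
  by (auto intro!: continuous_intros faddeev_line_facts(1)[OF assms])

definition faddeev_kernel :: "real \<Rightarrow> real \<Rightarrow> complex" where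
  "faddeev_kernel s t = inverse (4 * sinh (faddeev_line s t * s) * sinh (faddeev_line s t / s) * faddeev_line s t)"

text \<open>What remains of the Faddeev kernel in the difference of the integrals at
  \<open>z - \<i> * s / 2\<close> and \<open>z + \<i> * s / 2\<close>: the exponentials combine to
  \<open>- 2 * sinh (w * s)\<close> and cancel one sinh of the denominator.\<close>

definition shift_kernel :: "real \<Rightarrow> real \<Rightarrow> complex" where
  "shift_kernel s t = - 1 / 2 * inverse (faddeev_line s t * sinh (faddeev_line s t / s))"

lemma faddeev_integral_eq:
  assumes "s \<ge> 1"
  shows "faddeev_integral s z = integral UNIV (\<lambda>t. exp (- 2 * \<i> * z * faddeev_line s t) * faddeev_kernel s t)"
proof -
  have "1 * 1 \<le> s * s" by (intro mult_mono) (use assms in auto)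
  hence "min s (1 / s) = 1 / s" using assms by (simp add: field_simps min_def)
  hence "complex_of_real t + \<i> * complex_of_real (pi * min s (1 / s) / 2) = faddeev_line s t" for t
    by (simp add: faddeev_line_def complex_eq_iff)
  thus ?thesis
    unfolding faddeev_integral_def Let_def faddeev_kernel_def by (simp only: divide_inverse)
qed

lemma continuous_faddeev_kernel: "s \<ge> 1 \<Longrightarrow> continuous_on UNIV (faddeev_kernel s)"
  unfolding faddeev_kernel_def
  by (auto intro!: continuous_intros continuous_sinh_faddeev_line faddeev_line_facts simp: faddeev_line_facts)

lemma continuous_shift_kernel: "s \<ge> 1 \<Longrightarrow> continuous_on UNIV (shift_kernel s)"
  unfolding shift_kernel_def
  by (auto intro!: continuous_intros continuous_sinh_faddeev_line faddeev_line_facts simp: faddeev_line_facts)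

lemma faddeev_kernel_bound:
  assumes "s \<ge> 1"
  shows "norm (faddeev_kernel s t)
     \<le> 1 / 4 * 2 * (2 / sin (pi / (2 * s\<^sup>2))) * (2 * s / pi) * exp (- (s + 1 / s) * \<bar>t\<bar>)"
proof -
  have "norm (faddeev_kernel s t) = 1 / 4 * inverse (norm (sinh (faddeev_line s t * s)))
      * inverse (norm (sinh (faddeev_line s t / s))) * (1 / norm (faddeev_line s t))"
    by (simp add: faddeev_kernel_def norm_mult norm_inverse norm_divide inverse_eq_divide)
  also have "\<dots> \<le> 1 / 4 * (2 * exp (- s * \<bar>t\<bar>)) * ((2 / sin (pi / (2 * s\<^sup>2))) * exp (- (1 / s) * \<bar>t\<bar>)) * (2 * s / pi)"
    by (rule mult_mono'[OF mult_mono'[OF mult_left_mono faddeev_line_facts(4)[OF assms]] faddeev_line_facts(2)[OF assms]])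
       (use faddeev_line_facts(6)[OF assms] in auto)
  also have "\<dots> = 1 / 4 * 2 * (2 / sin (pi / (2 * s\<^sup>2))) * (2 * s / pi) * (exp (- s * \<bar>t\<bar>) * exp (- (1 / s) * \<bar>t\<bar>))"
    by simp
  also have "exp (- s * \<bar>t\<bar>) * exp (- (1 / s) * \<bar>t\<bar>) = exp (- (s + 1 / s) * \<bar>t\<bar>)"
    by (simp add: exp_add[symmetric] algebra_simps)
  finally show ?thesis .
qed

lemma shift_kernel_bound:
  assumes "s \<ge> 1"
  shows "norm (shift_kernel s t) \<le> 1 / 2 * (2 * s / pi) * (2 / sin (pi / (2 * s\<^sup>2))) * exp (- (1 / s) * \<bar>t\<bar>)"
proof -
  have "norm (shift_kernel s t) = 1 / 2 * (1 / norm (faddeev_line s t)) * inverse (norm (sinh (faddeev_line s t / s)))"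
    by (simp add: shift_kernel_def norm_mult norm_inverse norm_divide inverse_eq_divide)
  also have "\<dots> \<le> 1 / 2 * (2 * s / pi) * ((2 / sin (pi / (2 * s\<^sup>2))) * exp (- (1 / s) * \<bar>t\<bar>))"
    by (rule mult_mono'[OF mult_left_mono[OF faddeev_line_facts(2)[OF assms]] faddeev_line_facts(4)[OF assms]]) auto
  finally show ?thesis by (simp only: mult_ac)
qed

lemmas faddeev_integrable = exp_line_integrable[where d = "pi / (2 * s)", folded faddeev_line_def,
    OF continuous_faddeev_kernel faddeev_kernel_bound] for s
lemmas shift_integrable = exp_line_integrable[where d = "pi / (2 * s)", folded faddeev_line_def,
    OF continuous_shift_kernel shift_kernel_bound] for s
lemmas faddeev_deriv = exp_line_has_field_derivative[where d = "pi / (2 * s)", folded faddeev_line_def,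
    OF continuous_faddeev_kernel faddeev_kernel_bound] for s
lemmas shift_deriv = exp_line_has_field_derivative[where d = "pi / (2 * s)", folded faddeev_line_def,
    OF continuous_shift_kernel shift_kernel_bound] for s

lemma faddeev_integral_holomorphic:
  assumes "s \<ge> 1"
  shows "faddeev_integral s holomorphic_on {z. \<bar>Im z\<bar> < (s + 1 / s) / 2}"
proof -
  have "(faddeev_integral s has_field_derivative
     integral UNIV (\<lambda>t. exp (- 2 * \<i> * z * faddeev_line s t) * (- 2 * \<i> * faddeev_line s t * faddeev_kernel s t))) (at z)"
    if "\<bar>Im z\<bar> < (s + 1 / s) / 2" for z
    unfolding faddeev_integral_eq[OF assms, abs_def] by (rule faddeev_deriv[OF assms assms that])
  thus ?thesis
    using field_differentiable_at_within field_differentiable_def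
    unfolding holomorphic_on_def by blast
qed

definition shift_integral :: "real \<Rightarrow> complex \<Rightarrow> complex" where
  "shift_integral s z = integral UNIV (\<lambda>t. exp (- 2 * \<i> * z * faddeev_line s t) * shift_kernel s t)"

text \<open>The bound on \<open>Im z\<close> keeps both shifted arguments inside the strip of
  convergence, whose half-width is \<open>s / 2 + 1 / (2 * s)\<close>.\<close>

lemma faddeev_integral_diff:
  assumes s: "s \<ge> 1" and z: "\<bar>Im z\<bar> < 1 / (2 * s)"
  shows "faddeev_integral s (z - \<i> * s / 2) - faddeev_integral s (z + \<i> * s / 2) = shift_integral s z"
proof -
  have z': "\<bar>Im (z - \<i> * s / 2)\<bar> < (s + 1 / s) / 2" "\<bar>Im (z + \<i> * s / 2)\<bar> < (s + 1 / s) / 2"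
  proof -
    define u where "u = 1 / s"
    have "\<bar>Im z\<bar> < u / 2" using z by (simp add: u_def)
    moreover have "Im (z - \<i> * s / 2) = Im z - s / 2" "Im (z + \<i> * s / 2) = Im z + s / 2" by auto
    ultimately have "\<bar>Im (z - \<i> * s / 2)\<bar> < (s + 1 / s) / 2 \<and> \<bar>Im (z + \<i> * s / 2)\<bar> < (s + 1 / s) / 2"
      using s unfolding u_def[symmetric] by (auto simp: abs_less_iff field_simps)
    thus "\<bar>Im (z - \<i> * s / 2)\<bar> < (s + 1 / s) / 2" "\<bar>Im (z + \<i> * s / 2)\<bar> < (s + 1 / s) / 2" by auto
  qed
  let ?A = "\<lambda>t. exp (- 2 * \<i> * (z - \<i> * s / 2) * faddeev_line s t) * faddeev_kernel s t"
  let ?B = "\<lambda>t. exp (- 2 * \<i> * (z + \<i> * s / 2) * faddeev_line s t) * faddeev_kernel s t"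
  have "integral UNIV (\<lambda>t. ?A t - ?B t) = integral UNIV ?A - integral UNIV ?B"
    by (intro integral_diff set_lebesgue_integral_eq_integral(1) faddeev_integrable s z')
  also have "(\<lambda>t. ?A t - ?B t) = (\<lambda>t. exp (- 2 * \<i> * z * faddeev_line s t) * shift_kernel s t)"
  proof
    fix t
    let ?w = "faddeev_line s t"
    have "?A t - ?B t = exp (- 2 * \<i> * z * ?w) * (exp (- (?w * s)) - exp (?w * s)) * faddeev_kernel s t"
    proof -
      have "- 2 * \<i> * (z - \<i> * s / 2) * ?w = - 2 * \<i> * z * ?w + - (?w * s)"
           "- 2 * \<i> * (z + \<i> * s / 2) * ?w = - 2 * \<i> * z * ?w + ?w * s"
        by (simp_all add: algebra_simps)
      thus ?thesis by (simp only: exp_add) (simp add: algebra_simps)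
    qed
    also have "exp (- (?w * s)) - exp (?w * s) = - 2 * sinh (?w * s)" by (simp add: sinh_field_def)
    finally have "?A t - ?B t = exp (- 2 * \<i> * z * ?w) * (- 2 * sinh (?w * s) * faddeev_kernel s t)"
      by (simp only: mult.assoc)
    also have "- 2 * sinh (?w * s) * faddeev_kernel s t = shift_kernel s t"
      using faddeev_line_facts(3,5,7)[OF s, of t]
      by (simp add: faddeev_kernel_def shift_kernel_def field_simps)
    finally show "?A t - ?B t = exp (- 2 * \<i> * z * ?w) * shift_kernel s t" .
  qed
  finally show ?thesis unfolding faddeev_integral_eq[OF s] shift_integral_def by simp
qed

text \<open>Differentiating cancels the factor \<open>1 / w\<close> of the kernel and leaves the
  integral found by residues, which is the logarithmic derivative of the right-hand side. The
  quotient of both sides is thus constant on the strip, and the constant is found by letting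
  \<open>z\<close> tend to minus infinity.\<close>

lemma exp_shift_integral:
  fixes z :: complex
  assumes s: "s \<ge> 1" and z: "\<bar>Im z\<bar> < 1 / (2 * s)"
  shows "exp (shift_integral s z) = 1 + exp (2 * pi * s * z)"
proof -
  define S where "S = {z::complex. \<bar>Im z\<bar> < 1 / (2 * s)}"
  have d: "0 < pi / (2 * s)" "pi / (2 * s) < pi * s"
  proof -
    have "1 * 1 \<le> s * s" by (intro mult_mono) (use s in auto)
    thus "0 < pi / (2 * s)" "pi / (2 * s) < pi * s" using s by (auto simp: field_simps)
  qed
  let ?K = "\<lambda>z::complex. integral UNIV (\<lambda>t. exp (- 2 * \<i> * z * faddeev_line s t) / sinh (faddeev_line s t / s))"
  let ?E = "\<lambda>z::complex. exp (2 * pi * s * z)"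
  have K: "?K z * (1 + ?E z) = - 2 * pi * \<i> * s * ?E z" if "z \<in> S" for z
    using integral_exp_over_sinh[of s "pi / (2 * s)" z] d that s by (simp add: S_def faddeev_line_def)
  \<comment> \<open>A zero of this factor would make the right-hand side of the residue identity
    vanish, yet that side is a nonzero multiple of an exponential.\<close>
  have nz: "1 + ?E z \<noteq> 0" if "z \<in> S" for z
  proof
    assume "1 + ?E z = 0"
    with K[OF that] have "- 2 * pi * \<i> * s * ?E z = 0" by simp
    thus False using s by simp
  qed
  have D: "(shift_integral s has_field_derivative (\<i> * ?K z)) (at z)" if "z \<in> S" for z
  proof -
    have "\<bar>Im z\<bar> < 1 / s / 2" using that by (simp add: S_def)
    from shift_deriv[OF s s this]
    have "(shift_integral s has_field_derivative integral UNIV (\<lambda>t. exp (- 2 * \<i> * z * faddeev_line s t)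
         * (- 2 * \<i> * faddeev_line s t * shift_kernel s t))) (at z)"
      unfolding shift_integral_def[abs_def] .
    also have "(\<lambda>t. exp (- 2 * \<i> * z * faddeev_line s t) * (- 2 * \<i> * faddeev_line s t * shift_kernel s t))
       = (\<lambda>t. \<i> * (exp (- 2 * \<i> * z * faddeev_line s t) / sinh (faddeev_line s t / s)))"
      using faddeev_line_facts(3,5)[OF s] by (auto simp: fun_eq_iff shift_kernel_def field_simps)
    also have "integral UNIV \<dots> = \<i> * ?K z" by (rule integral_mult_right)
    finally show ?thesis .
  qed
  have deriv0: "((\<lambda>z. exp (shift_integral s z) / (1 + ?E z)) has_field_derivative 0) (at z within S)" if "z \<in> S" for z
  proof (rule has_field_derivative_at_within)
    have "\<i> * ?K z * (1 + ?E z) = 2 * pi * s * ?E z"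
    proof -
      have "\<i> * k * e = 2 * pi * s * x" if "k * e = - 2 * pi * \<i> * s * x" for k e x :: complex
        using that by (simp add: mult.assoc)
      from this[OF K[OF that]] show ?thesis .
    qed
    moreover have "((\<lambda>z. exp (shift_integral s z) / (1 + ?E z)) has_field_derivative
       exp (shift_integral s z) * (\<i> * ?K z * (1 + ?E z) - 2 * pi * s * ?E z) / (1 + ?E z)\<^sup>2) (at z)"
    proof -
      have "((\<lambda>z. exp (shift_integral s z)) has_field_derivative exp (shift_integral s z) * (\<i> * ?K z)) (at z)"
        by (rule DERIV_chain2[OF DERIV_exp D[OF that]])
      moreover have "((\<lambda>z. 1 + ?E z) has_field_derivative ?E z * (2 * pi * s)) (at z)"
        by (auto intro!: derivative_eq_intros)
      ultimately have "((\<lambda>z. exp (shift_integral s z) / (1 + ?E z)) has_field_derivative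
         (exp (shift_integral s z) * (\<i> * ?K z) * (1 + ?E z) - exp (shift_integral s z) * (?E z * (2 * pi * s)))
           / ((1 + ?E z) * (1 + ?E z))) (at z)"
        using nz[OF that] by (rule DERIV_divide)
      moreover have "exp (shift_integral s z) * k * (1 + ?E z) - exp (shift_integral s z) * (?E z * (2 * pi * s))
         = exp (shift_integral s z) * (k * (1 + ?E z) - 2 * pi * s * ?E z)" for k
        by (simp add: algebra_simps)
      ultimately show ?thesis by (simp only: power2_eq_square)
    qed
    ultimately show "((\<lambda>z. exp (shift_integral s z) / (1 + ?E z)) has_field_derivative 0) (at z)"
      by (simp only: diff_self mult_zero_right div_0)
  qed
  have conv: "convex S"
  proof -
    have "S = {z. Im z < 1 / (2 * s)} \<inter> {z. Im z > - (1 / (2 * s))}" by (auto simp: S_def)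
    thus ?thesis using convex_Int convex_halfspace_Im_lt convex_halfspace_Im_gt by metis
  qed
  obtain c where c: "\<And>z. z \<in> S \<Longrightarrow> exp (shift_integral s z) / (1 + ?E z) = c"
    using has_field_derivative_zero_constant[OF conv deriv0] by metis
  have aik: "shift_kernel s absolutely_integrable_on UNIV"
    using shift_integrable[OF s s, of 0] s by simp
  define I where "I = integral UNIV (\<lambda>t. norm (shift_kernel s t))"
  \<comment> \<open>At \<open>z = - n\<close> the exponential has modulus
    \<open>exp (- 2 * n * Im w)\<close>, and \<open>Im w = pi / (2 * s)\<close> all along the
    contour.\<close>
  have bound: "norm (shift_integral s (- of_nat n)) \<le> exp (- (pi / s) * real n) * I" for n
    unfolding shift_integral_def I_def integral_mult_right[symmetric]
  proof (rule integral_norm_bound_integral)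
    show "(\<lambda>t. exp (- 2 * \<i> * - of_nat n * faddeev_line s t) * shift_kernel s t) integrable_on UNIV"
      using shift_integrable[OF s s, of "- of_nat n"] s
      by (intro set_lebesgue_integral_eq_integral(1)) auto
    show "(\<lambda>t. exp (- (pi / s) * real n) * norm (shift_kernel s t)) integrable_on UNIV"
      using aik by (intro integrable_on_mult_right) (simp add: absolutely_integrable_on_def)
    fix t
    have "Re (- 2 * \<i> * - of_nat n * faddeev_line s t) = - (pi / s) * real n"
      by (simp add: faddeev_line_def)
    thus "norm (exp (- 2 * \<i> * - of_nat n * faddeev_line s t) * shift_kernel s t)
        \<le> exp (- (pi / s) * real n) * norm (shift_kernel s t)"
      by (simp only: norm_mult norm_exp_eq_Re order.refl)
  qed
  have exp0: "(\<lambda>n. exp (- k * real n)) \<longlonglongrightarrow> 0" if "k > 0" for k :: real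
  proof -
    have "filterlim (\<lambda>n. - k * real n) at_bot sequentially"
      by (rule filterlim_tendsto_neg_mult_at_bot[OF tendsto_const _ filterlim_real_sequentially]) (use that in auto)
    thus ?thesis by (rule filterlim_compose[OF exp_at_bot])
  qed
  have "(\<lambda>n. exp (- (pi / s) * real n) * I) \<longlonglongrightarrow> 0"
    by (rule tendsto_mult_left_zero[OF exp0]) (use s in auto)
  hence "(\<lambda>n. shift_integral s (- of_nat n)) \<longlonglongrightarrow> 0"
    by (rule Lim_null_comparison[rotated]) (use bound in auto)
  moreover have "(\<lambda>n. ?E (- of_nat n)) \<longlonglongrightarrow> 0"
  proof (rule Lim_null_comparison[OF _ exp0])
    show "\<forall>\<^sub>F n in sequentially. norm (?E (- of_nat n)) \<le> exp (- (2 * pi * s) * real n)" by simp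
  qed (use s in auto)
  ultimately have "(\<lambda>n. exp (shift_integral s (- of_nat n)) / (1 + ?E (- of_nat n))) \<longlonglongrightarrow> exp 0 / (1 + 0)"
    by (intro tendsto_intros) auto
  moreover have "exp (shift_integral s (- of_nat n)) / (1 + ?E (- of_nat n)) = c" for n
    by (rule c) (use s in \<open>auto simp: S_def\<close>)
  ultimately have "(\<lambda>n::nat. c) \<longlonglongrightarrow> 1" by simp
  hence "c = 1" by (simp add: LIMSEQ_const_iff)
  thus ?thesis using c[of z] nz[of z] z by (simp add: S_def field_simps)
qed

lemma faddeev_functional_equation:
  fixes z :: complex
  assumes "s \<ge> 1" "\<bar>Im z\<bar> < 1 / (2 * s)"
  shows "exp (faddeev_integral s (z - \<i> * s / 2)) = (1 + exp (2 * pi * s * z)) * exp (faddeev_integral s (z + \<i> * s / 2))"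
  using exp_shift_integral[OF assms] faddeev_integral_diff[OF assms]
  by (metis diff_add_cancel exp_add)

section \<open>Analytic continuation of the quantum dilogarithm\<close>

lemma ee_simps:
  "ee (x + y) = ee x * ee y" "ee (x - y) = ee x / ee y" "ee (- x) = inverse (ee x)"
  "ee x \<noteq> 0" "ee 0 = 1" "ee (of_int k) = 1" "ee (of_nat n) = 1"
proof -
  show "ee (x + y) = ee x * ee y" "ee (x - y) = ee x / ee y" "ee (- x) = inverse (ee x)"
    by (simp_all add: ee_def distrib_left right_diff_distrib exp_add exp_diff exp_minus)
  show "ee x \<noteq> 0" "ee 0 = 1" by (simp_all add: ee_def)
  have *: "ee (of_int k) = 1" for k
    by (auto simp: ee_def exp_eq_1 intro!: exI[of _ k])
  show "ee (of_int k) = 1" by (rule *)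
  show "ee (of_nat n) = 1" using *[of "int n"] by simp
qed

lemma ee_eq_1_iff: "ee x = 1 \<longleftrightarrow> x \<in> \<int>"
proof
  assume "ee x = 1"
  then obtain n :: int where n: "Im x = 0" "2 * pi * Re x = of_int (2 * n) * pi"
    unfolding ee_def exp_eq_1 by auto
  hence "x = of_int n" by (simp add: complex_eq_iff)
  thus "x \<in> \<int>" by simp
qed (auto elim!: Ints_cases simp: ee_simps)

definition dilog_arg :: "nat \<Rightarrow> complex \<Rightarrow> complex" where
  "dilog_arg N \<zeta> = (let s = complex_of_real (sqrt (real N)) in \<i> * \<zeta> / s - \<i> / 2 * (s + 1 / s) + \<i> / s)"

definition dilog_strip :: "nat \<Rightarrow> complex \<Rightarrow> complex" where
  "dilog_strip N \<zeta> = exp (faddeev_integral (sqrt (real N)) (dilog_arg N \<zeta>))"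

lemma Im_dilog_arg:
  assumes "N \<ge> 2"
  shows "Im (dilog_arg N \<zeta>) = Re \<zeta> / sqrt (real N) - (sqrt (real N) + 1 / sqrt (real N)) / 2 + 1 / sqrt (real N)"
proof -
  define s where "s = sqrt (real N)"
  have s: "s > 0" using assms by (auto simp: s_def)
  show ?thesis
    unfolding dilog_arg_def Let_def s_def[symmetric] by (simp add: field_simps)
qed

text \<open>In the variable \<zeta> the strip of convergence has width \<open>N + 1\<close>. It
  overlaps its translate by \<open>N\<close> in a strip of width 1, which is where the functional
  equation first makes sense.\<close>

lemma Im_dilog_arg_less_iff:
  assumes "N \<ge> 2"
  shows "\<bar>Im (dilog_arg N \<zeta>)\<bar> < (sqrt (real N) + 1 / sqrt (real N)) / 2 \<longleftrightarrow> - 1 < Re \<zeta> \<and> Re \<zeta> < real N"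
proof -
  define s where "s = sqrt (real N)"
  define u where "u = 1 / s"
  have s: "u > 0" "s = real N * u"
    using assms unfolding u_def s_def by (auto simp: real_div_sqrt)
  have im: "Im (dilog_arg N \<zeta>) = Re \<zeta> * u - (s + u) / 2 + u"
    using Im_dilog_arg[OF assms] by (simp add: s_def u_def)
  have 1: "0 < (Re \<zeta> + 1) * u \<longleftrightarrow> - 1 < Re \<zeta>" using s by (auto simp: zero_less_mult_iff)
  have 2: "Re \<zeta> * u < real N * u \<longleftrightarrow> Re \<zeta> < real N" using s by simp
  have "\<bar>x * u - (real N * u + u) / 2 + u\<bar> < (real N * u + u) / 2 \<longleftrightarrow> 0 < (x + 1) * u \<and> x * u < real N * u" for x
    by (auto simp: abs_less_iff field_simps)
  thus ?thesis unfolding s_def[symmetric] im u_def[symmetric] unfolding s(2) using 1 2 by blast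
qed

lemma dilog_strip_holomorphic:
  assumes "N \<ge> 2"
  shows "dilog_strip N holomorphic_on {\<zeta>. - 1 < Re \<zeta> \<and> Re \<zeta> < real N}"
proof -
  have s: "sqrt (real N) \<ge> 1" using assms by simp
  have "dilog_arg N holomorphic_on {\<zeta>. - 1 < Re \<zeta> \<and> Re \<zeta> < real N}"
    unfolding dilog_arg_def Let_def using assms by (intro holomorphic_intros) auto
  hence "(faddeev_integral (sqrt (real N)) \<circ> dilog_arg N) holomorphic_on {\<zeta>. - 1 < Re \<zeta> \<and> Re \<zeta> < real N}"
    using Im_dilog_arg_less_iff[OF assms]
    by (intro holomorphic_on_compose_gen[OF _ faddeev_integral_holomorphic[OF s]]) auto
  thus ?thesis unfolding dilog_strip_def[abs_def] o_def by (intro holomorphic_intros)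
qed

text \<open>Adding \<open>N\<close> to \<zeta> moves the argument of the Faddeev function by
  \<open>\<i> * s\<close>, because \<open>N = s * s\<close>. At the midpoint \<open>z\<close> of the
  two arguments \<open>s * z = \<i> * \<zeta> + \<i> / 2\<close>, and the summand
  \<open>\<i> / 2\<close> turns the plus sign of the functional equation into a minus.\<close>

lemma dilog_strip_shift:
  assumes N: "N \<ge> 2" and \<zeta>: "- 1 < Re \<zeta>" "Re \<zeta> < 0"
  shows "dilog_strip N \<zeta> = (1 - ee \<zeta>) * dilog_strip N (\<zeta> + of_nat N)"
proof -
  define s where "s = sqrt (real N)"
  have s: "s \<ge> 1" "s * s = real N" using N by (auto simp: s_def)
  have sN: "complex_of_real s * complex_of_real s = of_nat N"
    using s(2) by (metis of_real_mult of_real_of_nat_eq)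
  define z where "z = dilog_arg N \<zeta> + \<i> * s / 2"
  have arg: "dilog_arg N \<zeta> = \<i> * \<zeta> / s - \<i> / 2 * (s + 1 / s) + \<i> / s" for \<zeta>
    unfolding dilog_arg_def Let_def s_def by simp
  define u where "u = 1 / s"
  have "u > 0" using s by (simp add: u_def)
  have "Im z = (Re \<zeta> + 1) * u - u / 2"
  proof -
    have "Im (dilog_arg N \<zeta>) = Re \<zeta> * u - (s + u) / 2 + u"
      using Im_dilog_arg[OF N, of \<zeta>] by (simp add: s_def u_def)
    thus ?thesis by (simp add: z_def field_simps)
  qed
  moreover have "(Re \<zeta> + 1) * u > 0" "(Re \<zeta> + 1) * u < 1 * u"
    using \<zeta> \<open>u > 0\<close> by (auto intro!: mult_strict_right_mono mult_pos_pos simp del: mult_1)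
  ultimately have "\<bar>Im z\<bar> < u / 2" by (auto simp: abs_less_iff field_simps)
  hence "\<bar>Im z\<bar> < 1 / (2 * s)" by (simp add: u_def)
  from faddeev_functional_equation[OF s(1) this]
  have "exp (faddeev_integral s (z - \<i> * s / 2)) = (1 + exp (2 * pi * s * z)) * exp (faddeev_integral s (z + \<i> * s / 2))" .
  moreover have "z - \<i> * s / 2 = dilog_arg N \<zeta>" by (simp add: z_def)
  moreover have "z + \<i> * s / 2 = dilog_arg N (\<zeta> + of_nat N)"
    using s(1) unfolding z_def arg sN[symmetric] by (simp add: field_simps)
  moreover have "exp (2 * pi * s * z) = - ee \<zeta>"
  proof -
    have "s * z = \<i> * \<zeta> + \<i> / 2" using s(1) by (simp add: z_def arg field_simps)
    hence "2 * pi * (s * z) = 2 * pi * \<i> * \<zeta> + \<i> * pi" by (simp add: distrib_left mult_ac)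
    hence "2 * pi * s * z = 2 * pi * \<i> * \<zeta> + \<i> * pi" by (simp only: mult.assoc of_real_mult)
    thus ?thesis by (simp add: ee_def exp_add)
  qed
  ultimately show ?thesis by (simp add: dilog_strip_def s_def)
qed

text \<open>\<zeta> is moved back to \<open>0 \<le> Re \<zeta> < N\<close> by \<open>j\<close> steps
  of size \<open>N\<close>. Each step costs the same factor, as \<open>ee\<close> is unchanged by
  it, so the cost is a single integer power.\<close>

definition dilog_ext :: "nat \<Rightarrow> complex \<Rightarrow> complex" where
  "dilog_ext N \<zeta> = (let j = \<lfloor>Re \<zeta> / real N\<rfloor> in
     dilog_strip N (\<zeta> - of_int j * of_nat N) * (1 - ee \<zeta>) powi (- j))"

lemma one_minus_ee_nonzero:
  assumes "- 1 < Re \<zeta> - of_int k" "Re \<zeta> - of_int k < 0"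
  shows "1 - ee \<zeta> \<noteq> 0"
proof
  assume "1 - ee \<zeta> = 0"
  hence "\<zeta> \<in> \<int>" by (simp add: ee_eq_1_iff[symmetric])
  then obtain m where "\<zeta> = of_int m" by (auto elim: Ints_cases)
  with assms have "- 1 < m - k" "m - k < 0" by (auto simp flip: of_int_diff)
  thus False by linarith
qed

text \<open>The floor in \<open>dilog_ext\<close> jumps at \<open>Re \<zeta> = j * N\<close>. The
  functional equation makes the branches \<open>j - 1\<close> and \<open>j\<close> agree on a strip
  of width 1 left of the jump, so one formula holds on an open set around it; holomorphy across the
  jump follows from this.\<close>

lemma dilog_ext_strip:
  assumes N: "N \<ge> 2" and j: "of_int j * real N - 1 < Re \<zeta>" "Re \<zeta> < (of_int j + 1) * real N"
  shows "dilog_ext N \<zeta> = dilog_strip N (\<zeta> - of_int j * of_nat N) * (1 - ee \<zeta>) powi (- j)"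
proof (cases "of_int j * real N \<le> Re \<zeta>")
  case True
  hence "\<lfloor>Re \<zeta> / real N\<rfloor> = j"
    using N j by (intro floor_unique) (auto simp: field_simps)
  thus ?thesis by (simp add: dilog_ext_def)
next
  case False
  have "real N * 1 \<ge> 1" using N by simp
  hence "\<lfloor>Re \<zeta> / real N\<rfloor> = j - 1"
    using N j False by (intro floor_unique) (auto simp: field_simps)
  moreover have "dilog_strip N (\<zeta> - of_int j * of_nat N)
     = (1 - ee (\<zeta> - of_int j * of_nat N)) * dilog_strip N (\<zeta> - of_int j * of_nat N + of_nat N)"
    by (rule dilog_strip_shift[OF N]) (use j False in auto)
  moreover have "ee (\<zeta> - of_int j * of_nat N) = ee \<zeta>"
    using ee_simps(6)[of "j * int N"] by (simp add: ee_simps(2))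
  moreover have "1 - ee \<zeta> \<noteq> 0"
    by (rule one_minus_ee_nonzero[of _ "j * int N"]) (use j False in auto)
  moreover have "\<zeta> - of_int j * of_nat N + of_nat N = \<zeta> - of_int (j - 1) * of_nat N" by (simp add: algebra_simps)
  moreover have "e powi (- (j - 1)) = e * e powi (- j)" if "e \<noteq> 0" for e :: complex
    using power_int_add[of e 1 "- j"] that by simp
  ultimately show ?thesis by (simp add: dilog_ext_def Let_def del: of_int_diff)
qed

lemma dilog_ext_shift:
  assumes N: "N \<ge> 2" and "\<zeta> \<notin> \<int>"
  shows "dilog_ext N \<zeta> = (1 - ee \<zeta>) * dilog_ext N (\<zeta> + of_nat N)"
proof -
  define j where "j = \<lfloor>Re \<zeta> / real N\<rfloor>"
  have nz: "1 - ee \<zeta> \<noteq> 0" using assms by (simp add: ee_eq_1_iff[symmetric])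
  have "\<lfloor>Re (\<zeta> + of_nat N) / real N\<rfloor> = j + 1"
    using N by (simp add: add_divide_distrib j_def)
  moreover have "\<zeta> + of_nat N - of_int (j + 1) * of_nat N = \<zeta> - of_int j * of_nat N"
    by (simp add: algebra_simps)
  moreover have "ee (\<zeta> + of_nat N) = ee \<zeta>" by (simp add: ee_simps)
  ultimately have "dilog_ext N (\<zeta> + of_nat N) = dilog_strip N (\<zeta> - of_int j * of_nat N) * (1 - ee \<zeta>) powi (- (j + 1))"
    by (simp only: dilog_ext_def Let_def)
  moreover have "(1 - ee \<zeta>) powi (- j) = (1 - ee \<zeta>) * (1 - ee \<zeta>) powi (- (j + 1))"
    using power_int_add[of "1 - ee \<zeta>" 1 "- (j + 1)"] nz by simp
  ultimately show ?thesis by (simp add: dilog_ext_def Let_def flip: j_def)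
qed

lemma dilog_ext_holomorphic:
  assumes N: "N \<ge> 2"
  shows "dilog_ext N holomorphic_on - {of_nat k | k. k \<ge> N}"
proof -
  have "dilog_ext N field_differentiable (at \<zeta>)" if \<zeta>: "\<zeta> \<notin> {of_nat k | k. k \<ge> N}" for \<zeta>
  proof -
    define j where "j = \<lfloor>Re \<zeta> / real N\<rfloor>"
    define S where "S = {\<xi>. of_int j * real N - 1 < Re \<xi> \<and> Re \<xi> < (of_int j + 1) * real N} - {of_nat k | k. k \<ge> N}"
    have "closed {complex_of_nat k | k. k \<ge> N}" by (rule closed_subset_Ints) auto
    moreover have "{\<xi>. of_int j * real N - 1 < Re \<xi> \<and> Re \<xi> < (of_int j + 1) * real N}
       = {\<xi>. of_int j * real N - 1 < Re \<xi>} \<inter> {\<xi>. Re \<xi> < (of_int j + 1) * real N}" by auto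
    ultimately have op: "open S"
      unfolding S_def by (auto intro!: open_Diff open_Int open_halfspace_Re_lt open_halfspace_Re_gt)
    have "of_int j \<le> Re \<zeta> / real N" "Re \<zeta> / real N < of_int j + 1" unfolding j_def by linarith+
    hence "of_int j * real N \<le> Re \<zeta>" "Re \<zeta> < (of_int j + 1) * real N" using N by (auto simp: field_simps)
    hence mem: "\<zeta> \<in> S" using \<zeta> by (auto simp: S_def)
    have "(\<lambda>\<xi>. dilog_strip N (\<xi> - of_int j * of_nat N)) holomorphic_on S"
      by (rule holomorphic_on_compose_gen[OF _ dilog_strip_holomorphic[OF N], of "\<lambda>\<xi>. \<xi> - of_int j * of_nat N", unfolded o_def])
         (auto intro!: holomorphic_intros simp: S_def algebra_simps)
    moreover have "(\<lambda>\<xi>. (1 - ee \<xi>) powi (- j)) holomorphic_on S"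
    proof (rule holomorphic_on_power_int)
      \<comment> \<open>For \<open>j \<ge> 1\<close> the exponent is negative, and the zeros of
        \<open>1 - ee x\<close> are the integers. Those with real part above
        \<open>j * N - 1\<close> are at least \<open>N\<close>, and these points have been removed
        from \<open>S\<close>.\<close>
      show "0 \<le> - j \<or> (\<forall>x\<in>S. 1 - ee x \<noteq> 0)"
      proof (cases "j \<le> 0")
        case False
        have "1 - ee x \<noteq> 0" if "x \<in> S" for x
        proof
          assume "1 - ee x = 0"
          hence "x \<in> \<int>" by (simp add: ee_eq_1_iff[symmetric])
          then obtain m where m: "x = of_int m" by (auto elim: Ints_cases)
          have "1 * real N \<le> of_int j * real N" using False by (intro mult_right_mono) auto
          also have "\<dots> < of_int m + 1" using that by (simp add: S_def m)
          finally have "real_of_int (int N) < of_int (m + 1)" by simp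
          hence "m \<ge> int N" by linarith
          hence "x = of_nat (nat m)" "nat m \<ge> N" using m by auto
          thus False using that by (auto simp: S_def)
        qed
        thus ?thesis by blast
      qed auto
      show "(\<lambda>x. 1 - ee x) holomorphic_on S" unfolding ee_def by (intro holomorphic_intros)
    qed
    ultimately have "(\<lambda>\<xi>. dilog_strip N (\<xi> - of_int j * of_nat N) * (1 - ee \<xi>) powi (- j)) holomorphic_on S"
      by (rule holomorphic_on_mult)
    moreover have "dilog_ext N holomorphic_on S \<longleftrightarrow>
       (\<lambda>\<xi>. dilog_strip N (\<xi> - of_int j * of_nat N) * (1 - ee \<xi>) powi (- j)) holomorphic_on S"
      by (rule holomorphic_cong[OF refl dilog_ext_strip[OF N]]) (auto simp: S_def)
    ultimately show ?thesis using holomorphic_on_imp_differentiable_at[OF _ op mem] by blast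
  qed
  thus ?thesis unfolding holomorphic_on_def by (auto intro: field_differentiable_at_within)
qed

section \<open>Identification of the continuation with Faddeev's function\<close>

definition dilog_arg_inv :: "nat \<Rightarrow> complex \<Rightarrow> complex" where
  "dilog_arg_inv N z = (let s = complex_of_real (sqrt (real N)) in - \<i> * s * (z + \<i> / 2 * (s + 1 / s) - \<i> / s))"

lemma dilog_arg_inverse:
  assumes "N \<ge> 2"
  shows "dilog_arg N (dilog_arg_inv N z) = z" "dilog_arg_inv N (dilog_arg N \<zeta>) = \<zeta>"
  using assms by (auto simp: dilog_arg_def dilog_arg_inv_def Let_def field_simps)

text \<open>In the variable \<zeta> the double progression of poles becomes
  \<open>N + m * N + n\<close>, so it collapses to the natural numbers from \<open>N\<close> on;
  \<open>m = 0\<close> already reaches all of them.\<close>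

lemma faddeev_poles_iff:
  assumes N: "N \<ge> 2"
  shows "z \<in> faddeev_poles (sqrt (real N)) \<longleftrightarrow> dilog_arg_inv N z \<in> {of_nat k | k. k \<ge> N}"
proof -
  define s where "s = sqrt (real N)"
  have s: "s > 0" "s * s = real N" using N by (auto simp: s_def)
  have sN: "complex_of_real s * complex_of_real s = of_nat N"
    using s(2) by (metis of_real_mult of_real_of_nat_eq)
  have *: "dilog_arg_inv N (\<i> * complex_of_real ((s + 1 / s) / 2 + real m * s + real n / s)) = of_nat (N + m * N + n)" for m n
  proof -
    have "dilog_arg_inv N (\<i> * complex_of_real ((s + 1 / s) / 2 + real m * s + real n / s))
       = s * s + of_nat m * (s * s) + of_nat n"
      using s(1) unfolding dilog_arg_inv_def Let_def s_def[symmetric]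
      by (simp add: field_simps)
    thus ?thesis by (simp add: sN)
  qed
  show ?thesis unfolding s_def[symmetric]
  proof
    assume "z \<in> faddeev_poles s"
    then obtain m n where "z = \<i> * complex_of_real ((s + 1 / s) / 2 + real m * s + real n / s)"
      unfolding faddeev_poles_def by blast
    with * have "dilog_arg_inv N z = of_nat (N + m * N + n)" by simp
    moreover have "N + m * N + n \<ge> N" by simp
    ultimately show "dilog_arg_inv N z \<in> {of_nat k | k. k \<ge> N}" by blast
  next
    assume "dilog_arg_inv N z \<in> {of_nat k | k. k \<ge> N}"
    then obtain k where k: "dilog_arg_inv N z = of_nat k" "k \<ge> N" by blast
    have "dilog_arg_inv N (\<i> * complex_of_real ((s + 1 / s) / 2 + real 0 * s + real (k - N) / s)) = of_nat (N + 0 * N + (k - N))"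
      by (rule *)
    also have "\<dots> = dilog_arg_inv N z" using k by simp
    finally have "\<i> * complex_of_real ((s + 1 / s) / 2 + real 0 * s + real (k - N) / s) = z"
      using dilog_arg_inverse(1)[OF N] by metis
    thus "z \<in> faddeev_poles s" unfolding faddeev_poles_def by blast
  qed
qed

text \<open>Since the strip of convergence is wider than the shift by \<open>N\<close>, the functional equation of
  that single shift already continues the dilogarithm to the whole plane.\<close>

lemma faddeev_Phi_eq:
  assumes N: "N \<ge> 2"
  shows "faddeev_Phi (sqrt (real N)) = (\<lambda>z. dilog_ext N (dilog_arg_inv N z))"
  unfolding faddeev_Phi_def
proof (rule the_equality)
  let ?s = "sqrt (real N)"
  let ?P = "faddeev_poles ?s"
  let ?U = "{z. \<bar>Im z\<bar> < (?s + 1 / ?s) / 2}"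
  let ?g = "\<lambda>z. dilog_ext N (dilog_arg_inv N z)"
  have "?g holomorphic_on - ?P"
    by (rule holomorphic_on_compose_gen[OF _ dilog_ext_holomorphic[OF N], of "dilog_arg_inv N", unfolded o_def])
       (use faddeev_poles_iff[OF N] in \<open>auto intro!: holomorphic_intros simp: dilog_arg_inv_def[abs_def] Let_def\<close>)
  moreover have "?g z = exp (faddeev_integral ?s z)" if "\<bar>Im z\<bar> < (?s + 1 / ?s) / 2" for z
  proof -
    let ?\<zeta> = "dilog_arg_inv N z"
    have "- 1 < Re ?\<zeta> \<and> Re ?\<zeta> < real N"
      using that Im_dilog_arg_less_iff[OF N, of ?\<zeta>] by (simp add: dilog_arg_inverse[OF N])
    hence "dilog_ext N ?\<zeta> = dilog_strip N ?\<zeta>" using dilog_ext_strip[OF N, of 0 ?\<zeta>] by simp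
    thus ?thesis by (simp add: dilog_strip_def dilog_arg_inverse[OF N])
  qed
  moreover have "?g z = 0" if "z \<in> ?P" for z
  proof -
    obtain k where k: "dilog_arg_inv N z = of_nat k" "k \<ge> N" using faddeev_poles_iff[OF N] \<open>z \<in> ?P\<close> by blast
    \<comment> \<open>A nonzero integer power of 0 is 0 in HOL, negative exponents included, so
      \<open>dilog_ext\<close> takes at each pole the junk value prescribed for
      \<open>faddeev_Phi\<close>.\<close>
    hence "\<lfloor>real k / real N\<rfloor> \<noteq> 0" using N by (simp add: floor_eq_iff field_simps)
    hence "(1 - ee (of_nat k)) powi (- \<lfloor>real k / real N\<rfloor>) = 0"
      by (simp add: ee_simps power_int_0_left_if)
    thus ?thesis by (simp add: k(1) dilog_ext_def Let_def)
  qed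
  ultimately show g: "?g holomorphic_on - ?P \<and> (\<forall>z. \<bar>Im z\<bar> < (?s + 1 / ?s) / 2 \<longrightarrow> ?g z = exp (faddeev_integral ?s z))
     \<and> (\<forall>z\<in>?P. ?g z = 0)" by blast
  fix f
  assume f: "f holomorphic_on - ?P \<and> (\<forall>z. \<bar>Im z\<bar> < (?s + 1 / ?s) / 2 \<longrightarrow> f z = exp (faddeev_integral ?s z))
     \<and> (\<forall>z\<in>?P. f z = 0)"
  have img: "?P = dilog_arg_inv N -` {of_nat k | k. k \<ge> N}" using faddeev_poles_iff[OF N] by blast
  have "closed ?P" unfolding img
  proof (rule closed_vimage)
    show "closed {complex_of_nat k |k. N \<le> k}" by (rule closed_subset_Ints) auto
    show "continuous_on UNIV (dilog_arg_inv N)"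
      unfolding dilog_arg_inv_def[abs_def] Let_def by (intro continuous_intros)
  qed
  hence op: "open (- ?P)" by (rule open_Compl)
  have "?P \<subseteq> dilog_arg N ` range of_nat"
  proof
    fix z assume "z \<in> ?P"
    then obtain k where "dilog_arg_inv N z = of_nat k" using faddeev_poles_iff[OF N] by blast
    hence "z = dilog_arg N (of_nat k)" using dilog_arg_inverse(1)[OF N, of z] by simp
    thus "z \<in> dilog_arg N ` range of_nat" by blast
  qed
  \<comment> \<open>The plane minus a countable set is path connected, which supplies the connected
    domain for the identity theorem.\<close>
  hence "countable ?P" by (rule countable_subset) auto
  hence conn: "connected (- ?P)"
    by (intro path_connected_imp_connected path_connected_complement_countable) auto
  have U: "?U \<subseteq> - ?P"
  proof -
    have "z \<notin> ?P" if "\<bar>Im z\<bar> < (?s + 1 / ?s) / 2" for z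
    proof
      assume "z \<in> ?P"
      then obtain k where k: "dilog_arg_inv N z = of_nat k" "k \<ge> N" using faddeev_poles_iff[OF N] by blast
      have "\<bar>Im (dilog_arg N (dilog_arg_inv N z))\<bar> < (?s + 1 / ?s) / 2"
        unfolding dilog_arg_inverse(1)[OF N] by (rule that)
      thus False unfolding Im_dilog_arg_less_iff[OF N] using k by simp
    qed
    thus ?thesis by auto
  qed
  have "open ?U"
  proof -
    have "{z. \<bar>Im z\<bar> < c} = {z. Im z < c} \<inter> {z. Im z > - c}" for c by auto
    thus ?thesis using open_Int open_halfspace_Im_lt open_halfspace_Im_gt by metis
  qed
  moreover have "?s > 0" using N by simp
  hence zU: "0 \<in> ?U" by (simp add: add_pos_pos)
  ultimately have lim: "0 islimpt ?U" by (intro interior_limit_point) (simp add: interior_open)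
  have hol: "(\<lambda>w. f w - ?g w) holomorphic_on - ?P" using f g by (intro holomorphic_on_diff) blast+
  have "f w - ?g w = 0" if "w \<in> - ?P" for w
  proof (rule analytic_continuation[OF hol op conn U _ lim _ that])
    show "0 \<in> - ?P" using zU U by blast
    show "f z - ?g z = 0" if "z \<in> ?U" for z using f g that by simp
  qed
  thus "f = ?g" using f g by (auto simp: fun_eq_iff) (metis ComplI eq_iff_diff_eq_0)
qed

lemma Lam_eq_dilog_ext:
  assumes "N \<ge> 2"
  shows "Lam N \<zeta> = dilog_ext N \<zeta>"
proof -
  have "Lam N \<zeta> = faddeev_Phi (sqrt (real N)) (dilog_arg N \<zeta>)"
    by (simp add: Lam_def dilog_arg_def Let_def)
  thus ?thesis by (simp add: faddeev_Phi_eq[OF assms] dilog_arg_inverse[OF assms])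
qed

lemma Lam_shift:
  assumes "N \<ge> 2" "\<zeta> \<notin> \<int>"
  shows "Lam N \<zeta> = (1 - ee \<zeta>) * Lam N (\<zeta> + of_nat N)"
  using dilog_ext_shift[OF assms] by (simp add: Lam_eq_dilog_ext[OF assms(1)])

text \<open>On this strip \<open>Lam\<close> is an exponential. It contains the integers from 0 to
  \<open>N - 1\<close>, a full set of residues, which is what the limits at pinched crossings rely
  on.\<close>

lemma Lam_strip:
  assumes "N \<ge> 2" "- 1 < Re \<zeta>" "Re \<zeta> < real N"
  shows "isCont (Lam N) \<zeta>" "Lam N \<zeta> \<noteq> 0"
proof -
  let ?S = "{\<zeta>. - 1 < Re \<zeta> \<and> Re \<zeta> < real N}"
  have *: "Lam N \<xi> = dilog_strip N \<xi>" if "\<xi> \<in> ?S" for \<xi>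
    using that dilog_ext_strip[OF assms(1), of 0 \<xi>] by (simp add: Lam_eq_dilog_ext[OF assms(1)])
  have "?S = {\<zeta>. - 1 < Re \<zeta>} \<inter> {\<zeta>. Re \<zeta> < real N}" by auto
  hence op: "open ?S" using open_Int open_halfspace_Re_lt open_halfspace_Re_gt by metis
  have "continuous_on ?S (Lam N)"
    by (rule continuous_on_eq[OF holomorphic_on_imp_continuous_on[OF dilog_strip_holomorphic[OF assms(1)]]])
       (simp only: *)
  thus "isCont (Lam N) \<zeta>" using op assms by (auto simp: continuous_on_eq_continuous_at)
  show "Lam N \<zeta> \<noteq> 0" using *[of \<zeta>] assms by (simp add: dilog_strip_def)
qed

section \<open>Crossings under integer shifts of the log-parameters\<close>

lemma omega_simps:
  "omega N (x + y) = omega N x * omega N y" "omega N (x - y) = omega N x / omega N y"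
  "omega N x \<noteq> 0" "omega N 0 = 1" "omega N (- x) = inverse (omega N x)"
  by (simp_all add: omega_def distrib_left right_diff_distrib add_divide_distrib diff_divide_distrib exp_add exp_diff exp_minus)

lemma omega_of_nat_mult:
  assumes "N \<noteq> 0"
  shows "omega N (of_nat N * x) = ee x"
  using assms by (simp add: omega_def ee_def mult_ac)

lemma omega_cong:
  assumes "N \<noteq> 0" "m mod int N = n mod int N"
  shows "omega N (of_int m) = omega N (of_int n)"
proof -
  have "int N dvd m - n" using assms(2) by (simp add: mod_eq_dvd_iff)
  then obtain q where "m - n = int N * q" by (auto elim: dvdE)
  hence "m = n + int N * q" by simp
  hence "complex_of_int m = of_int n + of_nat N * of_int q" by simp
  thus ?thesis by (simp only: omega_simps(1) omega_of_nat_mult[OF assms(1)] ee_simps) simp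
qed

section \<open>Dependence of \<open>LamI\<close> on its index and on integer shifts\<close>

definition flat :: "complex \<times> complex \<Rightarrow> bool" where
  "flat z \<longleftrightarrow> ee (snd z) * (1 - ee (fst z)) = 1"

lemma flat_not_Ints: "flat z \<Longrightarrow> fst z \<notin> \<int>"
  by (auto simp: flat_def simp flip: ee_eq_1_iff)

lemma LamI_add_N:
  assumes N: "N \<ge> 2" and z: "flat z"
  shows "LamI N z (n + int N) = LamI N z n"
proof -
  have "fst z + of_int n \<notin> \<int>" using flat_not_Ints[OF z] by simp
  from Lam_shift[OF N this]
  have L: "Lam N (fst z + of_int n) = (1 - ee (fst z)) * Lam N (fst z + of_int n + of_nat N)"
    by (simp add: ee_simps)
  have "- (fst z * snd z / 2) - of_int (n + int N) * snd z
      = - (fst z * snd z / 2) - of_int n * snd z - of_nat N * snd z"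
    by (simp add: algebra_simps)
  hence "omega N (- (fst z * snd z / 2) - of_int (n + int N) * snd z)
      = omega N (- (fst z * snd z / 2) - of_int n * snd z) / ee (snd z)"
    using N by (simp only: omega_simps omega_of_nat_mult)
  moreover have "1 - ee (fst z) = 1 / ee (snd z)" using z ee_simps(4) by (simp add: flat_def field_simps)
  ultimately show ?thesis unfolding LamI_def L by (simp add: add.assoc)
qed

lemma LamI_cong:
  assumes N: "N \<ge> 2" and z: "flat z" and mn: "m mod int N = n mod int N"
  shows "LamI N z m = LamI N z n"
proof -
  have *: "LamI N z (n + int N * int q) = LamI N z n" for n q
  proof (induction q)
    case (Suc q)
    have "n + int N * int (Suc q) = n + int N * int q + int N" by (simp add: algebra_simps)
    thus ?case using LamI_add_N[OF N z, of "n + int N * int q"] Suc by (simp only: add.assoc)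
  qed auto
  have "int N dvd m - n" using mn by (simp add: mod_eq_dvd_iff)
  then obtain q where q: "m - n = int N * q" by (auto elim: dvdE)
  show ?thesis
  proof (cases "q \<ge> 0")
    case True
    thus ?thesis using *[of n "nat q"] q by (simp add: algebra_simps)
  next
    case False
    thus ?thesis using *[of m "nat (- q)"] q by (simp add: algebra_simps)
  qed
qed

text \<open>An integer added to the first parameter moves into the index; one added to the second
  leaves a phase linear in the index. The halves come from the term \<open>z0 * z1 / 2\<close>. The
  identity is purely algebraic and holds without flatness.\<close>

lemma LamI_shift:
  "LamI N (z0 + of_int h, z1 + of_int l) n
     = omega N (of_int h * z1 / 2 - of_int l * (z0 + of_int h) / 2 - of_int n * of_int l) * LamI N (z0, z1) (n + h)"
proof -
  have "- ((z0 + of_int h) * (z1 + of_int l) / 2) - of_int n * (z1 + of_int l)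
      = (of_int h * z1 / 2 - of_int l * (z0 + of_int h) / 2 - of_int n * of_int l)
        + (- (z0 * z1 / 2) - of_int (n + h) * z1)"
    by (simp add: field_simps)
  thus ?thesis by (simp add: LamI_def omega_simps(1) add_ac)
qed

text \<open>Negating \<beta> and \<mu> inverts every \<open>b\<close> and \<open>m\<close> and keeps
  every \<open>a\<close>, which turns the equations of a negative crossing into those of a positive
  one. Flatness, pinching and its approximation thus need proof for one sign only.\<close>

definition cneg :: "cdata \<Rightarrow> cdata" where
  "cneg c = (case c of ((\<beta>1, \<beta>2, \<beta>1', \<beta>2'), (gN, gW, gS, gE), (\<mu>1, \<mu>2)) \<Rightarrow>
     ((- \<beta>1, - \<beta>2, - \<beta>1', - \<beta>2'), (gN, gW, gS, gE), (- \<mu>1, - \<mu>2)))"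

lemma cneg_cneg [simp]: "cneg (cneg c) = c"
  by (simp add: cneg_def split: prod.splits)

lemma zetas_cneg: "zetas False c = zetas True (cneg c)"
proof -
  obtain \<beta>1 \<beta>2 \<beta>1' \<beta>2' gN gW gS gE \<mu>1 \<mu>2
    where c: "c = ((\<beta>1, \<beta>2, \<beta>1', \<beta>2'), (gN, gW, gS, gE), (\<mu>1, \<mu>2))" by (metis prod.exhaust)
  have "ee \<beta>1 / ee \<beta>2' = ee (- \<beta>2') / ee (- \<beta>1)" by (simp add: ee_simps field_simps)
  thus ?thesis by (simp add: c cneg_def zetas_def Let_def)
qed

lemma pinched_cneg: "pinched False c = pinched True (cneg c)"
  by (simp add: pinched_def zetas_cneg)

lemma logcross_cneg: "logcross False c = logcross True (cneg c)"
proof -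
  obtain \<beta>1 \<beta>2 \<beta>1' \<beta>2' gN gW gS gE \<mu>1 \<mu>2
    where c: "c = ((\<beta>1, \<beta>2, \<beta>1', \<beta>2'), (gN, gW, gS, gE), (\<mu>1, \<mu>2))" by (metis prod.exhaust)
  have 1: "1 - inverse m1 * inverse b1 / inverse b2 * (1 - a1 / inverse m1) * (1 - 1 / (inverse m2 * a2))
        = 1 - b2 / (m1 * b1) * (1 - m1 * a1) * (1 - m2 / a2)"
      "inverse m2 * inverse b2 / inverse m1 * inverse (1 - inverse m2 * a2 * (1 - inverse b2 / (inverse m1 * inverse b1)))
        = inverse (m2 * b2 / m1 * (1 - a2 / m2 * (1 - m1 * b1 / b2)))"
      "inverse b1 * (1 - inverse m1 / a1 * (1 - inverse b2 / (inverse m1 * inverse b1)))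
        = inverse (b1 * inverse (1 - 1 / (m1 * a1) * (1 - m1 * b1 / b2)))"
    for m1 m2 b1 b2 a1 a2 :: complex
    by (simp_all only: divide_inverse inverse_mult_distrib inverse_inverse_eq mult_1_left mult_ac)
  show ?thesis
    by (simp only: c cneg_def logcross_def Let_def prod.case ee_simps(3) 1 inverse_eq_iff_eq if_True if_False)
qed

text \<open>With \<open>x = b\<^sub>2/(m\<^sub>1b\<^sub>1)\<close>, \<open>p = m\<^sub>1/a\<^sub>1\<close> and \<open>q = m\<^sub>2a\<^sub>2\<close>, all exponentials of the \<open>\<zeta>\<close>'s are rational
  functions of \<open>x\<close>, \<open>p\<close>, \<open>q\<close>, and the crossing is pinched exactly when \<open>x = 1\<close>.\<close>

lemma crossing_parameters:
  assumes "logcross True c" "zetas True c = (zN, zW, zS, zE)"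
  obtains p q x A where "p \<noteq> 0" "q \<noteq> 0" "x \<noteq> 0" "A \<noteq> 0"
    "ee (fst zN) = 1 - p * (1 - x)" "ee (fst zW) = x" "ee (fst zS) = 1 - q * (1 - x)"
    "ee (fst zE) = (1 - p * (1 - x)) * (1 - q * (1 - x)) / x"
    "ee (snd zW) = ee (snd zN) * p" "ee (snd zS) = ee (snd zN) * p / q" "ee (snd zE) = ee (snd zN) / (q * A)"
    "1 - (1 - p * (1 - x)) * (1 - q * (1 - x)) / x = (1 - x) * p * q * A"
    "ee (fst zN) \<noteq> 1 \<Longrightarrow> ee (snd zN) = 1 / (1 - ee (fst zN))"
proof -
  obtain \<beta>1 \<beta>2 \<beta>1' \<beta>2' gN gW gS gE \<mu>1 \<mu>2
    where c: "c = ((\<beta>1, \<beta>2, \<beta>1', \<beta>2'), (gN, gW, gS, gE), (\<mu>1, \<mu>2))" by (metis prod.exhaust)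
  define x where "x = ee \<beta>2 / (ee \<mu>1 * ee \<beta>1)"
  define p where "p = ee \<mu>1 / ee (gW - gN)"
  define q where "q = ee \<mu>2 * ee (gS - gW)"
  define A where "A = 1 - ee \<mu>1 * ee \<beta>1 / ee \<beta>2 * (1 - ee (gW - gN) / ee \<mu>1) * (1 - 1 / (ee \<mu>2 * ee (gS - gW)))"
  define \<kappa> where "\<kappa> = gN - Ln (1 - ee \<beta>2' / ee \<beta>1) / (2 * of_real pi * \<i>)"
  have z: "zN = (\<beta>2' - \<beta>1, \<kappa> - gN)" "zW = (\<beta>2 - \<beta>1 - \<mu>1, \<kappa> - gW + \<mu>1)"
      "zS = (\<beta>2 - \<beta>1' + \<mu>2 - \<mu>1, \<kappa> - gS + (\<mu>1 - \<mu>2))" "zE = (\<beta>2' - \<beta>1' + \<mu>2, \<kappa> - gE - \<mu>2)"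
    using assms(2) by (auto simp: c zetas_def Let_def \<kappa>_def)
  have lc: "ee (gE - gN) = ee (gS - gW) * A"
     "ee \<beta>1' = ee \<mu>2 * ee \<beta>2 / ee \<mu>1 * inverse (1 - q * (1 - x))"
     "ee \<beta>2' = ee \<beta>1 * (1 - p * (1 - x))"
    using assms(1) unfolding c logcross_def by (auto simp: Let_def A_def x_def p_def q_def)
  \<comment> \<open>As \<open>inverse 0 = 0\<close>, a vanishing denominator would make
    \<open>ee \<beta>1'\<close> zero; likewise \<open>A = 0\<close> would make
    \<open>ee (gE - gN)\<close> zero.\<close>
  have nz: "1 - q * (1 - x) \<noteq> 0" "A \<noteq> 0" using lc ee_simps(4) by (metis inverse_zero mult_zero_right)+
  note e = ee_simps(4)
  have pqx: "p \<noteq> 0" "q \<noteq> 0" "x \<noteq> 0" by (simp_all add: p_def q_def x_def e)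
  have A: "A = 1 - (1 / x) * (1 - 1 / p) * (1 - 1 / q)"
    by (simp add: A_def x_def p_def q_def)
  show thesis
  proof (rule that[OF pqx nz(2)])
    show zN: "ee (fst zN) = 1 - p * (1 - x)" using lc(3) by (simp add: z ee_simps(2) e)
    show "ee (fst zW) = x" by (simp add: z ee_simps(2) x_def mult.commute)
    show zS: "ee (fst zS) = 1 - q * (1 - x)"
      unfolding z fst_conv ee_simps(1,2) lc(2) using nz e by (simp add: field_simps)
    show "ee (fst zE) = (1 - p * (1 - x)) * (1 - q * (1 - x)) / x"
      unfolding z fst_conv ee_simps(1,2) lc(2,3) using nz e by (simp add: x_def divide_inverse mult_ac)
    show "ee (snd zW) = ee (snd zN) * p"
      using e by (simp add: z ee_simps(1,2) p_def)
    show "ee (snd zS) = ee (snd zN) * p / q"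
      using e by (simp add: z ee_simps(1,2) p_def q_def field_simps)
    have "ee (snd zE) = ee (snd zN) / (ee (gE - gN) * ee \<mu>2)"
      using e by (simp add: z ee_simps(1,2) field_simps)
    thus "ee (snd zE) = ee (snd zN) / (q * A)" by (simp add: lc q_def mult_ac)
    show "1 - (1 - p * (1 - x)) * (1 - q * (1 - x)) / x = (1 - x) * p * q * A"
      unfolding A using pqx by (simp add: field_simps)
    assume "ee (fst zN) \<noteq> 1"
    hence "1 - ee (fst zN) \<noteq> 0" by simp
    moreover have "snd zN = - (Ln (1 - ee (fst zN)) / (2 * of_real pi * \<i>))"
      by (simp add: z \<kappa>_def ee_simps(2))
    moreover have "2 * of_real pi * \<i> * (w / (2 * of_real pi * \<i>)) = w" for w by simp
    ultimately show "ee (snd zN) = 1 / (1 - ee (fst zN))"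
      unfolding ee_def[of "snd zN"] by (simp add: exp_minus inverse_eq_divide)
  qed
qed

text \<open>The condition at the corner N gives \<open>x \<noteq> 1\<close> and fixes
  \<open>ee (snd zN)\<close>. All four flatness equations are then rational identities in
  \<open>x\<close>, \<open>p\<close> and \<open>q\<close>.\<close>

lemma zetas_flat_True:
  assumes "logcross True c" "zetas True c = (zN, zW, zS, zE)" "fst zN \<notin> \<int>"
  shows "flat zN \<and> flat zW \<and> flat zS \<and> flat zE"
proof -
  obtain p q x A where *: "p \<noteq> 0" "q \<noteq> 0" "x \<noteq> 0" "A \<noteq> 0"
    "ee (fst zN) = 1 - p * (1 - x)" "ee (fst zW) = x" "ee (fst zS) = 1 - q * (1 - x)"
    "ee (fst zE) = (1 - p * (1 - x)) * (1 - q * (1 - x)) / x"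
    "ee (snd zW) = ee (snd zN) * p" "ee (snd zS) = ee (snd zN) * p / q" "ee (snd zE) = ee (snd zN) / (q * A)"
    "1 - (1 - p * (1 - x)) * (1 - q * (1 - x)) / x = (1 - x) * p * q * A"
    "ee (fst zN) \<noteq> 1 \<Longrightarrow> ee (snd zN) = 1 / (1 - ee (fst zN))"
    using crossing_parameters[OF assms(1,2)] by metis
  have "ee (fst zN) \<noteq> 1" using assms(3) by (simp add: ee_eq_1_iff)
  hence "ee (snd zN) = 1 / (p * (1 - x))" "1 - x \<noteq> 0" using * by auto
  thus ?thesis using *(1-4) unfolding flat_def *(5-12) by simp
qed

text \<open>If the corner N were not integral, all four corners would be flat and none of them
  integral. So a pinched crossing has \<open>p * (1 - x) = 0\<close>, hence \<open>x = 1\<close>,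
  and every corner becomes integral at once.\<close>

lemma pinched_imp_Ints_True:
  assumes "logcross True c" "zetas True c = (zN, zW, zS, zE)" "pinched True c"
  shows "fst zN \<in> \<int> \<and> fst zW \<in> \<int> \<and> fst zS \<in> \<int> \<and> fst zE \<in> \<int>"
proof -
  obtain p q x A where *: "p \<noteq> 0" "q \<noteq> 0" "x \<noteq> 0" "A \<noteq> 0"
    "ee (fst zN) = 1 - p * (1 - x)" "ee (fst zW) = x" "ee (fst zS) = 1 - q * (1 - x)"
    "ee (fst zE) = (1 - p * (1 - x)) * (1 - q * (1 - x)) / x"
    "ee (snd zW) = ee (snd zN) * p" "ee (snd zS) = ee (snd zN) * p / q" "ee (snd zE) = ee (snd zN) / (q * A)"
    "1 - (1 - p * (1 - x)) * (1 - q * (1 - x)) / x = (1 - x) * p * q * A"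
    "ee (fst zN) \<noteq> 1 \<Longrightarrow> ee (snd zN) = 1 / (1 - ee (fst zN))"
    using crossing_parameters[OF assms(1,2)] by metis
  have "fst zN \<in> \<int>"
    using assms(3) zetas_flat_True[OF assms(1,2)] flat_not_Ints[of zW] flat_not_Ints[of zS] flat_not_Ints[of zE]
    unfolding pinched_def assms(2) prod.case by blast
  hence "x = 1" using *(1,5) by (simp flip: ee_eq_1_iff)
  thus ?thesis using *(5-8) by (simp flip: ee_eq_1_iff)
qed

lemma zetas_flat:
  assumes "logcross pos c" "zetas pos c = (zN, zW, zS, zE)" "\<not> pinched pos c"
  shows "flat zN \<and> flat zW \<and> flat zS \<and> flat zE"
  using zetas_flat_True[of c] zetas_flat_True[of "cneg c"] assms
  by (cases pos) (auto simp: logcross_cneg pinched_def zetas_cneg)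

lemma pinched_imp_Ints:
  assumes "logcross pos c" "zetas pos c = (zN, zW, zS, zE)" "pinched pos c"
  shows "fst zN \<in> \<int> \<and> fst zW \<in> \<int> \<and> fst zS \<in> \<int> \<and> fst zE \<in> \<int>"
  using pinched_imp_Ints_True[of c] pinched_imp_Ints_True[of "cneg c"] assms
  by (cases pos) (auto simp: logcross_cneg pinched_cneg zetas_cneg)

section \<open>Integer shifts of the data of one crossing and the phase they cause\<close>

fun cshift :: "int \<times> int \<times> int \<times> int \<Rightarrow> int \<times> int \<times> int \<times> int \<Rightarrow> cdata \<Rightarrow> cdata" where
  "cshift (k1, k2, k1', k2') (hN, hW, hS, hE) ((\<beta>1, \<beta>2, \<beta>1', \<beta>2'), (gN, gW, gS, gE), (\<mu>1, \<mu>2)) =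
    ((\<beta>1 + of_int k1, \<beta>2 + of_int k2, \<beta>1' + of_int k1', \<beta>2' + of_int k2'),
     (gN + of_int hN, gW + of_int hW, gS + of_int hS, gE + of_int hE), (\<mu>1, \<mu>2))"

text \<open>The first summand is minus the contribution of this crossing to the change of the
  longitudes paired with the meridians; only it sees the sign. The other summands are arranged as
  outgoing minus incoming segment terms, the last one following the region to the right of each
  strand, so that they telescope along the braid.\<close>

fun gauge :: "bool \<Rightarrow> int \<times> int \<times> int \<times> int \<Rightarrow> int \<times> int \<times> int \<times> int \<Rightarrow> cdata \<Rightarrow> int \<Rightarrow> int \<Rightarrow> int \<Rightarrow> int \<Rightarrow> complex" where
  "gauge pos (k1, k2, k1', k2') (hN, hW, hS, hE) ((\<beta>1, \<beta>2, \<beta>1', \<beta>2'), (gN, gW, gS, gE), (\<mu>1, \<mu>2)) n1 n2 n1' n2' =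
     - ((if pos then 1 else -1) / 2) * (\<mu>1 * of_int (k1' - k1) + \<mu>2 * of_int (k2 - k2'))
     + (- of_int k1 * (gW - gN) - of_int k2 * (gS - gW) + of_int k1' * (gS - gE) + of_int k2' * (gE - gN)) / 2
     + of_int (n1 * (hW - hN) + n2 * (hS - hW) - n1' * (hS - hE) - n2' * (hE - hN))
     + ((\<beta>1 + of_int k1) * of_int (hW - hN) + (\<beta>2 + of_int k2) * of_int (hS - hW)
        - (\<beta>1' + of_int k1') * of_int (hS - hE) - (\<beta>2' + of_int k2') * of_int (hE - hN)) / 2
     - (\<mu>1 * of_int (hS - hW) + \<mu>2 * of_int (hE - hS)) / 2"

lemma ee_add_int [simp]: "ee (x + of_int k) = ee x"
  by (simp add: ee_simps)

lemma ee_diff_add_int: "ee (x + of_int k - (y + of_int l)) = ee (x - y)"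
  by (simp add: ee_simps)

lemma logcross_cshift: "logcross pos (cshift k h c) = logcross pos c"
  by (cases "(k, h, c)" rule: cshift.cases) (simp add: logcross_def ee_diff_add_int)

text \<open>The logarithm inside \<kappa> depends on exponentials only, so \<kappa> just moves with
  \<open>gN\<close> and the second parameter at N stays put. The summand \<open>of_int 0\<close>
  gives that corner the shape required by \<open>LamI_shift\<close>.\<close>

lemma zetas_cshift:
  assumes "zetas pos ((\<beta>1, \<beta>2, \<beta>1', \<beta>2'), (gN, gW, gS, gE), (\<mu>1, \<mu>2)) = ((zN0, zN1), (zW0, zW1), (zS0, zS1), (zE0, zE1))"
    and "s = (if pos then 1 else -1)"
  shows "zetas pos (cshift (k1, k2, k1', k2') (hN, hW, hS, hE) ((\<beta>1, \<beta>2, \<beta>1', \<beta>2'), (gN, gW, gS, gE), (\<mu>1, \<mu>2)))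
     = ((zN0 + of_int (s * (k2' - k1)), zN1 + of_int 0), (zW0 + of_int (s * (k2 - k1)), zW1 + of_int (hN - hW)),
        (zS0 + of_int (s * (k2 - k1')), zS1 + of_int (hN - hS)), (zE0 + of_int (s * (k2' - k1')), zE1 + of_int (hN - hE)))"
proof -
  define l where "l = Ln (1 - (if pos then ee \<beta>2' / ee \<beta>1 else ee \<beta>1 / ee \<beta>2')) / (2 * of_real pi * \<i>)"
  note s = assms(2)
  have *: "zetas pos ((\<beta>1, \<beta>2, \<beta>1', \<beta>2'), (gN, gW, gS, gE), (\<mu>1, \<mu>2)) =
     ((of_int s * (\<beta>2' - \<beta>1), gN - l - gN), (of_int s * (\<beta>2 - \<beta>1 - \<mu>1), gN - l - gW + of_int s * \<mu>1),
      (of_int s * (\<beta>2 - \<beta>1' + \<mu>2 - \<mu>1), gN - l - gS + of_int s * (\<mu>1 - \<mu>2)),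
      (of_int s * (\<beta>2' - \<beta>1' + \<mu>2), gN - l - gE - of_int s * \<mu>2))"
    by (simp add: zetas_def Let_def l_def s)
  have "zetas pos (cshift (k1, k2, k1', k2') (hN, hW, hS, hE) ((\<beta>1, \<beta>2, \<beta>1', \<beta>2'), (gN, gW, gS, gE), (\<mu>1, \<mu>2))) =
     ((of_int s * (\<beta>2' + of_int k2' - (\<beta>1 + of_int k1)), gN + of_int hN - l - (gN + of_int hN)),
      (of_int s * (\<beta>2 + of_int k2 - (\<beta>1 + of_int k1) - \<mu>1), gN + of_int hN - l - (gW + of_int hW) + of_int s * \<mu>1),
      (of_int s * (\<beta>2 + of_int k2 - (\<beta>1' + of_int k1') + \<mu>2 - \<mu>1), gN + of_int hN - l - (gS + of_int hS) + of_int s * (\<mu>1 - \<mu>2)),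
      (of_int s * (\<beta>2' + of_int k2' - (\<beta>1' + of_int k1') + \<mu>2), gN + of_int hN - l - (gE + of_int hE) - of_int s * \<mu>2))"
    by (simp add: zetas_def Let_def l_def s)
  thus ?thesis using assms(1) unfolding * by (auto simp: algebra_simps)
qed

lemma pinched_cshift: "pinched pos (cshift k h c) = pinched pos c"
proof -
  obtain k1 k2 k1' k2' hN hW hS hE where kh: "k = (k1, k2, k1', k2')" "h = (hN, hW, hS, hE)" by (metis prod.exhaust)
  obtain \<beta>1 \<beta>2 \<beta>1' \<beta>2' gN gW gS gE \<mu>1 \<mu>2
    where c: "c = ((\<beta>1, \<beta>2, \<beta>1', \<beta>2'), (gN, gW, gS, gE), (\<mu>1, \<mu>2))" by (metis prod.exhaust)
  obtain zN0 zN1 zW0 zW1 zS0 zS1 zE0 zE1 where z: "zetas pos c = ((zN0, zN1), (zW0, zW1), (zS0, zS1), (zE0, zE1))"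
    by (metis prod.exhaust)
  have I: "x + complex_of_int j \<in> \<int> \<longleftrightarrow> x \<in> \<int>" for x j by simp
  show ?thesis
    unfolding pinched_def kh unfolding c zetas_cshift[OF z[unfolded c] refl] unfolding z[unfolded c] prod.case fst_conv I ..
qed

lemma regroup_scalars:
  fixes a b d e f g :: complex
  shows "(P * a) / n * (Q * b) * ((d * X) * (e * Y)) / ((f * Z) * (g * W))
     = (a * b * d * e / (f * g)) * (P / n * Q * (X * Y) / (Z * W))"
  by (simp add: mult_ac)

lemma omega_prefactor:
  assumes "N \<noteq> 0"
  shows "omega N (- (of_nat N - 1) * of_int j) = omega N (of_int j)"
        "omega N ((of_nat N - 1) * of_int j) = omega N (- of_int j)"
proof -
  have 1: "- (of_nat N - 1) * of_int j = of_nat N * of_int (- j) + complex_of_int j"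
          "(of_nat N - 1) * of_int j = of_nat N * of_int j + - complex_of_int j" by (simp_all add: algebra_simps)
  show "omega N (- (of_nat N - 1) * of_int j) = omega N (of_int j)"
       "omega N ((of_nat N - 1) * of_int j) = omega N (- of_int j)"
    unfolding 1 omega_simps(1) omega_of_nat_mult[OF assms] ee_simps by simp_all
qed

text \<open>The new indices are fixed only modulo \<open>N\<close>, so that they may later be basis
  labels reduced to \<open>0..N-1\<close>; periodicity of \<open>LamI\<close> at flat corners
  permits this.\<close>

lemma Rformula_gauge:
  assumes N: "N \<ge> 2" and lc: "logcross pos c" "\<not> pinched pos c"
    and k: "k = (k1, k2, k1', k2')"
    and m: "m1 mod int N = (n1 + k1) mod int N" "m2 mod int N = (n2 + k2) mod int N"
           "m1' mod int N = (n1' + k1') mod int N" "m2' mod int N = (n2' + k2') mod int N"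
  shows "Rformula N pos (cshift k h c) n1 n2 n1' n2'
       = omega N (gauge pos k h c n1 n2 n1' n2') * Rformula N pos c m1 m2 m1' m2'"
proof -
  obtain hN hW hS hE where h: "h = (hN, hW, hS, hE)" by (metis prod.exhaust)
  obtain \<beta>1 \<beta>2 \<beta>1' \<beta>2' gN gW gS gE \<mu>1 \<mu>2
    where c: "c = ((\<beta>1, \<beta>2, \<beta>1', \<beta>2'), (gN, gW, gS, gE), (\<mu>1, \<mu>2))" by (metis prod.exhaust)
  obtain zN0 zN1 zW0 zW1 zS0 zS1 zE0 zE1 where z: "zetas pos c = ((zN0, zN1), (zW0, zW1), (zS0, zS1), (zE0, zE1))"
    by (metis prod.exhaust)
  have flat: "flat (zN0, zN1)" "flat (zW0, zW1)" "flat (zS0, zS1)" "flat (zE0, zE1)"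
    using zetas_flat[OF lc(1) z lc(2)] by auto
  have N0: "N \<noteq> 0" using N by simp
  define x where "x = (\<lambda>(z0::complex) (z1::complex) (hh::int) (l::int) (n::int). of_int hh * z1 / 2 - of_int l * (z0 + of_int hh) / 2 - of_int n * of_int l)"
  have L: "LamI N (z0 + of_int hh, z1 + of_int l) n = omega N (x z0 z1 hh l n) * LamI N (z0, z1) m"
    if "flat (z0, z1)" "m mod int N = (n + hh) mod int N" for z0 z1 hh l n m
    unfolding LamI_shift x_def using LamI_cong[OF N that] by simp
  show ?thesis
  proof (cases pos)
    case True
    have ze: "zN0 = \<beta>2' - \<beta>1" "zW0 = \<beta>2 - \<beta>1 - \<mu>1" "zS0 = \<beta>2 - \<beta>1' + \<mu>2 - \<mu>1" "zE0 = \<beta>2' - \<beta>1' + \<mu>2"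
       "zW1 = zN1 + gN - gW + \<mu>1" "zS1 = zN1 + gN - gS + \<mu>1 - \<mu>2" "zE1 = zN1 + gN - gE - \<mu>2"
      using z True by (auto simp: c zetas_def Let_def)
    define s :: int where "s = (if pos then 1 else -1)"
    have s: "s = 1" using True by (simp add: s_def)
    have idx: "(m2' - m1) mod int N = (n2' - n1 + s * (k2' - k1)) mod int N"
        "(m2 - m1') mod int N = (n2 - n1' + s * (k2 - k1')) mod int N"
        "(m2 - m1 - 1) mod int N = (n2 - n1 - 1 + s * (k2 - k1)) mod int N"
        "(m2' - m1') mod int N = (n2' - n1' + s * (k2' - k1')) mod int N"
        "(n2 - n1) mod int N = (m2 - m1 - (k2 - k1)) mod int N"
      using mod_diff_cong[OF m(4) m(1)] mod_diff_cong[OF m(2) m(3)] mod_diff_cong[OF mod_diff_cong[OF m(2) m(1)] refl, of 1]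
        mod_diff_cong[OF m(4) m(3)] mod_diff_cong[OF mod_diff_cong[OF m(2) m(1)] refl, of "k2 - k1"]
      by (simp_all add: s algebra_simps)
    have pre: "omega N (- (of_nat N - 1) * (zW0 + of_int (s * (k2 - k1)) + (zW1 + of_int (hN - hW))))
       = omega N (- (of_nat N - 1) * (zW0 + zW1)) * omega N (of_int (k2 - k1 + (hN - hW)))"
      unfolding omega_prefactor(1)[OF N0, symmetric] omega_simps(1)[symmetric] s
      by (rule arg_cong[of _ _ "omega N"]) (simp add: algebra_simps)
    have pre2: "omega N (of_int (n2 - n1)) = omega N (of_int (m2 - m1)) * omega N (of_int (- (k2 - k1)))"
      unfolding omega_cong[OF N0 idx(5)] omega_simps(1)[symmetric] by (rule arg_cong[of _ _ "omega N"]) simp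
    have "Rformula N pos (cshift k h c) n1 n2 n1' n2'
       = (omega N (of_int (k2 - k1 + (hN - hW))) * omega N (of_int (- (k2 - k1)))
          * omega N (x zN0 zN1 (s * (k2' - k1)) 0 (n2' - n1)) * omega N (x zS0 zS1 (s * (k2 - k1')) (hN - hS) (n2 - n1'))
          / (omega N (x zW0 zW1 (s * (k2 - k1)) (hN - hW) (n2 - n1 - 1)) * omega N (x zE0 zE1 (s * (k2' - k1')) (hN - hE) (n2' - n1'))))
         * Rformula N pos c m1 m2 m1' m2'"
      unfolding Rformula_def z unfolding k h c zetas_cshift[OF z[unfolded c] s_def] prod.case if_P[OF True] fst_conv snd_conv
        L[OF flat(1) idx(1)] L[OF flat(3) idx(2)] L[OF flat(2) idx(3)] L[OF flat(4) idx(4)] pre pre2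
      by (rule regroup_scalars)
    \<comment> \<open>Of the prefactor's contribution, \<open>k2 - k1\<close> cancels against the
      change of the power of \<omega> in \<open>n2 - n1\<close>, and \<open>hN - hW\<close> against
      the offset -1 in the index at W.\<close>
    moreover have "of_int (k2 - k1 + (hN - hW)) + of_int (- (k2 - k1)) + x zN0 zN1 (s * (k2' - k1)) 0 (n2' - n1)
        + x zS0 zS1 (s * (k2 - k1')) (hN - hS) (n2 - n1')
        - (x zW0 zW1 (s * (k2 - k1)) (hN - hW) (n2 - n1 - 1) + x zE0 zE1 (s * (k2' - k1')) (hN - hE) (n2' - n1'))
        = gauge pos k h c n1 n2 n1' n2'"
      unfolding k h c gauge.simps x_def ze s using True by (simp add: field_simps)
    ultimately show ?thesis by (simp only: omega_simps(1,2)[symmetric])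
  next
    case False
    have ze: "zN0 = \<beta>1 - \<beta>2'" "zW0 = \<beta>1 + \<mu>1 - \<beta>2" "zS0 = \<beta>1' + \<mu>1 - \<beta>2 - \<mu>2" "zE0 = \<beta>1' - \<beta>2' - \<mu>2"
       "zW1 = zN1 + gN - gW - \<mu>1" "zS1 = zN1 + gN - gS + \<mu>2 - \<mu>1" "zE1 = zN1 + gN - gE + \<mu>2"
      using z False by (auto simp: c zetas_def Let_def)
    define s :: int where "s = (if pos then 1 else -1)"
    have s: "s = -1" using False by (simp add: s_def)
    have idx: "(m1 - m2) mod int N = (n1 - n2 + s * (k2 - k1)) mod int N"
        "(m1' - m2' - 1) mod int N = (n1' - n2' - 1 + s * (k2' - k1')) mod int N"
        "(m1 - m2' - 1) mod int N = (n1 - n2' - 1 + s * (k2' - k1)) mod int N"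
        "(m1' - m2 - 1) mod int N = (n1' - n2 - 1 + s * (k2 - k1')) mod int N"
        "(n1 - n2) mod int N = (m1 - m2 - (k1 - k2)) mod int N"
      using mod_diff_cong[OF m(1) m(2)] mod_diff_cong[OF mod_diff_cong[OF m(3) m(4)] refl, of 1]
        mod_diff_cong[OF mod_diff_cong[OF m(1) m(4)] refl, of 1] mod_diff_cong[OF mod_diff_cong[OF m(3) m(2)] refl, of 1]
        mod_diff_cong[OF mod_diff_cong[OF m(1) m(2)] refl, of "k1 - k2"]
      by (simp_all add: s algebra_simps)
    have pre: "omega N ((of_nat N - 1) * (zE0 + of_int (s * (k2' - k1')) + (zE1 + of_int (hN - hE))
           - (zS0 + of_int (s * (k2 - k1'))) - (zS1 + of_int (hN - hS)) - (zN0 + of_int (s * (k2' - k1))) - (zN1 + of_int 0)))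
       = omega N ((of_nat N - 1) * (zE0 + zE1 - zS0 - zS1 - zN0 - zN1)) * omega N (- of_int (k2 - k1 + (hS - hE)))"
      unfolding omega_prefactor(2)[OF N0, symmetric] omega_simps(1)[symmetric] s
      by (rule arg_cong[of _ _ "omega N"]) (simp add: algebra_simps)
    have pre2: "omega N (of_int (n1 - n2)) = omega N (of_int (m1 - m2)) * omega N (of_int (- (k1 - k2)))"
      unfolding omega_cong[OF N0 idx(5)] omega_simps(1)[symmetric] by (rule arg_cong[of _ _ "omega N"]) simp
    have "Rformula N pos (cshift k h c) n1 n2 n1' n2'
       = (omega N (- of_int (k2 - k1 + (hS - hE))) * omega N (of_int (- (k1 - k2)))
          * omega N (x zW0 zW1 (s * (k2 - k1)) (hN - hW) (n1 - n2)) * omega N (x zE0 zE1 (s * (k2' - k1')) (hN - hE) (n1' - n2' - 1))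
          / (omega N (x zN0 zN1 (s * (k2' - k1)) 0 (n1 - n2' - 1)) * omega N (x zS0 zS1 (s * (k2 - k1')) (hN - hS) (n1' - n2 - 1))))
         * Rformula N pos c m1 m2 m1' m2'"
      unfolding Rformula_def z unfolding k h c zetas_cshift[OF z[unfolded c] s_def] prod.case if_not_P[OF False] fst_conv snd_conv
        L[OF flat(2) idx(1)] L[OF flat(4) idx(2)] L[OF flat(1) idx(3)] L[OF flat(3) idx(4)] pre pre2
      by (rule regroup_scalars)
    \<comment> \<open>Here \<open>hS - hE\<close> cancels against the offsets -1 in the indices at E
      and S. The offset at N is harmless since the second parameter there does not shift.\<close>
    moreover have "- of_int (k2 - k1 + (hS - hE)) + of_int (- (k1 - k2)) + x zW0 zW1 (s * (k2 - k1)) (hN - hW) (n1 - n2)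
        + x zE0 zE1 (s * (k2' - k1')) (hN - hE) (n1' - n2' - 1)
        - (x zN0 zN1 (s * (k2' - k1)) 0 (n1 - n2' - 1) + x zS0 zS1 (s * (k2 - k1')) (hN - hS) (n1' - n2 - 1))
        = gauge pos k h c n1 n2 n1' n2'"
      unfolding k h c gauge.simps x_def ze s using False by (simp add: field_simps)
    ultimately show ?thesis by (simp only: omega_simps(1,2)[symmetric])
  qed
qed

section \<open>Pinched crossings\<close>

lemma LamI_affine:
  "LamI N (z0, \<kappa> + c) n = omega N (- (z0 / 2 + of_int n) * (\<kappa> + c)) * Lam N (z0 + of_int n)"
proof -
  have "- (z0 * (\<kappa> + c) / 2) - of_int n * (\<kappa> + c) = - (z0 / 2 + of_int n) * (\<kappa> + c)"
    by (simp add: field_simps)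
  thus ?thesis unfolding LamI_def fst_conv snd_conv by (simp only:)
qed

text \<open>All four arguments contain the divergent \<open>\<kappa>\<close>. After reducing each index modulo \<open>N\<close> into the
  region where \<open>\<Lambda>\<close> has neither zeros nor poles, the total coefficient of \<open>\<kappa>\<close> is a nonnegative
  multiple of \<open>N\<close>, so only a power of the convergent \<open>e\<^sup>-\<^sup>2\<^sup>\<pi>\<^sup>i\<^sup>\<kappa>\<close> remains.\<close>

lemma pinched_limit_exists:
  fixes zA zB zC zD cA cB cC cD \<kappa> P g :: "'a \<Rightarrow> complex"
  assumes N: "N \<ge> 2"
    and lim: "(zA \<longlongrightarrow> of_int kA) F" "(zB \<longlongrightarrow> of_int kB) F" "(zC \<longlongrightarrow> of_int kC) F" "(zD \<longlongrightarrow> of_int kD) F"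
      "(cA \<longlongrightarrow> cA0) F" "(cB \<longlongrightarrow> cB0) F" "(cC \<longlongrightarrow> cC0) F" "(cD \<longlongrightarrow> cD0) F" "(P \<longlongrightarrow> P0) F" "(g \<longlongrightarrow> g0) F"
    and ev: "eventually (\<lambda>x. ee (- \<kappa> x) = g x \<and> zA x + zB x = zC x + zD x \<and> flat (zA x, \<kappa> x + cA x) \<and> flat (zB x, \<kappa> x + cB x)
       \<and> flat (zC x, \<kappa> x + cC x) \<and> flat (zD x, \<kappa> x + cD x)) F"
    and n: "nA + nB - nC - nD = 1" and k: "kA + kB = kC + kD"
  shows "\<exists>L. ((\<lambda>x. omega N (P x - (of_nat N - 1) * \<kappa> x) * w
     * (LamI N (zA x, \<kappa> x + cA x) nA * LamI N (zB x, \<kappa> x + cB x) nB)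
     / (LamI N (zC x, \<kappa> x + cC x) nC * LamI N (zD x, \<kappa> x + cD x) nD)) \<longlongrightarrow> L) F"
proof -
  \<comment> \<open>Index \<open>n\<close> is replaced by the congruent \<open>r n k\<close>, chosen
    so that \<open>k + r n k\<close> is the residue \<open>v n k\<close>. The arguments of
    \<open>Lam\<close> then tend to integers in \<open>0..N-1\<close>, where
    \<open>Lam_strip\<close> applies.\<close>
  define v where "v = (\<lambda>n k. (n + k) mod int N)"
  define r where "r = (\<lambda>n k. v n k - k)"
  have rcong: "n mod int N = r n k mod int N" for n k
    unfolding r_def v_def by (simp add: mod_diff_left_eq)
  have v: "0 \<le> v n k" "v n k < int N" for n k using N by (auto simp: v_def)
  define e where "e = v nA kA + v nB kB - v nC kC - v nD kD"
  \<comment> \<open>Modulo \<open>N\<close> the residues combine to 1 by the hypotheses on indices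
    and limits. This 1 complements the \<open>N - 1\<close> of the prefactor.\<close>
  have "(int N - 1 + e) mod int N = 0"
  proof -
    have "(n + k - v n k) mod int N = 0" for n k by (simp add: v_def minus_mod_eq_mult_div)
    hence d: "int N dvd n + k - v n k" for n k by (simp add: dvd_eq_mod_eq_0)
    hence "int N dvd (nA + kA - v nA kA) + (nB + kB - v nB kB) - (nC + kC - v nC kC) - (nD + kD - v nD kD)"
      using d[of nA kA] d[of nB kB] d[of nC kC] d[of nD kD] by (meson dvd_add dvd_diff)
    also have "(nA + kA - v nA kA) + (nB + kB - v nB kB) - (nC + kC - v nC kC) - (nD + kD - v nD kD) = 1 - e"
      using n k by (simp add: e_def)
    finally have "int N dvd int N - (1 - e)" by (rule dvd_diff[OF dvd_refl])
    thus ?thesis by (simp add: algebra_simps)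
  qed
  then obtain q where q: "int N - 1 + e = int N * q" by (auto simp: mod_eq_0_iff_dvd elim: dvdE)
  \<comment> \<open>Only the two residues with a minus sign can make \<open>e\<close> negative, each
    by at most \<open>N - 1\<close>. So \<open>N - 1 + e\<close> exceeds \<open>- N\<close>, and a
    multiple of \<open>N\<close> above \<open>- N\<close> is nonnegative.\<close>
  have "e > - (2 * int N - 1)" using v[of nA kA] v[of nB kB] v[of nC kC] v[of nD kD] by (simp add: e_def)
  hence "int N * q > int N * (- 1)" using q by simp
  hence "q \<ge> 0" using mult_left_mono[of q "-1" "int N"] by linarith
  then obtain m where m: "q = int m" by (metis nonneg_int_cases)
  have esum: "complex_of_nat N - 1 + (of_int (r nA kA) + of_int (r nB kB) - of_int (r nC kC) - of_int (r nD kD)) = of_nat N * of_nat m"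
  proof -
    have "r nA kA + r nB kB - r nC kC - r nD kD = e" using k by (simp add: r_def e_def)
    hence "int N - 1 + (r nA kA + r nB kB - r nC kC - r nD kD) = int N * int m" using q m by simp
    from arg_cong[OF this, of complex_of_int] show ?thesis by simp
  qed
  define tA where "tA = (\<lambda>x. zA x / 2 + of_int (r nA kA))"
  define tB where "tB = (\<lambda>x. zB x / 2 + of_int (r nB kB))"
  define tC where "tC = (\<lambda>x. zC x / 2 + of_int (r nC kC))"
  define tD where "tD = (\<lambda>x. zD x / 2 + of_int (r nD kD))"
  \<comment> \<open>The quotient with \<kappa> eliminated: its total contribution is a power of
    \<open>ee (- \<kappa>)\<close>, here replaced by the convergent \<open>g\<close>.\<close>
  define G where "G = (\<lambda>x. g x ^ m * omega N (P x - tA x * cA x - tB x * cB x + tC x * cC x + tD x * cD x) * w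
     * (Lam N (zA x + of_int (r nA kA)) * Lam N (zB x + of_int (r nB kB)))
     / (Lam N (zC x + of_int (r nC kC)) * Lam N (zD x + of_int (r nD kD))))"
  have Lc: "isCont (Lam N) (of_int k + of_int (r n k))" and Lnz: "Lam N (of_int k + of_int (r n k)) \<noteq> 0" for n k
  proof -
    have "complex_of_int k + of_int (r n k) = of_int (v n k)" by (simp add: r_def)
    moreover have "real_of_int (v n k) < real N" using v(2)[of n k] by linarith
    moreover have "- 1 < real_of_int (v n k)" using v(1)[of n k] by linarith
    ultimately show "isCont (Lam N) (of_int k + of_int (r n k))" "Lam N (of_int k + of_int (r n k)) \<noteq> 0"
      using Lam_strip[OF N, of "of_int (v n k)"] by auto
  qed
  have "\<exists>L. (G \<longlongrightarrow> L) F"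
  proof (rule exI)
    show "(G \<longlongrightarrow> g0 ^ m * omega N (P0 - (of_int kA / 2 + of_int (r nA kA)) * cA0 - (of_int kB / 2 + of_int (r nB kB)) * cB0
          + (of_int kC / 2 + of_int (r nC kC)) * cC0 + (of_int kD / 2 + of_int (r nD kD)) * cD0) * w
     * (Lam N (of_int kA + of_int (r nA kA)) * Lam N (of_int kB + of_int (r nB kB)))
     / (Lam N (of_int kC + of_int (r nC kC)) * Lam N (of_int kD + of_int (r nD kD)))) F"
      unfolding G_def tA_def tB_def tC_def tD_def omega_def
      by (intro tendsto_intros lim isCont_tendsto_compose[OF Lc]) (use Lnz N in auto)
  qed
  then obtain L where L: "(G \<longlongrightarrow> L) F" by blast
  have "eventually (\<lambda>x. G x = omega N (P x - (of_nat N - 1) * \<kappa> x) * w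
     * (LamI N (zA x, \<kappa> x + cA x) nA * LamI N (zB x, \<kappa> x + cB x) nB)
     / (LamI N (zC x, \<kappa> x + cC x) nC * LamI N (zD x, \<kappa> x + cD x) nD)) F"
    using ev
  proof eventually_elim
    case (elim x)
    have LI: "LamI N (z, \<kappa> x + c) n = omega N (- (z / 2 + of_int (r n k)) * (\<kappa> x + c)) * Lam N (z + of_int (r n k))"
      if "flat (z, \<kappa> x + c)" for z c n k
      using LamI_cong[OF N that rcong[of n k]] LamI_affine by simp
    have t: "tA x + tB x - tC x - tD x = of_int (r nA kA) + of_int (r nB kB) - of_int (r nC kC) - of_int (r nD kD)"
    proof -
      have "tA x + tB x - tC x - tD x = (zA x + zB x - (zC x + zD x)) / 2
          + (of_int (r nA kA) + of_int (r nB kB) - of_int (r nC kC) - of_int (r nD kD))"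
        unfolding tA_def tB_def tC_def tD_def by (simp add: field_simps)
      thus ?thesis using elim by simp
    qed
    have "P x - (of_nat N - 1) * \<kappa> x + - tA x * (\<kappa> x + cA x) + - tB x * (\<kappa> x + cB x)
         - (- tC x * (\<kappa> x + cC x) + - tD x * (\<kappa> x + cD x))
       = - (of_nat N - 1 + (tA x + tB x - tC x - tD x)) * \<kappa> x
         + (P x - tA x * cA x - tB x * cB x + tC x * cC x + tD x * cD x)"
      by (simp add: algebra_simps)
    also have "- (of_nat N - 1 + (tA x + tB x - tC x - tD x)) * \<kappa> x = of_nat N * (of_nat m * - \<kappa> x)"
      unfolding t esum by simp
    finally have "omega N (P x - (of_nat N - 1) * \<kappa> x) * omega N (- tA x * (\<kappa> x + cA x)) * omega N (- tB x * (\<kappa> x + cB x))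
         / (omega N (- tC x * (\<kappa> x + cC x)) * omega N (- tD x * (\<kappa> x + cD x)))
       = omega N (of_nat N * (of_nat m * - \<kappa> x)) * omega N (P x - tA x * cA x - tB x * cB x + tC x * cC x + tD x * cD x)"
      by (simp only: omega_simps(1,2)[symmetric])
    also have "omega N (of_nat N * (of_nat m * - \<kappa> x)) = ee (of_nat m * - \<kappa> x)"
      by (rule omega_of_nat_mult) (use N in simp)
    also have "\<dots> = ee (- \<kappa> x) ^ m"
      unfolding ee_def exp_of_nat_mult[symmetric] by (simp add: mult_ac)
    also have "ee (- \<kappa> x) = g x" using elim by simp
    finally have om: "g x ^ m * omega N (P x - tA x * cA x - tB x * cB x + tC x * cC x + tD x * cD x)
      = omega N (P x - (of_nat N - 1) * \<kappa> x) * omega N (- tA x * (\<kappa> x + cA x)) * omega N (- tB x * (\<kappa> x + cB x))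
         / (omega N (- tC x * (\<kappa> x + cC x)) * omega N (- tD x * (\<kappa> x + cD x)))" ..
    have fl: "flat (zA x, \<kappa> x + cA x)" "flat (zB x, \<kappa> x + cB x)" "flat (zC x, \<kappa> x + cC x)" "flat (zD x, \<kappa> x + cD x)"
      using elim by auto
    have *: "(Q * d * e / (f * h)) * w * (X * Y) / (Z * W) = Q * w * ((d * X) * (e * Y)) / ((f * Z) * (h * W))"
      for Q d e f h X Y Z W :: complex by (simp add: mult_ac)
    show ?case
      unfolding G_def om unfolding LI[OF fl(1), of nA kA] LI[OF fl(2), of nB kB] LI[OF fl(3), of nC kC] LI[OF fl(4), of nD kD]
        tA_def tB_def tC_def tD_def by (rule *)
  qed
  from Lim_transform_eventually[OF L this] show ?thesis by blast
qed

text \<open>\<open>Lim\<close> carries information only when the limit exists and the filter is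
  nontrivial. This provides the first half; \<open>pinched_approx\<close> provides the
  second.\<close>

lemma Rformula_limit_exists:
  assumes N: "N \<ge> 2" and lc: "logcross pos c" "pinched pos c"
  shows "\<exists>L. ((\<lambda>x. Rformula N pos x n1 n2 n1' n2') \<longlongrightarrow> L) (at c within {x. logcross pos x \<and> \<not> pinched pos x})"
    (is "\<exists>L. (_ \<longlongrightarrow> L) ?F")
proof -
  define b1 b2 b1' b2' where "b1 = (\<lambda>x::cdata. fst (fst x))" and "b2 = (\<lambda>x::cdata. fst (snd (fst x)))"
    and "b1' = (\<lambda>x::cdata. fst (snd (snd (fst x))))" and "b2' = (\<lambda>x::cdata. snd (snd (snd (fst x))))"
  define gN gW gS gE where "gN = (\<lambda>x::cdata. fst (fst (snd x)))" and "gW = (\<lambda>x::cdata. fst (snd (fst (snd x))))"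
    and "gS = (\<lambda>x::cdata. fst (snd (snd (fst (snd x)))))" and "gE = (\<lambda>x::cdata. snd (snd (snd (fst (snd x)))))"
  define m1 m2 where "m1 = (\<lambda>x::cdata. fst (snd (snd x)))" and "m2 = (\<lambda>x::cdata. snd (snd (snd x)))"
  note proj = b1_def b2_def b1'_def b2'_def gN_def gW_def gS_def gE_def m1_def m2_def
  define s where "s = (if pos then 1 else -1 :: complex)"
  define zN zW zS zE where "zN = (\<lambda>x. s * (b2' x - b1 x))" and "zW = (\<lambda>x. s * (b2 x - b1 x - m1 x))"
    and "zS = (\<lambda>x. s * (b2 x - b1' x + m2 x - m1 x))" and "zE = (\<lambda>x. s * (b2' x - b1' x + m2 x))"
  define \<kappa> where "\<kappa> = (\<lambda>x. gN x - Ln (1 - ee (zN x)) / (2 * of_real pi * \<i>))"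
  define cN cW cS cE where "cN = (\<lambda>x. - gN x)" and "cW = (\<lambda>x. - gW x + s * m1 x)"
    and "cS = (\<lambda>x. - gS x + s * (m1 x - m2 x))" and "cE = (\<lambda>x. - gE x - s * m2 x)"
  have z: "zetas pos x = ((zN x, \<kappa> x + cN x), (zW x, \<kappa> x + cW x), (zS x, \<kappa> x + cS x), (zE x, \<kappa> x + cE x))" for x
  proof -
    obtain \<beta>1 \<beta>2 \<beta>1' \<beta>2' hN hW hS hE \<mu>1 \<mu>2
      where x: "x = ((\<beta>1, \<beta>2, \<beta>1', \<beta>2'), (hN, hW, hS, hE), (\<mu>1, \<mu>2))" by (metis prod.exhaust)
    have "(if pos then ee \<beta>2' / ee \<beta>1 else ee \<beta>1 / ee \<beta>2') = ee (zN x)"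
      by (simp add: zN_def s_def proj x ee_simps)
    thus ?thesis
      by (simp add: x zetas_def Let_def \<kappa>_def s_def[symmetric]) (simp add: x zN_def zW_def zS_def zE_def cN_def cW_def cS_def cE_def proj)
  qed
  \<comment> \<open>This relation removes the halves \<open>z / 2\<close> from the total coefficient
    of \<kappa>, which leaves an integer.\<close>
  have sum: "zN x + zS x = zW x + zE x" for x
    by (simp add: zN_def zW_def zS_def zE_def algebra_simps)
  have "zN c \<in> \<int>" "zW c \<in> \<int>" "zS c \<in> \<int>" "zE c \<in> \<int>"
    using pinched_imp_Ints[OF lc(1) z lc(2)] by auto
  then obtain kN kW kS kE where kz: "zN c = of_int kN" "zW c = of_int kW" "zS c = of_int kS" "zE c = of_int kE"
    by (metis Ints_cases)
  have "complex_of_int (kN + kS) = of_int (kW + kE)" using sum[of c] by (simp add: kz)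
  hence k: "kN + kS = kW + kE" using of_int_eq_iff by blast
  have id: "((\<lambda>x. x) \<longlongrightarrow> c) ?F" by (rule tendsto_ident_at)
  have tz: "(zN \<longlongrightarrow> of_int kN) ?F" "(zW \<longlongrightarrow> of_int kW) ?F" "(zS \<longlongrightarrow> of_int kS) ?F" "(zE \<longlongrightarrow> of_int kE) ?F"
    unfolding kz[symmetric] zN_def zW_def zS_def zE_def proj by (intro tendsto_intros id)+
  have tc: "(cN \<longlongrightarrow> cN c) ?F" "(cW \<longlongrightarrow> cW c) ?F" "(cS \<longlongrightarrow> cS c) ?F" "(cE \<longlongrightarrow> cE c) ?F"
    unfolding cN_def cW_def cS_def cE_def proj by (intro tendsto_intros id)+
  \<comment> \<open>\<kappa> diverges at the pinch, but \<open>ee (- \<kappa>)\<close> equals this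
    continuous expression, which tends to 0 there.\<close>
  define g where "g = (\<lambda>x. ee (- gN x) * (1 - ee (zN x)))"
  have tg: "(g \<longlongrightarrow> g c) ?F"
    unfolding g_def ee_def zN_def proj by (intro tendsto_intros id)
  have ev: "eventually (\<lambda>x. ee (- \<kappa> x) = g x \<and> flat (zN x, \<kappa> x + cN x) \<and> flat (zW x, \<kappa> x + cW x)
       \<and> flat (zS x, \<kappa> x + cS x) \<and> flat (zE x, \<kappa> x + cE x)) ?F"
    unfolding eventually_at_filter
  proof (intro always_eventually allI impI)
    fix x assume "x \<in> {x. logcross pos x \<and> \<not> pinched pos x}"
    hence fl: "flat (zN x, \<kappa> x + cN x) \<and> flat (zW x, \<kappa> x + cW x) \<and> flat (zS x, \<kappa> x + cS x) \<and> flat (zE x, \<kappa> x + cE x)"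
      using zetas_flat[OF _ z] by blast
    hence "ee (\<kappa> x) / ee (gN x) * (1 - ee (zN x)) = 1" by (simp add: flat_def cN_def ee_simps)
    hence "ee (- \<kappa> x) = g x" using ee_simps(4) by (simp add: g_def ee_simps(3) field_simps)
    thus "ee (- \<kappa> x) = g x \<and> flat (zN x, \<kappa> x + cN x) \<and> flat (zW x, \<kappa> x + cW x)
       \<and> flat (zS x, \<kappa> x + cS x) \<and> flat (zE x, \<kappa> x + cE x)" using fl by blast
  qed
  show ?thesis
  proof (cases pos)
    case True
    define P where "P = (\<lambda>x. - (of_nat N - 1) * (zW x + cW x))"
    have tP: "(P \<longlongrightarrow> - (of_nat N - 1) * (of_int kW + cW c)) ?F"
      unfolding P_def by (intro tendsto_intros tz tc)
    define w where "w = omega N (of_int (n2 - n1)) / of_nat N"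
    have "Rformula N pos x n1 n2 n1' n2' = omega N (P x - (of_nat N - 1) * \<kappa> x) * w
     * (LamI N (zN x, \<kappa> x + cN x) (n2' - n1) * LamI N (zS x, \<kappa> x + cS x) (n2 - n1'))
     / (LamI N (zW x, \<kappa> x + cW x) (n2 - n1 - 1) * LamI N (zE x, \<kappa> x + cE x) (n2' - n1'))" for x
    proof -
      have "- (of_nat N - 1) * (zW x + (\<kappa> x + cW x)) = P x - (of_nat N - 1) * \<kappa> x"
        by (simp add: P_def algebra_simps)
      thus ?thesis unfolding Rformula_def z prod.case if_P[OF True] fst_conv snd_conv w_def
        by (simp add: mult_ac)
    qed
    moreover have "\<forall>\<^sub>F x in ?F. ee (- \<kappa> x) = g x \<and> zN x + zS x = zW x + zE x \<and> flat (zN x, \<kappa> x + cN x)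
       \<and> flat (zS x, \<kappa> x + cS x) \<and> flat (zW x, \<kappa> x + cW x) \<and> flat (zE x, \<kappa> x + cE x)"
      using ev by eventually_elim (use sum in blast)
    ultimately show ?thesis
      using pinched_limit_exists[OF N tz(1) tz(3) tz(2) tz(4) tc(1) tc(3) tc(2) tc(4) tP tg,
          of \<kappa> "n2' - n1" "n2 - n1'" "n2 - n1 - 1" "n2' - n1'" w] k by simp
  next
    case False
    define P where "P = (\<lambda>x. (of_nat N - 1) * (zE x + cE x - (zS x + cS x) - (zN x + cN x)))"
    have tP: "(P \<longlongrightarrow> (of_nat N - 1) * (of_int kE + cE c - (of_int kS + cS c) - (of_int kN + cN c))) ?F"
      unfolding P_def by (intro tendsto_intros tz tc)
    define w where "w = omega N (of_int (n1 - n2)) / of_nat N"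
    have "Rformula N pos x n1 n2 n1' n2' = omega N (P x - (of_nat N - 1) * \<kappa> x) * w
     * (LamI N (zW x, \<kappa> x + cW x) (n1 - n2) * LamI N (zE x, \<kappa> x + cE x) (n1' - n2' - 1))
     / (LamI N (zN x, \<kappa> x + cN x) (n1 - n2' - 1) * LamI N (zS x, \<kappa> x + cS x) (n1' - n2 - 1))" for x
    proof -
      have "(of_nat N - 1) * (zE x + (\<kappa> x + cE x) - zS x - (\<kappa> x + cS x) - zN x - (\<kappa> x + cN x)) = P x - (of_nat N - 1) * \<kappa> x"
        by (simp add: P_def algebra_simps)
      thus ?thesis unfolding Rformula_def z prod.case if_not_P[OF False] fst_conv snd_conv w_def
        by (simp add: mult_ac)
    qed
    moreover have "\<forall>\<^sub>F x in ?F. ee (- \<kappa> x) = g x \<and> zW x + zE x = zN x + zS x \<and> flat (zW x, \<kappa> x + cW x)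
       \<and> flat (zE x, \<kappa> x + cE x) \<and> flat (zN x, \<kappa> x + cN x) \<and> flat (zS x, \<kappa> x + cS x)"
      using ev by eventually_elim (use sum in metis)
    ultimately show ?thesis
      using pinched_limit_exists[OF N tz(2) tz(4) tz(1) tz(3) tc(2) tc(4) tc(1) tc(3) tP tg,
          of \<kappa> "n1 - n2" "n1' - n2' - 1" "n1 - n2' - 1" "n1' - n2 - 1" w] k by simp
  qed
qed

text \<open>Moving \<open>\<beta>\<^sub>2\<close> alone and solving for the outgoing data leads out of the pinched locus.\<close>

lemma pinched_approx_True:
  assumes lc: "logcross True c" "pinched True c"
  shows "\<exists>f. ((f :: real \<Rightarrow> cdata) \<longlongrightarrow> c) (at_right 0) \<and> eventually (\<lambda>t. logcross True (f t) \<and> \<not> pinched True (f t)) (at_right 0)"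
proof -
  obtain \<beta>1 \<beta>2 \<beta>1' \<beta>2' gN gW gS gE \<mu>1 \<mu>2
    where c: "c = ((\<beta>1, \<beta>2, \<beta>1', \<beta>2'), (gN, gW, gS, gE), (\<mu>1, \<mu>2))" by (metis prod.exhaust)
  define l where "l = 2 * complex_of_real pi * \<i>"
  define p q where "p = ee \<mu>1 / ee (gW - gN)" and "q = ee \<mu>2 * ee (gS - gW)"
  define A where "A = (\<lambda>x. 1 - 1 / x * (1 - 1 / p) * (1 - 1 / q))"
  note e = ee_simps(4)
  have pq: "p \<noteq> 0" "q \<noteq> 0" by (auto simp: p_def q_def e)
  have "\<beta>2 - \<beta>1 - \<mu>1 \<in> \<int>"
    using pinched_imp_Ints[OF lc(1) _ lc(2)] by (fastforce simp: c zetas_def Let_def)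
  hence "ee (\<beta>2 - \<beta>1 - \<mu>1) = 1" by (simp add: ee_eq_1_iff)
  hence x1: "ee \<beta>2 = ee \<mu>1 * ee \<beta>1" using e by (simp add: ee_simps(1,2) field_simps)
  have lc': "ee (gE - gN) = ee (gS - gW) * A 1" "ee (gS - gE) = ee (gW - gN) / A 1"
     "ee \<beta>1' = ee \<mu>2 * ee \<beta>2 / ee \<mu>1" "ee \<beta>2' = ee \<beta>1"
    using lc(1) e unfolding c logcross_def by (auto simp: Let_def A_def x1 p_def q_def)
  have A1: "A 1 \<noteq> 0" using lc'(1) e by (metis mult_zero_right)
  have eeLn: "ee (Ln w / l) = w" if "w \<noteq> 0" for w
    using that by (simp add: ee_def l_def)
  define y where "y = (\<lambda>t::real. 1 - ee (of_real t))"
  \<comment> \<open>Each outgoing parameter is corrected by the logarithm of the ratio of its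
    required exponential to its old one. These ratios tend to 1, where \<open>Ln\<close> is
    continuous with value 0, so the corrections tend to 0.\<close>
  define f where "f = (\<lambda>t::real. ((\<beta>1, \<beta>2 + of_real t, \<beta>1' + of_real t - Ln (1 - q * y t) / l, \<beta>2' + Ln (1 - p * y t) / l),
      (gN, gW, gS, gE + Ln (A (ee (of_real t)) / A 1) / l), (\<mu>1, \<mu>2)))"
  have id: "((\<lambda>t. complex_of_real t) \<longlongrightarrow> 0) (at_right 0)"
    using tendsto_of_real[OF tendsto_ident_at[of 0 "{0<..}"]] by simp
  have te: "((\<lambda>t. ee (complex_of_real t)) \<longlongrightarrow> 1) (at_right 0)"
  proof -
    have "((\<lambda>t. ee (complex_of_real t)) \<longlongrightarrow> exp (2 * of_real pi * \<i> * 0)) (at_right 0)"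
      unfolding ee_def by (intro tendsto_intros id)
    thus ?thesis by simp
  qed
  have ty: "(y \<longlongrightarrow> 1 - 1) (at_right 0)" unfolding y_def by (intro tendsto_intros te)
  have ty': "((\<lambda>t. 1 - u * y t) \<longlongrightarrow> 1) (at_right 0)" for u
    by (rule tendsto_eq_rhs[OF tendsto_diff[OF tendsto_const tendsto_mult[OF tendsto_const ty]]]) simp
  have tA: "((\<lambda>t. A (ee (of_real t)) / A 1) \<longlongrightarrow> 1) (at_right 0)"
  proof -
    have "((\<lambda>t. A (ee (of_real t)) / A 1) \<longlongrightarrow> A 1 / A 1) (at_right 0)"
      unfolding A_def by (intro tendsto_intros te) (use A1 in \<open>auto simp: A_def\<close>)
    thus ?thesis using A1 by simp
  qed
  have tL: "((\<lambda>t. Ln (h t) / l) \<longlongrightarrow> 0) (at_right 0)" if "(h \<longlongrightarrow> 1) (at_right 0)" for h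
  proof -
    have "((\<lambda>t. Ln (h t) / l) \<longlongrightarrow> Ln 1 / l) (at_right 0)"
      by (intro tendsto_intros that tendsto_Ln) (auto simp: l_def)
    thus ?thesis by simp
  qed
  have "(f \<longlongrightarrow> ((\<beta>1, \<beta>2 + 0, \<beta>1' + 0 - 0, \<beta>2' + 0), (gN, gW, gS, gE + 0), (\<mu>1, \<mu>2))) (at_right 0)"
    unfolding f_def by (intro tendsto_intros id tL ty' tA)
  hence "(f \<longlongrightarrow> c) (at_right 0)" by (simp add: c)
  moreover have "eventually (\<lambda>t. logcross True (f t) \<and> \<not> pinched True (f t)) (at_right 0)"
  proof -
    have ev: "eventually (\<lambda>t. 1 - q * y t \<noteq> 0) (at_right 0)" "eventually (\<lambda>t. 1 - p * y t \<noteq> 0) (at_right 0)"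
      "eventually (\<lambda>t. A (ee (of_real t)) / A 1 \<noteq> 0) (at_right 0)"
      by (rule tendsto_imp_eventually_ne[OF ty'], simp, rule tendsto_imp_eventually_ne[OF ty'], simp,
          rule tendsto_imp_eventually_ne[OF tA], simp)
    have ev1: "eventually (\<lambda>t::real. t < 1) (at_right 0)"
      by (rule order_tendstoD(2)[OF tendsto_ident_at]) simp
    show ?thesis
      using ev ev1 eventually_at_right_less[of "0::real"]
    proof eventually_elim
      case (elim t)
      define E where "E = ee (of_real t)"
      have E: "E \<noteq> 0" "y t = 1 - E" by (simp_all add: E_def e y_def)
      have AE: "A E \<noteq> 0" using elim by (simp add: E_def)
      have v: "ee (\<beta>2 + of_real t) = ee \<mu>1 * ee \<beta>1 * E"
        "ee (\<beta>1' + of_real t - Ln (1 - q * y t) / l) = ee \<mu>2 * ee \<beta>1 * E / (1 - q * (1 - E))"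
        "ee (\<beta>2' + Ln (1 - p * y t) / l) = ee \<beta>1 * (1 - p * (1 - E))"
        "ee (gE + Ln (A (ee (of_real t)) / A 1) / l - gN) = ee (gS - gW) * A E"
        "ee (gS - (gE + Ln (A (ee (of_real t)) / A 1) / l)) = ee (gW - gN) / A E"
      proof -
        show "ee (\<beta>2 + of_real t) = ee \<mu>1 * ee \<beta>1 * E" by (simp add: ee_simps(1) x1 E_def)
        show "ee (\<beta>1' + of_real t - Ln (1 - q * y t) / l) = ee \<mu>2 * ee \<beta>1 * E / (1 - q * (1 - E))"
          unfolding ee_simps(1,2) eeLn[OF elim(1)] lc'(3) x1 using e by (simp add: E E_def[symmetric])
        show "ee (\<beta>2' + Ln (1 - p * y t) / l) = ee \<beta>1 * (1 - p * (1 - E))"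
          unfolding ee_simps(1,2) eeLn[OF elim(2)] lc'(4) by (simp add: E)
        have "ee (gE + Ln (A (ee (of_real t)) / A 1) / l - gN) = ee (gE - gN) * (A E / A 1)"
          unfolding ee_simps(1,2) eeLn[OF elim(3)] by (simp add: E_def)
        thus "ee (gE + Ln (A (ee (of_real t)) / A 1) / l - gN) = ee (gS - gW) * A E"
          using A1 by (simp add: lc'(1))
        have "ee (gS - (gE + Ln (A (ee (of_real t)) / A 1) / l)) = ee (gS - gE) / (A E / A 1)"
          unfolding ee_simps(1,2) eeLn[OF elim(3)] by (simp add: E_def)
        thus "ee (gS - (gE + Ln (A (ee (of_real t)) / A 1) / l)) = ee (gW - gN) / A E"
          using A1 by (simp add: lc'(2))
      qed
      have r: "ee \<mu>1 * ee \<beta>1 / (ee \<mu>1 * ee \<beta>1 * E) = 1 / E" "ee \<mu>1 * ee \<beta>1 * E / (ee \<mu>1 * ee \<beta>1) = E"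
        "ee (gW - gN) / ee \<mu>1 = 1 / p" "1 / (ee \<mu>2 * ee (gS - gW)) = 1 / q"
        "ee \<mu>1 / ee (gW - gN) = p" "ee \<mu>2 * ee (gS - gW) = q"
        "ee \<mu>2 * (ee \<mu>1 * ee \<beta>1 * E) / ee \<mu>1 = ee \<mu>2 * ee \<beta>1 * E"
        using e by (simp_all add: p_def q_def)
      have lcf: "logcross True (f t)"
        unfolding f_def logcross_def Let_def prod.case if_True v r by (simp add: A_def divide_inverse)
      \<comment> \<open>A pinch would force \<open>ee t = 1\<close>, impossible for
        \<open>0 < t < 1\<close>.\<close>
      moreover have "\<not> pinched True (f t)"
      proof
        assume "pinched True (f t)"
        hence "\<beta>2 + of_real t - \<beta>1 - \<mu>1 \<in> \<int>"
          using pinched_imp_Ints[OF lcf] by (fastforce simp: f_def zetas_def Let_def)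
        hence "ee (\<beta>2 + of_real t - \<beta>1 - \<mu>1) = 1" by (simp add: ee_eq_1_iff)
        hence "E = 1" unfolding ee_simps(2) v(1) using e by (simp add: field_simps)
        hence "complex_of_real t \<in> \<int>" by (simp add: E_def ee_eq_1_iff)
        then obtain j where "complex_of_real t = of_int j" by (auto elim: Ints_cases)
        hence "t = of_int j" by (metis of_real_eq_iff of_real_of_int_eq)
        thus False using elim by simp
      qed
      ultimately show ?case by blast
    qed
  qed
  ultimately show ?thesis by blast
qed

lemma tendsto_cneg:
  assumes "(f \<longlongrightarrow> c) F"
  shows "((\<lambda>t. cneg (f t)) \<longlongrightarrow> cneg c) F"
proof -
  have *: "cneg x = ((- fst (fst x), - fst (snd (fst x)), - fst (snd (snd (fst x))), - snd (snd (snd (fst x)))),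
     fst (snd x), (- fst (snd (snd x)), - snd (snd (snd x))))" for x
    by (simp add: cneg_def split: prod.splits)
  show ?thesis unfolding * by (intro tendsto_intros assms)
qed

text \<open>The limit that defines \<open>Rmat\<close> at a pinch is unique because of this; along
  the trivial filter every value would be a limit.\<close>

lemma pinched_approx:
  assumes lc: "logcross pos c" "pinched pos c"
  shows "at c within {x. logcross pos x \<and> \<not> pinched pos x} \<noteq> bot"
proof -
  have "\<exists>f. ((f :: real \<Rightarrow> cdata) \<longlongrightarrow> c) (at_right 0) \<and> eventually (\<lambda>t. logcross pos (f t) \<and> \<not> pinched pos (f t)) (at_right 0)"
  proof (cases pos)
    case True
    thus ?thesis using pinched_approx_True lc by simp
  next
    case False
    hence "logcross True (cneg c)" "pinched True (cneg c)" using lc by (simp_all add: logcross_cneg pinched_cneg)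
    from pinched_approx_True[OF this] obtain f where f: "((f :: real \<Rightarrow> cdata) \<longlongrightarrow> cneg c) (at_right 0)"
      "eventually (\<lambda>t. logcross True (f t) \<and> \<not> pinched True (f t)) (at_right 0)" by blast
    have "((\<lambda>t. cneg (f t)) \<longlongrightarrow> c) (at_right 0)" using tendsto_cneg[OF f(1)] by simp
    moreover have "eventually (\<lambda>t. logcross pos (cneg (f t)) \<and> \<not> pinched pos (cneg (f t))) (at_right 0)"
      using f(2) False by (simp add: logcross_cneg pinched_cneg)
    ultimately show ?thesis by blast
  qed
  then obtain f where f: "((f :: real \<Rightarrow> cdata) \<longlongrightarrow> c) (at_right 0)"
      "eventually (\<lambda>t. logcross pos (f t) \<and> \<not> pinched pos (f t)) (at_right 0)" by blast
  have "eventually (\<lambda>t. f t \<in> {x. logcross pos x \<and> \<not> pinched pos x} \<and> f t \<noteq> c) (at_right 0)"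
    using f(2) by eventually_elim (use lc in auto)
  hence fl: "filterlim f (at c within {x. logcross pos x \<and> \<not> pinched pos x}) (at_right 0)"
    using f(1) unfolding filterlim_at by blast
  show ?thesis
  proof
    assume "at c within {x. logcross pos x \<and> \<not> pinched pos x} = bot"
    with fl have "filterlim f bot (at_right 0)" by simp
    hence "eventually (\<lambda>x. P (f x)) (at_right 0)" for P by (simp add: filterlim_iff)
    from this[of "\<lambda>_. False"] have "eventually (\<lambda>x. False) (at_right (0::real))" by simp
    thus False by simp
  qed
qed

text \<open>\<open>cshift\<close> is translation by a constant vector \<open>d\<close> and preserves
  both the crossing equations and pinching. It therefore carries the filter at \<open>c\<close> into
  the one at the shifted crossing, and the identity passes to the limit by continuity of
  \<open>gauge\<close>.\<close>

lemma Rmat_gauge: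
  assumes N: "N \<ge> 2" and lc: "logcross pos c"
    and k: "k = (k1, k2, k1', k2')"
    and m: "m1 mod int N = (n1 + k1) mod int N" "m2 mod int N = (n2 + k2) mod int N"
           "m1' mod int N = (n1' + k1') mod int N" "m2' mod int N = (n2' + k2') mod int N"
  shows "Rmat N pos (cshift k h c) n1 n2 n1' n2'
       = omega N (gauge pos k h c n1 n2 n1' n2') * Rmat N pos c m1 m2 m1' m2'"
proof (cases "pinched pos c")
  case False
  thus ?thesis using Rformula_gauge[OF N lc False k m, of h] by (simp add: Rmat_def pinched_cshift)
next
  case True
  let ?S = "{x. logcross pos x \<and> \<not> pinched pos x}"
  obtain hN hW hS hE where h: "h = (hN, hW, hS, hE)" by (metis prod.exhaust)
  have lc': "logcross pos (cshift k h c)" "pinched pos (cshift k h c)"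
    using lc True by (simp_all add: logcross_cshift pinched_cshift)
  obtain L where L: "((\<lambda>x. Rformula N pos x m1 m2 m1' m2') \<longlongrightarrow> L) (at c within ?S)"
    using Rformula_limit_exists[OF N lc True] by blast
  obtain L' where L': "((\<lambda>x. Rformula N pos x n1 n2 n1' n2') \<longlongrightarrow> L') (at (cshift k h c) within ?S)"
    using Rformula_limit_exists[OF N lc'] by blast
  have nb: "at c within ?S \<noteq> bot" "at (cshift k h c) within ?S \<noteq> bot"
    using pinched_approx[OF lc True] pinched_approx[OF lc'] by auto
  define d :: cdata where "d = cshift k h ((0,0,0,0),(0,0,0,0),(0,0))"
  have shift: "cshift k h x = x + d" for x
  proof -
    obtain \<beta>1 \<beta>2 \<beta>1' \<beta>2' gN gW gS gE \<mu>1 \<mu>2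
      where x: "x = ((\<beta>1, \<beta>2, \<beta>1', \<beta>2'), (gN, gW, gS, gE), (\<mu>1, \<mu>2))" by (metis prod.exhaust)
    show ?thesis by (simp add: d_def x k h)
  qed
  have "filterlim (cshift k h) (at (cshift k h c) within ?S) (at c within ?S)"
    unfolding filterlim_at
  proof
    show "\<forall>\<^sub>F x in at c within ?S. cshift k h x \<in> ?S \<and> cshift k h x \<noteq> cshift k h c"
      unfolding eventually_at_filter
      by (intro always_eventually allI impI) (simp add: logcross_cshift pinched_cshift, simp add: shift)
    show "(cshift k h \<longlongrightarrow> cshift k h c) (at c within ?S)"
      unfolding shift by (intro tendsto_intros)
  qed
  from filterlim_compose[OF L' this]
  have 1: "((\<lambda>x. Rformula N pos (cshift k h x) n1 n2 n1' n2') \<longlongrightarrow> L') (at c within ?S)" .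
  have "((\<lambda>x. gauge pos k h x n1 n2 n1' n2') \<longlongrightarrow> gauge pos k h c n1 n2 n1' n2') (at c within ?S)"
  proof -
    have *: "gauge pos k h x n1 n2 n1' n2' = gauge pos k h ((fst (fst x), fst (snd (fst x)), fst (snd (snd (fst x))), snd (snd (snd (fst x)))),
       (fst (fst (snd x)), fst (snd (fst (snd x))), fst (snd (snd (fst (snd x)))), snd (snd (snd (fst (snd x))))),
       (fst (snd (snd x)), snd (snd (snd x)))) n1 n2 n1' n2'" for x
      by simp
    show ?thesis
      unfolding *[of c] by (subst *) (unfold k h gauge.simps, intro tendsto_intros, simp_all)
  qed
  hence "((\<lambda>x. omega N (gauge pos k h x n1 n2 n1' n2') * Rformula N pos x m1 m2 m1' m2')
     \<longlongrightarrow> omega N (gauge pos k h c n1 n2 n1' n2') * L) (at c within ?S)"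
    unfolding omega_def by (intro tendsto_intros L) (use N in auto)
  moreover have "eventually (\<lambda>x. omega N (gauge pos k h x n1 n2 n1' n2') * Rformula N pos x m1 m2 m1' m2'
      = Rformula N pos (cshift k h x) n1 n2 n1' n2') (at c within ?S)"
    unfolding eventually_at_filter
    by (intro always_eventually allI impI) (use Rformula_gauge[OF N _ _ k m] in simp)
  ultimately have "((\<lambda>x. Rformula N pos (cshift k h x) n1 n2 n1' n2')
     \<longlongrightarrow> omega N (gauge pos k h c n1 n2 n1' n2') * L) (at c within ?S)"
    by (rule Lim_transform_eventually)
  hence "L' = omega N (gauge pos k h c n1 n2 n1' n2') * L"
    by (rule tendsto_unique[OF nb(1) 1])
  moreover have "Rmat N pos (cshift k h c) n1 n2 n1' n2' = L'" "Rmat N pos c m1 m2 m1' m2' = L"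
    using tendsto_Lim[OF nb(2) L'] tendsto_Lim[OF nb(1) L] lc'(2) True by (simp_all add: Rmat_def)
  ultimately show ?thesis by simp
qed

section \<open>Composition along the braid\<close>

lemma strand_less:
  assumes "is_braid n w" "t \<le> length w" "p < n"
  shows "strand w t p < n"
  using assms(2,3)
proof (induction t arbitrary: p)
  case (Suc t)
  hence "Suc (fst (w ! t)) < n" using assms(1) by (simp add: is_braid_def)
  thus ?case using Suc by (auto simp: Let_def)
qed auto

section \<open>Cyclic shifts of basis labels\<close>

definition shift_state :: "nat \<Rightarrow> (nat \<Rightarrow> int) \<Rightarrow> nat list \<Rightarrow> nat list" where
  "shift_state N k xs = map (\<lambda>p. nat ((int (xs ! p) + k p) mod int N)) [0..<length xs]"

lemma length_shift_state [simp]: "length (shift_state N k xs) = length xs"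
  by (simp add: shift_state_def)

lemma shift_state_nth:
  assumes "N > 0" "p < length xs"
  shows "int (shift_state N k xs ! p) = (int (xs ! p) + k p) mod int N"
  using assms by (simp add: shift_state_def)

lemma shift_state_in_states:
  assumes "N > 0" "xs \<in> states N n"
  shows "shift_state N k xs \<in> states N n"
  using assms by (auto simp: states_def shift_state_def nat_less_iff)

lemma shift_state_id:
  assumes "xs \<in> states N n" "\<And>p. p < n \<Longrightarrow> k p = 0"
  shows "shift_state N k xs = xs"
proof (rule nth_equalityI)
  fix p assume "p < length (shift_state N k xs)"
  hence p: "p < length xs" by simp
  hence "xs ! p < N" "k p = 0" using assms by (auto simp: states_def)
  thus "shift_state N k xs ! p = xs ! p" using p by (simp add: shift_state_def)
qed simp

lemma shift_state_inverse:
  assumes "N > 0" "xs \<in> states N n"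
  shows "shift_state N (\<lambda>p. - k p) (shift_state N k xs) = xs"
proof (rule nth_equalityI)
  fix p assume "p < length (shift_state N (\<lambda>p. - k p) (shift_state N k xs))"
  hence p: "p < length xs" by simp
  have "int (shift_state N (\<lambda>p. - k p) (shift_state N k xs) ! p) = ((int (xs ! p) + k p) mod int N - k p) mod int N"
    using p assms(1) by (simp add: shift_state_nth)
  also have "\<dots> = int (xs ! p)" using p assms by (simp add: mod_diff_left_eq states_def)
  finally show "shift_state N (\<lambda>p. - k p) (shift_state N k xs) ! p = xs ! p" by simp
qed simp

lemma bij_betw_shift_state:
  assumes "N > 0"
  shows "bij_betw (shift_state N k) (states N n) (states N n)"
proof (rule bij_betw_byWitness[where f' = "shift_state N (\<lambda>p. - k p)"])
  show "\<forall>xs\<in>states N n. shift_state N (\<lambda>p. - k p) (shift_state N k xs) = xs"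
    using shift_state_inverse[OF assms] by blast
  show "\<forall>xs\<in>states N n. shift_state N k (shift_state N (\<lambda>p. - k p) xs) = xs"
    using shift_state_inverse[OF assms, of _ n "\<lambda>p. - k p"] by simp
qed (use shift_state_in_states[OF assms] in blast)+

text \<open>The integer differences are data, since the phases involve the integers themselves and
  not just their existence.\<close>

locale shifted_log_colorings =
  fixes N n :: nat and w :: "(nat \<times> bool) list" and f f' :: logcol
    and K G :: "nat \<Rightarrow> nat \<Rightarrow> int"
  assumes N: "N \<ge> 2" and braid: "is_braid n w"
    and col: "is_log_coloring n w f" "is_log_coloring n w f'"
    and K: "\<And>t p. t \<le> length w \<Longrightarrow> p < n \<Longrightarrow> lbeta f' t p = lbeta f t p + of_int (K t p)"
    and G: "\<And>t r. t \<le> length w \<Longrightarrow> r \<le> n \<Longrightarrow> lgamma f' t r = lgamma f t r + of_int (G t r)"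
    and mu: "\<And>j. j < n \<Longrightarrow> lmu f' j = lmu f j"
begin

lemma K_unchanged:
  assumes "t < length w" "p < n" "p \<noteq> fst (w ! t)" "p \<noteq> Suc (fst (w ! t))"
  shows "lbeta f (Suc t) p = lbeta f t p" "K (Suc t) p = K t p"
proof -
  have "lbeta f (Suc t) p = lbeta f t p" "lbeta f' (Suc t) p = lbeta f' t p"
    using col assms unfolding is_log_coloring_def Let_def by blast+
  thus "lbeta f (Suc t) p = lbeta f t p" "K (Suc t) p = K t p"
    using K[of t p] K[of "Suc t" p] assms by auto
qed

lemma G_unchanged:
  assumes "t < length w" "r \<le> n" "r \<noteq> Suc (fst (w ! t))"
  shows "lgamma f (Suc t) r = lgamma f t r" "G (Suc t) r = G t r"
proof -
  have "lgamma f (Suc t) r = lgamma f t r" "lgamma f' (Suc t) r = lgamma f' t r"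
    using col assms unfolding is_log_coloring_def Let_def by blast+
  thus "lgamma f (Suc t) r = lgamma f t r" "G (Suc t) r = G t r"
    using G[of t r] G[of "Suc t" r] assms by auto
qed

text \<open>The logarithm of the diagonal change of basis at one segment. In the \<mu> term only the
  right-hand region occurs: at a crossing strand 1 exchanges W for S on its right and strand 2
  exchanges S for E, which matches the last summand of \<open>gauge\<close>.\<close>

definition seg_phase :: "nat \<Rightarrow> nat \<Rightarrow> int \<Rightarrow> complex" where
  "seg_phase t p m = of_int (K t p) * (lgamma f t (Suc p) - lgamma f t p) / 2
     - of_int m * of_int (G t (Suc p) - G t p)
     - (lbeta f t p + of_int (K t p)) * of_int (G t (Suc p) - G t p) / 2
     - lmu f (strand w t p) * of_int (G t (Suc p)) / 2"

definition level_phase :: "nat \<Rightarrow> nat list \<Rightarrow> complex" where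
  "level_phase t xs = (\<Sum>p<n. seg_phase t p (int (xs ! p)))"

definition crossing_long :: "nat \<Rightarrow> complex" where
  "crossing_long t = (let i = fst (w ! t) in (if snd (w ! t) then 1 else -1) / 2 *
     (lmu f (strand w t i) * of_int (K (Suc t) (Suc i) - K t i)
      + lmu f (strand w t (Suc i)) * of_int (K t (Suc i) - K (Suc t) i)))"

text \<open>Away from the crossing the integers and the coloring are the same at both levels, so
  those segment phases cancel. The four segments at the crossing reproduce
  \<open>gauge\<close>.\<close>

lemma crossM_gauge:
  assumes t: "t < length w" and zs: "zs \<in> states N n" and ys: "ys \<in> states N n"
  shows "crossM N w f' t zs ys = omega N (level_phase (Suc t) ys - level_phase t zs - crossing_long t)
     * crossM N w f t (shift_state N (K t) zs) (shift_state N (K (Suc t)) ys)"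
proof -
  define i where "i = fst (w ! t)"
  define pos where "pos = snd (w ! t)"
  have i: "Suc i < n" using braid t by (simp add: is_braid_def i_def)
  have N0: "N > 0" using N by simp
  have len: "length zs = n" "length ys = n" using zs ys by (auto simp: states_def)
  let ?zs = "shift_state N (K t) zs" and ?ys = "shift_state N (K (Suc t)) ys"
  \<comment> \<open>An untouched position is shifted by the same integer above and below. Equality
    of labels can be recovered from the shifted ones because labels lie below
    \<open>N\<close>.\<close>
  have cond: "(\<forall>q<length ?zs. q \<noteq> i \<and> q \<noteq> Suc i \<longrightarrow> ?zs ! q = ?ys ! q)
      \<longleftrightarrow> (\<forall>q<length zs. q \<noteq> i \<and> q \<noteq> Suc i \<longrightarrow> zs ! q = ys ! q)"
  proof -
    have "?zs ! q = ?ys ! q \<longleftrightarrow> zs ! q = ys ! q" if "q < n" "q \<noteq> i" "q \<noteq> Suc i" for q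
    proof
      assume "zs ! q = ys ! q"
      moreover have "K (Suc t) q = K t q" using K_unchanged[OF t] that by (simp add: i_def)
      ultimately show "?zs ! q = ?ys ! q" using that len by (simp add: shift_state_def)
    next
      assume eq: "?zs ! q = ?ys ! q"
      have "K (Suc t) q = K t q" using K_unchanged[OF t] that by (simp add: i_def)
      hence "(int (zs ! q) + K t q) mod int N = (int (ys ! q) + K t q) mod int N"
        using shift_state_nth[OF N0, of q zs "K t"] shift_state_nth[OF N0, of q ys "K (Suc t)"] eq that len by simp
      hence "(int (zs ! q) + K t q - K t q) mod int N = (int (ys ! q) + K t q - K t q) mod int N"
        by (rule mod_diff_cong) simp
      moreover have "zs ! q < N" "ys ! q < N" using zs ys that len by (auto simp: states_def)
      ultimately show "zs ! q = ys ! q" by simp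
    qed
    thus ?thesis using len by auto
  qed
  show ?thesis
  proof (cases "\<forall>q<length zs. q \<noteq> i \<and> q \<noteq> Suc i \<longrightarrow> zs ! q = ys ! q")
    case False
    hence "crossM N w f' t zs ys = 0" by (auto simp: crossM_def Let_def i_def)
    moreover have "crossM N w f t ?zs ?ys = 0"
      using False unfolding cond[symmetric] by (auto simp: crossM_def Let_def i_def)
    ultimately show ?thesis by simp
  next
    case True
    have sl: "strand w t i < n" "strand w t (Suc i) < n" using strand_less[OF braid] t i by auto
    define k where "k = (K t i, K t (Suc i), K (Suc t) (Suc i), K (Suc t) i)"
    define h where "h = (G t i, G t (Suc i), G t (Suc (Suc i)), G (Suc t) (Suc i))"
    have cd: "cross_data w f' t = cshift k h (cross_data w f t)"
      using t i K[of t i] K[of t "Suc i"] K[of "Suc t" "Suc i"] K[of "Suc t" i]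
        G[of t i] G[of t "Suc i"] G[of t "Suc (Suc i)"] G[of "Suc t" "Suc i"] mu[OF sl(1)] mu[OF sl(2)]
      by (simp add: cross_data_def Let_def i_def[symmetric] k_def h_def)
    have lc: "logcross pos (cross_data w f t)"
      using col(1) t by (simp add: is_log_coloring_def Let_def pos_def)
    have mods: "int (?zs ! i) mod int N = (int (zs ! i) + K t i) mod int N"
      "int (?zs ! Suc i) mod int N = (int (zs ! Suc i) + K t (Suc i)) mod int N"
      "int (?ys ! Suc i) mod int N = (int (ys ! Suc i) + K (Suc t) (Suc i)) mod int N"
      "int (?ys ! i) mod int N = (int (ys ! i) + K (Suc t) i) mod int N"
      using len i N0 by (auto simp: shift_state_nth)
    have "level_phase (Suc t) ys - level_phase t zs
        = (\<Sum>p<n. seg_phase (Suc t) p (int (ys ! p)) - seg_phase t p (int (zs ! p)))"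
      by (simp add: level_phase_def sum_subtractf)
    also have "\<dots> = (\<Sum>p\<in>{i, Suc i}. seg_phase (Suc t) p (int (ys ! p)) - seg_phase t p (int (zs ! p)))"
    proof (rule sum.mono_neutral_right)
      show "\<forall>p\<in>{..<n} - {i, Suc i}. seg_phase (Suc t) p (int (ys ! p)) - seg_phase t p (int (zs ! p)) = 0"
      proof
        fix p assume "p \<in> {..<n} - {i, Suc i}"
        hence p: "p < n" "p \<noteq> i" "p \<noteq> Suc i" by auto
        have "strand w (Suc t) p = strand w t p" using p by (simp add: Let_def i_def)
        moreover have "zs ! p = ys ! p" using True p len by simp
        ultimately show "seg_phase (Suc t) p (int (ys ! p)) - seg_phase t p (int (zs ! p)) = 0"
          using K_unchanged[OF t, of p] G_unchanged[OF t, of p] G_unchanged[OF t, of "Suc p"] p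
          by (simp add: seg_phase_def i_def)
      qed
    qed (use i in auto)
    finally have lp: "level_phase (Suc t) ys - level_phase t zs
       = seg_phase (Suc t) i (int (ys ! i)) - seg_phase t i (int (zs ! i))
       + (seg_phase (Suc t) (Suc i) (int (ys ! Suc i)) - seg_phase t (Suc i) (int (zs ! Suc i)))" by simp
    have st: "strand w (Suc t) i = strand w t (Suc i)" "strand w (Suc t) (Suc i) = strand w t i"
      by (simp_all add: Let_def i_def)
    have gu: "lgamma f (Suc t) i = lgamma f t i" "G (Suc t) i = G t i"
       "lgamma f (Suc t) (Suc (Suc i)) = lgamma f t (Suc (Suc i))" "G (Suc t) (Suc (Suc i)) = G t (Suc (Suc i))"
      using G_unchanged[OF t, of i] G_unchanged[OF t, of "Suc (Suc i)"] i by (auto simp: i_def)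
    have "gauge pos k h (cross_data w f t) (int (zs ! i)) (int (zs ! Suc i)) (int (ys ! Suc i)) (int (ys ! i))
       = level_phase (Suc t) ys - level_phase t zs - crossing_long t"
      unfolding lp k_def h_def cross_data_def crossing_long_def Let_def i_def[symmetric] pos_def[symmetric] gauge.simps
        seg_phase_def st gu
      by (simp add: field_simps)
    moreover have "crossM N w f' t zs ys
        = Rmat N pos (cross_data w f' t) (int (zs ! i)) (int (zs ! Suc i)) (int (ys ! Suc i)) (int (ys ! i))"
      using True by (simp add: crossM_def Let_def i_def pos_def)
    moreover have "crossM N w f t ?zs ?ys
        = Rmat N pos (cross_data w f t) (int (?zs ! i)) (int (?zs ! Suc i)) (int (?ys ! Suc i)) (int (?ys ! i))"
      using True unfolding cond[symmetric] by (simp add: crossM_def Let_def i_def pos_def)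
    ultimately show ?thesis
      using Rmat_gauge[OF N lc k_def mods, of h] by (simp only: cd)
  qed
qed

text \<open>The phase of the intermediate state cancels between the partial product and the next
  crossing. What remains in the sum depends on that state only through its cyclic shift, a bijection
  of the states, so the shift is absorbed by reindexing.\<close>

lemma Jpart_gauge:
  assumes "\<And>p. p < n \<Longrightarrow> K 0 p = 0" "\<And>r. r \<le> n \<Longrightarrow> G 0 r = 0"
    and "t \<le> length w" "xs \<in> states N n" "ys \<in> states N n"
  shows "Jpart N n w f' t xs ys
     = omega N (level_phase t ys - (\<Sum>u<t. crossing_long u)) * Jpart N n w f t xs (shift_state N (K t) ys)"
  using assms(3,5)
proof (induction t arbitrary: ys)
  case 0
  have "level_phase 0 ys = 0" using assms(1,2) by (simp add: level_phase_def seg_phase_def)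
  thus ?case using shift_state_id[OF 0(2), of "K 0"] assms(1) by (simp add: omega_simps)
next
  case (Suc t)
  let ?M = "\<Sum>u<t. crossing_long u"
  let ?ys = "shift_state N (K (Suc t)) ys"
  have t: "t < length w" using Suc by simp
  have "Jpart N n w f' (Suc t) xs ys = (\<Sum>zs\<in>states N n. Jpart N n w f' t xs zs * crossM N w f' t zs ys)" by simp
  also have "\<dots> = (\<Sum>zs\<in>states N n. omega N (level_phase (Suc t) ys - (?M + crossing_long t))
      * (Jpart N n w f t xs (shift_state N (K t) zs) * crossM N w f t (shift_state N (K t) zs) ?ys))"
  proof (rule sum.cong[OF refl])
    fix zs assume zs: "zs \<in> states N n"
    have "level_phase (Suc t) ys - (?M + crossing_long t)
        = (level_phase t zs - ?M) + (level_phase (Suc t) ys - level_phase t zs - crossing_long t)" by simp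
    hence om: "omega N (level_phase (Suc t) ys - (?M + crossing_long t))
       = omega N (level_phase t zs - ?M) * omega N (level_phase (Suc t) ys - level_phase t zs - crossing_long t)"
      by (simp only: omega_simps(1))
    have "Jpart N n w f' t xs zs = omega N (level_phase t zs - ?M) * Jpart N n w f t xs (shift_state N (K t) zs)"
      using Suc.IH[OF _ zs] t by simp
    thus "Jpart N n w f' t xs zs * crossM N w f' t zs ys = omega N (level_phase (Suc t) ys - (?M + crossing_long t))
      * (Jpart N n w f t xs (shift_state N (K t) zs) * crossM N w f t (shift_state N (K t) zs) ?ys)"
      unfolding om crossM_gauge[OF t zs Suc.prems(2)] by (simp only: mult_ac)
  qed
  also have "\<dots> = omega N (level_phase (Suc t) ys - (?M + crossing_long t))
      * (\<Sum>zs\<in>states N n. Jpart N n w f t xs (shift_state N (K t) zs) * crossM N w f t (shift_state N (K t) zs) ?ys)"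
    by (simp only: sum_distrib_left)
  also have "(\<Sum>zs\<in>states N n. Jpart N n w f t xs (shift_state N (K t) zs) * crossM N w f t (shift_state N (K t) zs) ?ys)
      = (\<Sum>zs\<in>states N n. Jpart N n w f t xs zs * crossM N w f t zs ?ys)"
    by (rule sum.reindex_bij_betw[OF bij_betw_shift_state]) (use N in simp)
  finally show ?case by simp
qed

text \<open>The left side is organised by crossings, the longitudes by components. After exchanging
  the sums, each crossing selects the components of its two strands.\<close>

lemma sum_crossing_long:
  "(\<Sum>u<length w. crossing_long u) = (\<Sum>j<n. (loglong w f' j - loglong w f j) * lmu f j)"
proof -
  define d where "d = (\<lambda>j u. let i = fst (w ! u); s = (if snd (w ! u) then 1 else -1 :: complex) in
     s / 2 * ((if strand w u i = j then of_int (K (Suc u) (Suc i) - K u i) else 0)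
        + (if strand w u (Suc i) = j then of_int (K u (Suc i) - K (Suc u) i) else 0)))"
  have "loglong w f' j - loglong w f j = (\<Sum>u<length w. d j u)" for j
    unfolding loglong_def right_diff_distrib[symmetric] sum_subtractf[symmetric] sum_distrib_left
  proof (rule sum.cong[OF refl])
    fix u assume "u \<in> {..<length w}"
    hence u: "u < length w" by simp
    define i where "i = fst (w ! u)"
    have i: "Suc i < n" using braid u by (simp add: is_braid_def i_def)
    show "1 / 2 * ((let i = fst (w ! u); \<epsilon> = if snd (w ! u) then 1 else - 1 :: complex; \<beta> = lbeta f' in
        \<epsilon> * ((if strand w u i = j then \<beta> (Suc u) (Suc i) - \<beta> u i else 0) + (if strand w u (Suc i) = j then \<beta> u (Suc i) - \<beta> (Suc u) i else 0)))
      - (let i = fst (w ! u); \<epsilon> = if snd (w ! u) then 1 else - 1 :: complex; \<beta> = lbeta f in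
        \<epsilon> * ((if strand w u i = j then \<beta> (Suc u) (Suc i) - \<beta> u i else 0) + (if strand w u (Suc i) = j then \<beta> u (Suc i) - \<beta> (Suc u) i else 0))))
      = d j u"
      unfolding d_def Let_def i_def[symmetric]
      using u i K[of u i] K[of u "Suc i"] K[of "Suc u" "Suc i"] K[of "Suc u" i]
      by (simp add: field_simps)
  qed
  hence "(\<Sum>j<n. (loglong w f' j - loglong w f j) * lmu f j) = (\<Sum>j<n. \<Sum>u<length w. d j u * lmu f j)"
    by (simp add: sum_distrib_right)
  also have "\<dots> = (\<Sum>u<length w. \<Sum>j<n. d j u * lmu f j)" by (rule sum.swap)
  also have "\<dots> = (\<Sum>u<length w. crossing_long u)"
  proof (rule sum.cong[OF refl])
    fix u assume "u \<in> {..<length w}"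
    hence u: "u < length w" by simp
    define i where "i = fst (w ! u)"
    define s where "s = (if snd (w ! u) then 1 else -1 :: complex)"
    define A B where "A = complex_of_int (K (Suc u) (Suc i) - K u i)" and "B = complex_of_int (K u (Suc i) - K (Suc u) i)"
    have i: "Suc i < n" using braid u by (simp add: is_braid_def i_def)
    have sl: "strand w u i < n" "strand w u (Suc i) < n" using strand_less[OF braid] u i by auto
    have "d j u * lmu f j = s / 2 * ((if strand w u i = j then A * lmu f j else 0)
        + (if strand w u (Suc i) = j then B * lmu f j else 0))" for j
      unfolding d_def Let_def i_def[symmetric] s_def[symmetric] A_def[symmetric] B_def[symmetric] by (simp add: distrib_right)
    hence "(\<Sum>j<n. d j u * lmu f j) = s / 2 * ((\<Sum>j<n. if strand w u i = j then A * lmu f j else 0)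
        + (\<Sum>j<n. if strand w u (Suc i) = j then B * lmu f j else 0))"
      by (simp only: sum_distrib_left[symmetric] sum.distrib)
    also have "\<dots> = s / 2 * (A * lmu f (strand w u i) + B * lmu f (strand w u (Suc i)))"
      using sl by (simp add: sum.delta)
    also have "\<dots> = crossing_long u"
      unfolding crossing_long_def Let_def i_def[symmetric] s_def[symmetric] A_def[symmetric] B_def[symmetric]
      by (simp only: mult_ac)
    finally show "(\<Sum>j<n. d j u * lmu f j) = crossing_long u" .
  qed
  finally show ?thesis ..
qed

end

theorem theorem5p5:
  fixes N n :: nat and w :: "(nat \<times> bool) list" and f f' :: logcol
    and chi :: "nat \<Rightarrow> nat \<Rightarrow> complex \<times> complex \<times> complex"
  assumes "N \<ge> 2"
    and "is_braid n w"
    and "is_log_coloring n w f" and "is_log_coloring n w f'"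
    and "\<forall>t \<le> length w. \<forall>p < n. chi_of N w f t p = chi t p"
    and "\<forall>t \<le> length w. \<forall>p < n. chi_of N w f' t p = chi t p"
    and "\<forall>p < n. lbeta f' 0 p = lbeta f 0 p \<and> lbeta f' (length w) p = lbeta f (length w) p"
    and "\<forall>r \<le> n. lgamma f' 0 r = lgamma f 0 r \<and> lgamma f' (length w) r = lgamma f (length w) r"
    and "\<forall>j < n. lmu f' j = lmu f j"
  shows "\<forall>xs\<in>states N n. \<forall>ys\<in>states N n.
           Jop N n w f' xs ys =
             exp (- (2 * of_real pi * \<i> / of_nat N)
                  * (\<Sum>j<n. (loglong w f' j - loglong w f j) * lmu f j))
             * Jop N n w f xs ys"
proof (intro ballI)
  fix xs ys assume xs: "xs \<in> states N n" and ys: "ys \<in> states N n"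
  have int_diff: "\<exists>k::int. x = y + of_int k" if "ee x = ee y" for x y
  proof -
    have "ee (x - y) = 1" using that ee_simps(4) by (simp add: ee_simps(2))
    then obtain k where "x - y = of_int k" by (auto simp: ee_eq_1_iff elim: Ints_cases)
    thus ?thesis by (intro exI[of _ k]) (simp add: algebra_simps)
  qed
  have "\<exists>k::int. lbeta f' t p = lbeta f t p + of_int k" if "t \<le> length w" "p < n" for t p
  proof (rule int_diff)
    have "chi_of N w f' t p = chi_of N w f t p" using assms(5,6) that by simp
    thus "ee (lbeta f' t p) = ee (lbeta f t p)" by (simp add: chi_of_def)
  qed
  then obtain K where K: "\<And>t p. t \<le> length w \<Longrightarrow> p < n \<Longrightarrow> lbeta f' t p = lbeta f t p + complex_of_int (K t p)"
    by metis
  \<comment> \<open>The coloring determines only differences of \<gamma> modulo integers, so an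
    anchor is needed at every level. The leftmost region serves: a crossing changes region
    \<open>Suc i\<close>, never region 0.\<close>
  have left: "lgamma g t 0 = lgamma g 0 0" if "is_log_coloring n w g" "t \<le> length w" for g t
    using that(2)
  proof (induction t)
    case (Suc t)
    hence "lgamma g (Suc t) 0 = lgamma g t 0"
      using that(1) unfolding is_log_coloring_def Let_def by (metis Suc_le_eq nat.distinct(1) le0)
    thus ?case using Suc by simp
  qed simp
  have "\<exists>k::int. lgamma f' t r = lgamma f t r + of_int k" if "t \<le> length w" "r \<le> n" for t r
    using that(2)
  proof (induction r)
    case 0
    have "lgamma f' t 0 = lgamma f t 0"
      using left[OF assms(3) that(1)] left[OF assms(4) that(1)] assms(8) by simp
    thus ?case by (intro exI[of _ 0]) simp
  next
    case (Suc r)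
    then obtain k :: int where k: "lgamma f' t r = lgamma f t r + of_int k" by auto
    have "chi_of N w f' t r = chi_of N w f t r" using assms(5,6) Suc that(1) by simp
    hence "ee (lgamma f' t (Suc r) - lgamma f' t r) = ee (lgamma f t (Suc r) - lgamma f t r)"
      by (simp add: chi_of_def)
    from int_diff[OF this] obtain l :: int
      where "lgamma f' t (Suc r) - lgamma f' t r = lgamma f t (Suc r) - lgamma f t r + of_int l" by blast
    thus ?case using k by (intro exI[of _ "k + l"]) (simp add: algebra_simps)
  qed
  then obtain G where G: "\<And>t r. t \<le> length w \<Longrightarrow> r \<le> n \<Longrightarrow> lgamma f' t r = lgamma f t r + complex_of_int (G t r)"
    by metis
  interpret shifted_log_colorings N n w f f' K G
    by standard (use assms K G in auto)
  have K0: "K 0 p = 0" "K (length w) p = 0" if "p < n" for p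
    using K[of 0 p] K[of "length w" p] that assms(7) by auto
  have G0: "G 0 r = 0" "G (length w) r = 0" if "r \<le> n" for r
    using G[of 0 r] G[of "length w" r] that assms(8) by auto
  \<comment> \<open>Agreement at the bottom boundary makes the final change of basis
    trivial.\<close>
  have "level_phase (length w) ys = 0" using K0 G0 by (simp add: level_phase_def seg_phase_def)
  moreover have "shift_state N (K (length w)) ys = ys" using shift_state_id[OF ys] K0 by blast
  ultimately have "Jop N n w f' xs ys = omega N (- (\<Sum>u<length w. crossing_long u)) * Jop N n w f xs ys"
    unfolding Jop_def using Jpart_gauge[OF K0(1) G0(1) order.refl xs ys] by simp
  thus "Jop N n w f' xs ys = exp (- (2 * of_real pi * \<i> / of_nat N)
                  * (\<Sum>j<n. (loglong w f' j - loglong w f j) * lmu f j)) * Jop N n w f xs ys"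
    unfolding sum_crossing_long omega_def by simp
qed

end
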